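(* Let $n,k\ge1$ and let $H=\sum_{P\in\{I,X,Y,Z\}^{\otimes n}:|P|\le k}\alpha_P P$ ($\alpha_P\in\mathbb{R}$) be an $n$-qubit $k$-local Hamiltonian with expansion coefficient $c_e$ and expansion dimension $d_e$. Let $r=2d_e/(d_e+1)\in[1,2)$ and $\mathsf{nnz}(H)=|\{P:\alpha_P\ne0\}|$. There is a randomized algorithm that runs in time $\mathcal{O}(nk+\mathsf{nnz}(H)2^k)$ and produces either a random maximizing state $|\psi\rangle=|\psi_1\rangle\otimes\cdots\otimes|\psi_n\rangle$ satisfying $$\mathbb{E}_{|\psi\rangle}\big[\langle\psi|H|\psi\rangle\big]\ge\mathbb{E}_{|\phi\rangle:\mathrm{Haar}}\big[\langle\phi|H|\phi\rangle\big]+C(c_e,d_e,k)\left(\sum_{P\ne I}|\alpha_P|^r\right)^{1/r},$$ or a random minimizing state $|\psi\rangle=|\psi_1\rangle\otimes\cdots\otimes|\psi_n\rangle$ satisfying $$\mathbb{E}_{|\psi\rangle}\big[\langle\psi|H|\psi\rangle\big]\le\mathbb{E}_{|\phi\rangle:\mathrm{Haar}}\big[\langle\phi|H|\phi\rangle\big]-C(c_e,d_e,k)\left(\sum_{P\ne I}|\alpha_P|^r\right)^{1/r},$$ where $$C(c_e,d_e,k)=\frac{\sqrt{2(k!)}}{c_e^{1/(2d_e)}\,k^{\,k+1.5+1/r}\,(\sqrt6+2\sqrt3)^k}.$$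
   Context: $\{I,X,Y,Z\}^{\otimes n}$ is the set of $n$-qubit Pauli observables $P=P_1\otimes\cdots\otimes P_n$; $\mathsf{dom}(P)=\{i:P_i\neq I\}$ and $|P|=|\mathsf{dom}(P)|$; "$P\ne I$" means $P\ne I^{\otimes n}$. Expansion property: $H=\sum_P\alpha_P P$ has expansion coefficient $c_e$ and expansion dimension $d_e$ ($c_e\ge1$, $d_e\in\{1,\dots,n\}$) if for every $\Upsilon\subseteq\{1,\dots,n\}$ with $|\Upsilon|=d_e$, the number of $P\in\{I,X,Y,Z\}^{\otimes n}$ with $\alpha_P\ne0$ and ($\Upsilon\subseteq\mathsf{dom}(P)$ or $\mathsf{dom}(P)\subseteq\Upsilon$) is at most $c_e$. The Haar expectation is over Haar-random $n$-qubit pure states. $\mathbb{E}_{|\psi\rangle}$ is over the algorithm's randomness; which of the two alternatives occurs is not controlled. *)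

theory Defs
  imports "HOL-Probability.Probability"
begin

text \<open>
  Qubits are numbered from 0 to n - 1. A computational basis state of n qubits is a number
  x < 2^n whose binary digit i is the value of qubit i. Vectors of the n-qubit space are functions
  on the numbers below 2^n, operators are given by their matrix entries in this basis.
\<close>

datatype pauli = PI | PX | PY | PZ

fun pauli_entry :: "pauli \<Rightarrow> bool \<Rightarrow> bool \<Rightarrow> complex" where
  "pauli_entry PI a b = (if a = b then 1 else 0)"
| "pauli_entry PX a b = (if a \<noteq> b then 1 else 0)"
| "pauli_entry PY a b = (if a = b then 0 else if a then \<i> else - \<i>)"
| "pauli_entry PZ a b = (if a \<noteq> b then 0 else if a then - 1 else 1)"

definition paulis :: "nat \<Rightarrow> pauli list set" where
  "paulis n = {P. length P = n}"

definition pauli_id :: "nat \<Rightarrow> pauli list" where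
  "pauli_id n = replicate n PI"

definition pauli_dom :: "pauli list \<Rightarrow> nat set" where
  "pauli_dom P = {i. i < length P \<and> P ! i \<noteq> PI}"

definition pauli_weight :: "pauli list \<Rightarrow> nat" where
  "pauli_weight P = card (pauli_dom P)"

definition pauli_op :: "pauli list \<Rightarrow> nat \<Rightarrow> nat \<Rightarrow> complex" where
  "pauli_op P x y = (\<Prod>i<length P. pauli_entry (P ! i) (bit x i) (bit y i))"

definition hamiltonian :: "nat \<Rightarrow> (pauli list \<Rightarrow> real) \<Rightarrow> nat \<Rightarrow> nat \<Rightarrow> complex" where
  "hamiltonian n \<alpha> x y = (\<Sum>P\<in>paulis n. complex_of_real (\<alpha> P) * pauli_op P x y)"

text \<open>The expectation value of a Hermitian operator is real; \<open>Re\<close> only adjusts the type.\<close>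

definition expval :: "nat \<Rightarrow> (nat \<Rightarrow> nat \<Rightarrow> complex) \<Rightarrow> (nat \<Rightarrow> complex) \<Rightarrow> real" where
  "expval n A \<phi> = Re (\<Sum>x<2^n. \<Sum>y<2^n. cnj (\<phi> x) * A x y * \<phi> y)"

text \<open>A single-qubit vector is the pair of its amplitudes at 0 and 1.\<close>

type_synonym qubit = "complex \<times> complex"

definition unit_qubit :: "qubit \<Rightarrow> bool" where
  "unit_qubit q \<longleftrightarrow> (cmod (fst q))\<^sup>2 + (cmod (snd q))\<^sup>2 = 1"

definition product_state :: "nat \<Rightarrow> (nat \<Rightarrow> qubit) \<Rightarrow> nat \<Rightarrow> complex" where
  "product_state n q x = (\<Prod>i<n. if bit x i then snd (q i) else fst (q i))"

definition k_local :: "nat \<Rightarrow> nat \<Rightarrow> (pauli list \<Rightarrow> real) \<Rightarrow> bool" where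
  "k_local n k \<alpha> \<longleftrightarrow> (\<forall>P\<in>paulis n. \<alpha> P \<noteq> 0 \<longrightarrow> pauli_weight P \<le> k)"

definition nnz :: "nat \<Rightarrow> (pauli list \<Rightarrow> real) \<Rightarrow> nat" where
  "nnz n \<alpha> = card {P\<in>paulis n. \<alpha> P \<noteq> 0}"

definition expansion :: "nat \<Rightarrow> (pauli list \<Rightarrow> real) \<Rightarrow> real \<Rightarrow> nat \<Rightarrow> bool" where
  "expansion n \<alpha> c d \<longleftrightarrow> c \<ge> 1 \<and> d \<in> {1..n} \<and>
     (\<forall>\<Upsilon>. \<Upsilon> \<subseteq> {..<n} \<and> card \<Upsilon> = d \<longrightarrow>
        real (card {P\<in>paulis n. \<alpha> P \<noteq> 0 \<and> (\<Upsilon> \<subseteq> pauli_dom P \<or> pauli_dom P \<subseteq> \<Upsilon>)}) \<le> c)"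

definition rexpo :: "nat \<Rightarrow> real" where
  "rexpo d = 2 * real d / (real d + 1)"

definition coeff_norm :: "nat \<Rightarrow> (pauli list \<Rightarrow> real) \<Rightarrow> real \<Rightarrow> real" where
  "coeff_norm n \<alpha> r = (\<Sum>P\<in>paulis n - {pauli_id n}. \<bar>\<alpha> P\<bar> powr r) powr (1 / r)"

definition gain_const :: "real \<Rightarrow> nat \<Rightarrow> nat \<Rightarrow> real" where
  "gain_const c d k = sqrt (2 * fact k) /
     (c powr (1 / (2 * real d)) * real k powr (real k + 1.5 + 1 / rexpo d)
        * (sqrt 6 + 2 * sqrt 3) ^ k)"

definition unitary :: "nat \<Rightarrow> (nat \<Rightarrow> nat \<Rightarrow> complex) \<Rightarrow> bool" where
  "unitary N U \<longleftrightarrow> (\<forall>x<N. \<forall>y<N. (\<Sum>z<N. cnj (U z x) * U z y) = (if x = y then 1 else 0))"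

definition apply_op :: "nat \<Rightarrow> (nat \<Rightarrow> nat \<Rightarrow> complex) \<Rightarrow> (nat \<Rightarrow> complex) \<Rightarrow> nat \<Rightarrow> complex" where
  "apply_op N U \<phi> = (\<lambda>x\<in>{..<N}. \<Sum>y<N. U x y * \<phi> y)"

text \<open>
  The Haar distribution of n-qubit pure states: the Borel probability measure that is
  concentrated on the unit sphere of the 2^n-dimensional space and invariant under all unitaries.
  Such a measure exists and is unique, so quantifying over it amounts to naming it.
\<close>

definition haar_state_measure :: "nat \<Rightarrow> (nat \<Rightarrow> complex) measure \<Rightarrow> bool" where
  "haar_state_measure n \<mu> \<longleftrightarrow>
     sets \<mu> = sets (PiM {..<2^n} (\<lambda>_. borel)) \<and>
     prob_space \<mu> \<and>
     (AE \<phi> in \<mu>. (\<Sum>x<2^n. (cmod (\<phi> x))\<^sup>2) = 1) \<and>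
     (\<forall>U. unitary (2^n) U \<longrightarrow> distr \<mu> \<mu> (apply_op (2^n) U) = \<mu>)"

text \<open>
  The model of computation is a randomized real random access machine. Its memory consists of named
  arrays (a program mentions finitely many) of natural numbers and of real numbers; a scalar
  variable is cell 0 of an array. Every step of the machine costs one unit of time. Expressions
  have a size fixed by the program, so evaluating them within one step affects running times by a
  constant factor only.

  Integer arithmetic is limited to addition and subtraction (so the length of an integer grows by
  at most a constant per step). Real arithmetic is exact and
  includes powers, which are needed for exponents such as r and for normalising amplitudes. The only
  constants are natural numbers, and reals cannot be rounded to integers, so the digits of a real
  number cannot serve as an advice string or as a packed data structure.
\<close>

type_synonym vname = string

datatype iexp =
    INat nat
  | ICell vname iexp
  | IAdd iexp iexp
  | ISub iexp iexp

datatype rexp =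
    RNat iexp
  | RCell vname iexp
  | RAdd rexp rexp
  | RSub rexp rexp
  | RMul rexp rexp
  | RDiv rexp rexp
  | RPow rexp rexp

datatype test =
    ILess iexp iexp
  | RLess rexp rexp
  | TNot test
  | TAnd test test

datatype com =
    Skip
  | IStore vname iexp iexp
  | RStore vname iexp rexp
  | Coin vname iexp rexp
  | Seq com com
  | Cond test com com
  | Loop test com

record store =
  ints :: "vname \<Rightarrow> nat \<Rightarrow> nat"
  reals :: "vname \<Rightarrow> nat \<Rightarrow> real"

fun ival :: "store \<Rightarrow> iexp \<Rightarrow> nat" where
  "ival s (INat m) = m"
| "ival s (ICell a i) = ints s a (ival s i)"
| "ival s (IAdd e f) = ival s e + ival s f"
| "ival s (ISub e f) = ival s e - ival s f"

text \<open>Powers are taken of the absolute value of the base, so \<open>powr\<close> is never used outside its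
  intended domain.\<close>

fun rval :: "store \<Rightarrow> rexp \<Rightarrow> real" where
  "rval s (RNat e) = real (ival s e)"
| "rval s (RCell a i) = reals s a (ival s i)"
| "rval s (RAdd e f) = rval s e + rval s f"
| "rval s (RSub e f) = rval s e - rval s f"
| "rval s (RMul e f) = rval s e * rval s f"
| "rval s (RDiv e f) = rval s e / rval s f"
| "rval s (RPow e f) = \<bar>rval s e\<bar> powr rval s f"

fun tval :: "store \<Rightarrow> test \<Rightarrow> bool" where
  "tval s (ILess e f) \<longleftrightarrow> ival s e < ival s f"
| "tval s (RLess e f) \<longleftrightarrow> rval s e < rval s f"
| "tval s (TNot t) \<longleftrightarrow> \<not> tval s t"
| "tval s (TAnd t u) \<longleftrightarrow> tval s t \<and> tval s u"

definition set_int :: "vname \<Rightarrow> nat \<Rightarrow> nat \<Rightarrow> store \<Rightarrow> store" where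
  "set_int a i v s = s\<lparr>ints := (ints s)(a := (ints s a)(i := v))\<rparr>"

definition set_real :: "vname \<Rightarrow> nat \<Rightarrow> real \<Rightarrow> store \<Rightarrow> store" where
  "set_real a i v s = s\<lparr>reals := (reals s)(a := (reals s a)(i := v))\<rparr>"

text \<open>
  A configuration is the stack of commands still to be executed together with the memory.
  \<open>Coin a i e\<close> stores 1 with probability e and 0 otherwise (\<open>bernoulli_pmf\<close> clips e to the unit
  interval). A halted machine stays as it is.
\<close>

type_synonym config = "com list \<times> store"

fun step :: "config \<Rightarrow> config pmf" where
  "step ([], s) = return_pmf ([], s)"
| "step (Skip # K, s) = return_pmf (K, s)"
| "step (IStore a i e # K, s) = return_pmf (K, set_int a (ival s i) (ival s e) s)"
| "step (RStore a i e # K, s) = return_pmf (K, set_real a (ival s i) (rval s e) s)"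
| "step (Coin a i e # K, s) =
     map_pmf (\<lambda>b. (K, set_int a (ival s i) (if b then 1 else 0) s)) (bernoulli_pmf (rval s e))"
| "step (Seq p q # K, s) = return_pmf (p # q # K, s)"
| "step (Cond t p q # K, s) = return_pmf ((if tval s t then p else q) # K, s)"
| "step (Loop t p # K, s) = return_pmf (if tval s t then p # Loop t p # K else K, s)"

primrec run :: "nat \<Rightarrow> config \<Rightarrow> config pmf" where
  "run 0 c = return_pmf c"
| "run (Suc t) c = bind_pmf (step c) (run t)"

definition halts_within :: "com \<Rightarrow> store \<Rightarrow> nat \<Rightarrow> bool" where
  "halts_within p s t \<longleftrightarrow> (\<forall>c\<in>set_pmf (run t ([p], s)). fst c = [])"

text \<open>
  Sparse input format. The Pauli observables with nonzero coefficient are listed in the order Ps.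
  Cell j of \<open>coeff\<close> and of \<open>weight\<close> holds the coefficient and the weight of the j-th of them; the
  qubits it acts on and the codes of the Pauli matrices there are stored, one observable after the
  other, in \<open>site\<close> and \<open>pauli\<close>. All other cells are initially 0.
\<close>

fun pauli_code :: "pauli \<Rightarrow> nat" where
  "pauli_code PI = 0" | "pauli_code PX = 1" | "pauli_code PY = 2" | "pauli_code PZ = 3"

definition sites :: "pauli list \<Rightarrow> nat list" where
  "sites P = sorted_list_of_set (pauli_dom P)"

definition cells :: "'a::zero list \<Rightarrow> nat \<Rightarrow> 'a" where
  "cells xs j = (if j < length xs then xs ! j else 0)"

definition input_store ::
    "nat \<Rightarrow> nat \<Rightarrow> nat \<Rightarrow> (pauli list \<Rightarrow> real) \<Rightarrow> pauli list list \<Rightarrow> store" where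
  "input_store n k d \<alpha> Ps =
     \<lparr>ints = (\<lambda>_ _. 0)
        (''n'' := cells [n], ''k'' := cells [k], ''d'' := cells [d],
         ''nnz'' := cells [length Ps],
         ''weight'' := cells (map pauli_weight Ps),
         ''site'' := cells (concat (map sites Ps)),
         ''pauli'' := cells (concat (map (\<lambda>P. map (\<lambda>i. pauli_code (P ! i)) (sites P)) Ps))),
      reals = (\<lambda>_ _. 0)(''coeff'' := cells (map \<alpha> Ps))\<rparr>"

text \<open>The output is the list of the amplitudes of the n single-qubit states.\<close>

definition output_qubits :: "store \<Rightarrow> nat \<Rightarrow> qubit" where
  "output_qubits s i = (Complex (reals s ''re0'' i) (reals s ''im0'' i),
                        Complex (reals s ''re1'' i) (reals s ''im1'' i))"

definition output_pmf :: "com \<Rightarrow> store \<Rightarrow> nat \<Rightarrow> (nat \<Rightarrow> qubit) pmf" where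
  "output_pmf p s t = map_pmf (\<lambda>c. output_qubits (snd c)) (run t ([p], s))"

end

theory Submission
  imports Defs
begin

text \<open>
  Identify the Pauli matrix \<open>p\<close> on qubit \<open>i\<close> with a variable \<open>3 * i + pauli_code p\<close> and an observable
  with the set of its variables, so that \<open>H\<close> becomes a multilinear polynomial. A product of cube corner
  states (Bloch vectors \<open>(\<plusminus>1, \<plusminus>1, \<plusminus>1) / sqrt 3\<close>) evaluates it at a sign vector, with \<open>\<alpha> P\<close> scaled by
  \<open>3 powr (- |P| / 2)\<close>, and independent random signs with means \<open>m\<close> evaluate it at \<open>m\<close> in expectation.

  The means are \<open>m = (v + t * w) / 2\<close>. With the powers of 2 absorbed into the coefficients (which
  become \<open>amp\<close>), the derivative at \<open>t = 0\<close> is \<open>\<Sum>u. w u * g u v\<close>, where \<open>g u\<close> is the partial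
  derivative in direction \<open>u\<close>; choosing \<open>w u\<close> as the sign of \<open>g u v\<close> makes it
  \<open>\<Sum>u. |g u v|\<close>. A polynomial in \<open>t\<close> of degree \<open>k\<close> with a large derivative at 0 is large at one of
  the \<open>2 * k + 1\<close> points \<open>(q - k) / k\<close>, by a central difference formula.

  The sign vector \<open>v\<close> cannot be chosen at random: a single program has to commit to one of the two
  alternatives, and random gains of both signs may cancel. It is found by conditional expectations.
  Bound \<open>|g|\<close> below by \<open>a * g^2 - b * g^4\<close>. After some variables are fixed, the square sum of
  the coefficients of \<open>g\<close> is the conditional mean of \<open>g^2\<close>, and the square of the sum of
  \<open>3 ^ |R| * (coefficient of R)^2\<close> is a supermartingale that ends in \<open>g^4\<close>. Coefficients that become
  equal monomials have to be merged; they are kept in a trie, and fixing the variables in decreasing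
  order merges every node into its parent.

  Finally \<open>\<Sum>u. sqrt (mean of (g u)^2)\<close> is bounded below by the \<open>r\<close>-norm of the
  coefficients through Blei's mixed norm inequality and the expansion property.
\<close>

subsection \<open>Running times of deterministic programs\<close>

text \<open>All choices before the sampling are deterministic, so the sign of one number,
  \<open>ray_poly\<close> at the chosen \<open>t\<close>, decides which alternative occurs. The
  weight 3 comes from the hypercontractive bound E g^4 <= 9^deg (E g^2)^2 on the cube: the
  conditional fourth moment itself would need sums over quadruples of monomials, whereas the squared
  weighted sum dominates it and needs one number per monomial. For a derivative g of square norm V
  put K = 3^(k-1) and r = K sqrt V. The quartic 3/(2r) g^2 - 1/(2r^3) g^4 touches |g| at |g| = r,
  and its initial estimate is 3/2 - 1/2 = 1 times sqrt V / K. The total loss is therefore 12^(k/2)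
  (per site sqrt 3 for the corner states and 2 for the means), 3^(k-1) for the signs and k^2 for the
  central difference. This beats the claimed constant because there k^k stands against sqrt(k!)
  only, which leaves about k^(k/2) to spare. The time bound rests on the trie having at most nnz *
  k^2 nodes, each merged once, and on k^2 <= 2 * 2^k; the term n * k pays for the table of multiples
  and for loops over the variables.\<close>

primrec int_writes :: "com \<Rightarrow> vname set" where
  "int_writes Skip = {}"
| "int_writes (IStore a i e) = {a}"
| "int_writes (RStore a i e) = {}"
| "int_writes (Coin a i e) = {a}"
| "int_writes (Seq p q) = int_writes p \<union> int_writes q"
| "int_writes (Cond t p q) = int_writes p \<union> int_writes q"
| "int_writes (Loop t p) = int_writes p"

primrec real_writes :: "com \<Rightarrow> vname set" where
  "real_writes Skip = {}"
| "real_writes (IStore a i e) = {}"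
| "real_writes (RStore a i e) = {a}"
| "real_writes (Coin a i e) = {}"
| "real_writes (Seq p q) = real_writes p \<union> real_writes q"
| "real_writes (Cond t p q) = real_writes p \<union> real_writes q"
| "real_writes (Loop t p) = real_writes p"

text \<open>Built into \<open>wp\<close>, so that arrays a program never writes need not be
  mentioned in any invariant.\<close>

definition frame :: "com \<Rightarrow> store \<Rightarrow> store \<Rightarrow> bool" where
  "frame c s s' \<longleftrightarrow> (\<forall>a. a \<notin> int_writes c \<longrightarrow> ints s' a = ints s a) \<and>
     (\<forall>a. a \<notin> real_writes c \<longrightarrow> reals s' a = reals s a)"

lemma frame_refl: "frame c s s"
  by (simp add: frame_def)

lemma frame_trans:
  assumes "frame c s s'" "frame c' s' s''"
    "int_writes c \<union> int_writes c' \<subseteq> int_writes d" "real_writes c \<union> real_writes c' \<subseteq> real_writes d"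
  shows "frame d s s''"
  using assms unfolding frame_def by (metis Un_iff subset_eq)

lemma frame_ints: "frame c s s' \<Longrightarrow> a \<notin> int_writes c \<Longrightarrow> ints s' a = ints s a"
  and frame_reals: "frame c s s' \<Longrightarrow> a \<notin> real_writes c \<Longrightarrow> reals s' a = reals s a"
  by (simp_all add: frame_def)

lemma run_add: "run (m + n) c = bind_pmf (run m c) (run n)"
proof (induction m arbitrary: c)
  case (Suc m)
  then have "run (m + n) = (\<lambda>c. bind_pmf (run m c) (run n))" by blast
  then show ?case by (simp add: bind_assoc_pmf)
qed (simp add: bind_return_pmf)

definition reaches :: "com \<Rightarrow> store \<Rightarrow> nat \<Rightarrow> store \<Rightarrow> bool" where
  "reaches c s m s' \<longleftrightarrow> (\<forall>K. run m (c # K, s) = return_pmf (K, s'))"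

text \<open>A total correctness statement with a step budget. It asks for a single final store, so
  it is meant for programs without coins; \<open>yields\<close> takes over for the sampling.\<close>

definition wp :: "com \<Rightarrow> store \<Rightarrow> nat \<Rightarrow> (store \<Rightarrow> bool) \<Rightarrow> bool" where
  "wp c s n Q \<longleftrightarrow> (\<exists>m\<le>n. \<exists>s'. Q s' \<and> frame c s s' \<and> reaches c s m s')"

lemma wp_mono: "wp c s n Q \<Longrightarrow> n \<le> n' \<Longrightarrow> (\<And>s'. Q s' \<Longrightarrow> frame c s s' \<Longrightarrow> R s') \<Longrightarrow> wp c s n' R"
  unfolding wp_def by (meson order_trans)

lemma reaches_Seq:
  assumes "reaches p s m s1" "reaches q s1 m' s2"
  shows "reaches (Seq p q) s (Suc (m + m')) s2"
  using assms by (simp add: reaches_def run_add bind_return_pmf)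

lemma wp_Seq:
  assumes "wp p s m (\<lambda>s1. wp q s1 n Q)" "m + n + 1 \<le> N"
  shows "wp (Seq p q) s N Q"
proof -
  from assms(1) obtain m1 s1 where 1: "m1 \<le> m" "frame p s s1" "reaches p s m1 s1" "wp q s1 n Q"
    unfolding wp_def by blast
  from 1(4) obtain m2 s2 where 2: "m2 \<le> n" "Q s2" "frame q s1 s2" "reaches q s1 m2 s2"
    unfolding wp_def by blast
  have "frame (Seq p q) s s2"
    by (rule frame_trans[OF 1(2) 2(3)]) auto
  with reaches_Seq[OF 1(3) 2(4)] 1 2 assms(2) show ?thesis
    unfolding wp_def by (intro exI[of _ "Suc (m1 + m2)"]) auto
qed

text \<open>The invariant is indexed by the number of completed rounds and the total
  \<open>N\<close> is known in advance, which lets the budget \<open>b i\<close> vary from round to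
  round, as for layers of different sizes. The frame relative to the start of the loop comes for
  free.\<close>

lemma wp_Loop:
  assumes "I 0 s0"
    and body: "\<And>i s. i < N \<Longrightarrow> I i s \<Longrightarrow> frame p s0 s \<Longrightarrow> tval s t \<and> wp p s (b i) (I (Suc i))"
    and exit: "\<And>s. I N s \<Longrightarrow> frame p s0 s \<Longrightarrow> \<not> tval s t"
    and "(\<Sum>i<N. b i + 1) + 1 \<le> M"
  shows "wp (Loop t p) s0 M (I N)"
proof -
  \<comment> \<open>Induction on the rounds still to go; with \<open>r\<close> of them left,
    \<open>N - r\<close> are done.\<close>
  have "wp (Loop t p) s ((\<Sum>i\<in>{N - r..<N}. b i + 1) + 1) (I N)"
    if "r \<le> N" "I (N - r) s" "frame p s0 s" for r s
    using that
  proof (induction r arbitrary: s)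
    case 0
    then have "\<not> tval s t" using exit by simp
    then have "reaches (Loop t p) s 1 s" by (simp add: reaches_def bind_return_pmf)
    then show ?case using 0 unfolding wp_def by (intro exI[of _ 1]) (auto simp: frame_refl)
  next
    case (Suc r)
    have lt: "N - Suc r < N" and eq: "Suc (N - Suc r) = N - r" using Suc.prems by auto
    from body[OF lt Suc.prems(2,3)] have tv: "tval s t" and
      w: "wp p s (b (N - Suc r)) (I (N - r))" by (simp_all add: eq)
    from w obtain m1 s1 where 1: "m1 \<le> b (N - Suc r)" "I (N - r) s1" "frame p s s1" "reaches p s m1 s1"
      unfolding wp_def by blast
    have "frame p s0 s1" by (rule frame_trans[OF Suc.prems(3) 1(3)]) auto
    from Suc.IH[OF _ 1(2) this] Suc.prems obtain m2 s2 where
      2: "m2 \<le> (\<Sum>i\<in>{N - r..<N}. b i + 1) + 1" "I N s2" "frame (Loop t p) s1 s2" "reaches (Loop t p) s1 m2 s2"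
      unfolding wp_def by auto
    have "reaches (Loop t p) s (Suc (m1 + m2)) s2"
      using 1(4) 2(4) tv by (simp add: reaches_def run_add bind_return_pmf)
    moreover have "frame (Loop t p) s s2"
      by (rule frame_trans[OF 1(3) 2(3)]) auto
    moreover have "(\<Sum>i\<in>{N - Suc r..<N}. b i + 1) = b (N - Suc r) + 1 + (\<Sum>i\<in>{N - r..<N}. b i + 1)"
      using lt eq by (subst sum.atLeast_Suc_lessThan) auto
    ultimately show ?case using 1(1) 2(1,2)
      unfolding wp_def by (intro exI[of _ "Suc (m1 + m2)"]) auto
  qed
  from this[of N s0] assms(1) have "wp (Loop t p) s0 ((\<Sum>i<N. b i + 1) + 1) (I N)"
    by (simp add: frame_refl atLeast0LessThan)
  then show ?thesis by (rule wp_mono) (use assms(4) in auto)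
qed

section \<open>Straight-line code and its symbolic execution\<close>

primrec straight :: "com \<Rightarrow> bool" where
  "straight Skip = True"
| "straight (IStore a i e) = True"
| "straight (RStore a i e) = True"
| "straight (Coin a i e) = False"
| "straight (Seq p q) = (straight p \<and> straight q)"
| "straight (Cond t p q) = (straight p \<and> straight q)"
| "straight (Loop t p) = False"

primrec exec :: "com \<Rightarrow> store \<Rightarrow> store" where
  "exec Skip s = s"
| "exec (IStore a i e) s = set_int a (ival s i) (ival s e) s"
| "exec (RStore a i e) s = set_real a (ival s i) (rval s e) s"
| "exec (Coin a i e) s = s"
| "exec (Seq p q) s = exec q (exec p s)"
| "exec (Cond t p q) s = (if tval s t then exec p s else exec q s)"
| "exec (Loop t p) s = s"

text \<open>A conditional is charged for both branches, an overestimate that makes the cost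
  independent of the store.\<close>

primrec cost :: "com \<Rightarrow> nat" where
  "cost Skip = 1"
| "cost (IStore a i e) = 1"
| "cost (RStore a i e) = 1"
| "cost (Coin a i e) = 1"
| "cost (Seq p q) = cost p + cost q + 1"
| "cost (Cond t p q) = cost p + cost q + 1"
| "cost (Loop t p) = 1"

text \<open>Reduces loop-free code to an evaluation of \<open>exec\<close> by rewriting.\<close>

lemma wp_exec:
  assumes "straight c" "Q (exec c s)" "cost c \<le> n"
  shows "wp c s n Q"
proof -
  have "straight c \<Longrightarrow> wp c s (cost c) (\<lambda>s'. s' = exec c s)" for c s
  proof (induction c arbitrary: s)
    case (Seq p q)
    then show ?case
      by (intro wp_Seq[where m = "cost p" and n = "cost q"] wp_mono[OF Seq.IH(1)])
        (auto intro: wp_mono[OF Seq.IH(2)])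
  next
    case (Cond t p q)
    let ?c = "if tval s t then p else q"
    from Cond have "wp ?c s (cost p + cost q) (\<lambda>s'. s' = exec ?c s)"
      by (auto intro: wp_mono[OF Cond.IH(1)] wp_mono[OF Cond.IH(2)])
    then obtain m s' where m: "m \<le> cost p + cost q" "s' = exec ?c s" "frame ?c s s'" "reaches ?c s m s'"
      unfolding wp_def by blast
    then have "reaches (Cond t p q) s (Suc m) s'"
      by (simp add: reaches_def bind_return_pmf split: if_splits)
    moreover have "frame (Cond t p q) s s'"
      using m(3) by (auto simp: frame_def split: if_splits)
    ultimately show ?case using m(1,2) unfolding wp_def
      by (intro exI[of _ "Suc m"]) auto
  qed (auto simp: wp_def reaches_def frame_def set_int_def set_real_def bind_return_pmf
        intro!: exI[of _ 1])
  from wp_mono[OF this[OF assms(1)] assms(3)] assms(2) show ?thesis by blast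
qed

lemma store_upd [simp]:
  "ints (set_int a i v s) b = (if b = a then (ints s a)(i := v) else ints s b)"
  "reals (set_int a i v s) = reals s"
  "reals (set_real a i x s) b = (if b = a then (reals s a)(i := x) else reals s b)"
  "ints (set_real a i x s) = ints s"
  by (simp_all add: set_int_def set_real_def)

subsection \<open>A table of multiples of powers\<close>

lemma wp_straight_Seq:
  assumes "straight p" "wp q (exec p s) n Q" "cost p + n + 1 \<le> N"
  shows "wp (Seq p q) s N Q"
  by (rule wp_Seq[where m = "cost p" and n = n]) (use assms in \<open>auto intro: wp_exec\<close>)

lemma wp_conseq: "wp c s n Q \<Longrightarrow> (\<And>s'. frame c s s' \<Longrightarrow> Q s' \<Longrightarrow> R s') \<Longrightarrow> wp c s n R"
  by (rule wp_mono[OF _ order_refl])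

abbreviation iv :: "vname \<Rightarrow> iexp" where "iv a \<equiv> ICell a (INat 0)"
abbreviation rv :: "vname \<Rightarrow> rexp" where "rv a \<equiv> RCell a (INat 0)"
abbreviation iset :: "vname \<Rightarrow> iexp \<Rightarrow> com" where "iset a \<equiv> IStore a (INat 0)"
abbreviation rset :: "vname \<Rightarrow> rexp \<Rightarrow> com" where "rset a \<equiv> RStore a (INat 0)"
abbreviation incr :: "vname \<Rightarrow> com" where "incr a \<equiv> iset a (IAdd (iv a) (INat 1))"
abbreviation rnat :: "nat \<Rightarrow> rexp" where "rnat m \<equiv> RNat (INat m)"
abbreviation seq :: "com \<Rightarrow> com \<Rightarrow> com" (infixr ";;" 60) where "p ;; q \<equiv> Seq p q"

definition table_cell :: com where
  "table_cell =
    IStore ''tab'' (iv ''idx'') (iv ''acc'') ;; iset ''acc'' (IAdd (iv ''acc'') (iv ''step'')) ;;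
    incr ''idx'' ;; incr ''y''"

definition table_row :: com where
  "table_row = Loop (ILess (iv ''y'') (iv ''B'')) table_cell"

definition table_init :: com where
  "table_init = iset ''B'' (IAdd (IAdd (iv ''n'') (iv ''n'')) (IAdd (iv ''n'') (INat 1))) ;;
     iset ''step'' (iv ''B'') ;; iset ''idx'' (INat 0) ;; iset ''j'' (INat 0)"

definition table_prog :: com where
  "table_prog = table_init ;;
    Loop (ILess (iv ''j'') (iv ''k''))
      ((iset ''acc'' (INat 0) ;; iset ''y'' (INat 0)) ;; table_row ;;
       (iset ''step'' (iv ''acc'') ;; incr ''j''))"

text \<open>The algorithm up to the sampling sees only increasing lists of variables; Pauli matrices
  return with \<open>pauli_instance\<close>. An empty list is the identity observable.\<close>

locale hamiltonian_data =
  fixes n k nz :: nat and X :: "nat \<Rightarrow> nat list" and \<alpha> :: "nat \<Rightarrow> real"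
  assumes n_pos: "n \<ge> 1" and k_pos: "k \<ge> 1"
    and sorted_X: "j < nz \<Longrightarrow> sorted_wrt (<) (X j)"
    and set_X: "j < nz \<Longrightarrow> set (X j) \<subseteq> {1..3 * n}"
    and length_X: "j < nz \<Longrightarrow> length (X j) \<le> k"
    and inj_X: "inj_on X {..<nz}"
begin

text \<open>Larger than every variable 1, ..., 3 * n, so the variables are nonzero digits.\<close>

definition base :: nat where "base = 3 * n + 1"

definition offset :: "nat \<Rightarrow> nat" where "offset j = (\<Sum>i<j. length (X i))"

definition input :: "store \<Rightarrow> bool" where
  "input s \<longleftrightarrow> ints s ''n'' 0 = n \<and> ints s ''k'' 0 = k \<and> ints s ''nnz'' 0 = nz \<and>
     (\<forall>j<nz. ints s ''weight'' j = length (X j) \<and> reals s ''coeff'' j = \<alpha> j \<and>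
        (\<forall>l<length (X j). 3 * ints s ''site'' (offset j + l) + ints s ''pauli'' (offset j + l) = X j ! l))"

lemma input_frame:
  assumes "input s" "frame c s s'"
    "int_writes c \<inter> {''n'', ''k'', ''nnz'', ''weight'', ''site'', ''pauli''} = {}" "''coeff'' \<notin> real_writes c"
  shows "input s'"
proof -
  let ?A = "{''n'', ''k'', ''nnz'', ''weight'', ''site'', ''pauli''}"
  have eq: "ints s' a = ints s a" if "a \<in> ?A" for a
    by (rule frame_ints[OF assms(2)]) (metis assms(3) that disjoint_iff)
  have "ints s' ''n'' = ints s ''n''" "ints s' ''k'' = ints s ''k''" "ints s' ''nnz'' = ints s ''nnz''"
    "ints s' ''weight'' = ints s ''weight''" "ints s' ''site'' = ints s ''site''"
    "ints s' ''pauli'' = ints s ''pauli''"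
    by (intro eq insertI1 insertI2)+
  then show ?thesis using assms(1) frame_reals[OF assms(2,4)] by (simp add: input_def)
qed

definition table_ok :: "store \<Rightarrow> bool" where
  "table_ok s \<longleftrightarrow> ints s ''B'' 0 = base \<and> (\<forall>j<k. \<forall>y<base. ints s ''tab'' (j * base + y) = y * base ^ (j + 1))"


lemma wp_table_row:
  assumes "ints s ''y'' 0 = 0" "ints s ''acc'' 0 = 0" "ints s ''idx'' 0 = j * base"
    "ints s ''step'' 0 = base ^ (j + 1)" "ints s ''B'' 0 = base"
    "\<And>i. i < j * base \<Longrightarrow> ints s ''tab'' i = (i mod base) * base ^ (i div base + 1)"
  shows "wp table_row s (base * 8 + 1) (\<lambda>s'. ints s' ''acc'' 0 = base ^ (j + 2) \<and>
    ints s' ''idx'' 0 = (j + 1) * base \<and>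
    (\<forall>i < (j + 1) * base. ints s' ''tab'' i = (i mod base) * base ^ (i div base + 1)))"
proof -
  define I where "I = (\<lambda>y (t :: store). ints t ''y'' 0 = y \<and> ints t ''acc'' 0 = y * base ^ (j + 1) \<and> ints t ''idx'' 0 = j * base + y \<and>
    ints t ''step'' 0 = base ^ (j + 1) \<and> ints t ''B'' 0 = base \<and>
    (\<forall>i < j * base + y. ints t ''tab'' i = (i mod base) * base ^ (i div base + 1)))"
  have "wp table_row s (base * 8 + 1) (I base)"
    unfolding table_row_def
  proof (rule wp_Loop[where b = "\<lambda>_. 7"])
    show "I 0 s" using assms by (simp add: I_def)
  next
    fix y and t :: store assume "y < base" and I: "I y t"
    then have d: "(j * base + y) mod base = y" "(j * base + y) div base = j" by auto
    have t: "ints t ''y'' 0 = y" "ints t ''acc'' 0 = y * base ^ (j + 1)" "ints t ''idx'' 0 = j * base + y"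
      "ints t ''step'' 0 = base ^ (j + 1)" "ints t ''B'' 0 = base"
      and tab: "\<And>i. i < j * base + y \<Longrightarrow> ints t ''tab'' i = (i mod base) * base ^ (i div base + 1)"
      using I by (simp_all add: I_def)
    show "tval t (ILess (iv ''y'') (iv ''B'')) \<and> wp table_cell t 7 (I (Suc y))"
    proof (intro conjI wp_exec)
      show "I (Suc y) (exec table_cell t)"
        by (simp add: table_cell_def I_def t tab d less_Suc_eq \<open>y < base\<close>)
    qed (use \<open>y < base\<close> in \<open>simp_all add: t table_cell_def\<close>)
  next
    show "\<not> tval t (ILess (iv ''y'') (iv ''B''))" if "I base t" for t
      using that by (simp add: I_def)
  qed simp
  then show ?thesis by (rule wp_conseq) (simp add: I_def algebra_simps)
qed

lemma wp_table_prog: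
  assumes "input s"
  shows "wp table_prog s (k * (base * 8 + 20) + 20) table_ok"
proof -
  define I where "I = (\<lambda>j (t :: store). ints t ''j'' 0 = j \<and> ints t ''idx'' 0 = j * base \<and>
    ints t ''step'' 0 = base ^ (j + 1) \<and> ints t ''B'' 0 = base \<and> ints t ''k'' 0 = k \<and>
    (\<forall>i < j * base. ints t ''tab'' i = (i mod base) * base ^ (i div base + 1)))"
  have "wp table_prog s (k * (base * 8 + 20) + 20) (I k)"
    unfolding table_prog_def
  proof (rule wp_straight_Seq)
    show "wp (Loop (ILess (iv ''j'') (iv ''k''))
      ((iset ''acc'' (INat 0) ;; iset ''y'' (INat 0)) ;; table_row ;;
       (iset ''step'' (iv ''acc'') ;; incr ''j''))) (exec table_init s) (k * (base * 8 + 20) + 1) (I k)"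
    proof (rule wp_Loop[where b = "\<lambda>_. base * 8 + 12"])
      show "I 0 (exec table_init s)"
        using assms by (simp add: I_def table_init_def input_def base_def)
    next
      fix j and t :: store assume "j < k" and I: "I j t"
      have t: "ints t ''j'' 0 = j" "ints t ''idx'' 0 = j * base"
        "ints t ''step'' 0 = base ^ (j + 1)" "ints t ''B'' 0 = base" "ints t ''k'' 0 = k"
        and tab: "\<And>i. i < j * base \<Longrightarrow> ints t ''tab'' i = (i mod base) * base ^ (i div base + 1)"
        using I by (simp_all add: I_def)
      let ?t = "exec (iset ''acc'' (INat 0) ;; iset ''y'' (INat 0)) t"
      have "wp table_row ?t (base * 8 + 1)
        (\<lambda>t'. wp (iset ''step'' (iv ''acc'') ;; incr ''j'') t' 3 (I (Suc j)))"
      proof (rule wp_conseq[OF wp_table_row[where j = j]], goal_cases)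
        case (7 t')
        have "ints t' ''j'' 0 = j" "ints t' ''k'' 0 = k" "ints t' ''B'' 0 = base"
          using t 7(1) by (simp_all add: frame_ints table_row_def table_cell_def)
        with 7(2) show ?case
          by (intro wp_exec) (simp_all add: I_def)
      qed (simp_all add: t tab)
      then have "wp ((iset ''acc'' (INat 0) ;; iset ''y'' (INat 0)) ;; table_row ;;
          (iset ''step'' (iv ''acc'') ;; incr ''j'')) t (base * 8 + 12) (I (Suc j))"
        by (intro wp_straight_Seq[where n = "base * 8 + 8"] wp_Seq[where m = "base * 8 + 1" and n = 3]) simp_all
      then show "tval t (ILess (iv ''j'') (iv ''k'')) \<and>
        wp ((iset ''acc'' (INat 0) ;; iset ''y'' (INat 0)) ;; table_row ;;
          (iset ''step'' (iv ''acc'') ;; incr ''j'')) t (base * 8 + 12) (I (Suc j))"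
        using \<open>j < k\<close> by (simp add: t)
    next
      show "\<not> tval t (ILess (iv ''j'') (iv ''k''))" if "I k t" for t
        using that by (simp add: I_def)
    qed simp
  qed (simp_all add: table_init_def)
  then show ?thesis
  proof (rule wp_conseq)
    fix t assume t: "I k t"
    have "ints t ''tab'' (j * base + y) = y * base ^ (j + 1)" if "j < k" "y < base" for j y
    proof -
      have "j * base + y < j * base + base" using that by simp
      also have "\<dots> = (j + 1) * base" by simp
      also have "\<dots> \<le> k * base" using that by (intro mult_right_mono) auto
      finally have "ints t ''tab'' (j * base + y)
          = ((j * base + y) mod base) * base ^ ((j * base + y) div base + 1)"
        using t by (simp only: I_def)
      then show ?thesis using that by simp
    qed
    with t show "table_ok t" by (simp add: table_ok_def I_def)
  qed
qed

end

subsection \<open>The trie of monomials\<close>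

text \<open>A linked list threaded through the array \<open>f\<close> and ended by 0, which is not
  the code of any node.\<close>

primrec chain :: "(nat \<Rightarrow> nat) \<Rightarrow> nat \<Rightarrow> nat list \<Rightarrow> bool" where
  "chain f h [] \<longleftrightarrow> h = 0"
| "chain f h (c # cs) \<longleftrightarrow> h = c \<and> 0 < c \<and> chain f (f c) cs"

lemma chain_fun_upd: "c \<notin> set cs \<Longrightarrow> chain (f(c := v)) h cs = chain f h cs"
  by (induction cs arbitrary: h) auto

context hamiltonian_data
begin

text \<open>A word is stored under its value as a numeral in base \<open>base\<close>, least significant letter first.
  Letters are nonzero, so no length has to be recorded. The machine cannot multiply integers; the
  table supplies the increments needed to append a letter.\<close>

primrec code :: "nat list \<Rightarrow> nat" where
  "code [] = 0"
| "code (x # xs) = x + base * code xs"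

lemma code_snoc: "code (xs @ [y]) = code xs + y * base ^ length xs"
  by (induction xs) (simp_all add: algebra_simps)

definition words :: "nat list set" where "words = {xs. xs \<noteq> [] \<and> set xs \<subseteq> {1..3 * n}}"

lemma inj_code: "inj_on code {xs. set xs \<subseteq> {1..3 * n}}"
proof -
  have "set xs \<subseteq> {1..3 * n} \<Longrightarrow> set ys \<subseteq> {1..3 * n} \<Longrightarrow> code xs = code ys \<Longrightarrow> xs = ys" for xs ys
  proof (induction xs arbitrary: ys)
    case Nil
    then show ?case by (cases ys) auto
  next
    case (Cons x xs)
    then obtain z zs where ys: "ys = z # zs" by (cases ys) auto
    have lt: "x < base" "z < base" using Cons.prems ys by (auto simp: base_def)
    have eq: "x + base * code xs = z + base * code zs" using Cons.prems(3) ys by simp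
    have "x = z" using arg_cong[OF eq, of "\<lambda>m. m mod base"] lt by simp
    moreover have "code xs = code zs" using arg_cong[OF eq, of "\<lambda>m. m div base"] lt by simp
    ultimately have "x = z" "code xs = code zs" .
    then show ?case using Cons ys by simp
  qed
  then show ?thesis by (auto intro: inj_onI)
qed

lemma inj_code_words: "inj_on code words"
  by (rule inj_on_subset[OF inj_code]) (auto simp: words_def)

lemma code_pos: "xs \<in> words \<Longrightarrow> 0 < code xs"
  by (cases xs) (auto simp: words_def)

text \<open>The lists enumerate the nodes by their last letter, the order in which they are merged.\<close>

definition trie :: "nat list set \<Rightarrow> store \<Rightarrow> bool" where
  "trie S s \<longleftrightarrow> S \<subseteq> words \<and>
     (\<forall>c. ints s ''seen'' c = (if c \<in> code ` S then 1 else 0)) \<and>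
     (\<forall>xs\<in>S. ints s ''par'' (code xs) = code (butlast xs) \<and> ints s ''root'' (code xs) = hd xs \<and>
        reals s ''wgt'' (code xs) = 3 ^ (length xs - 2)) \<and>
     (\<forall>y. \<exists>ys. distinct ys \<and> set ys = {xs\<in>S. last xs = y} \<and>
        chain (ints s ''nxt'') (ints s ''head'' y) (map code ys))"

lemma trie_cong:
  assumes "trie S s" "ints s' ''seen'' = ints s ''seen''" "ints s' ''par'' = ints s ''par''"
    "ints s' ''root'' = ints s ''root''" "reals s' ''wgt'' = reals s ''wgt''"
    "ints s' ''nxt'' = ints s ''nxt''" "ints s' ''head'' = ints s ''head''"
  shows "trie S s'"
  using assms unfolding trie_def by simp

lemma trie_chain:
  "trie S s \<Longrightarrow> \<exists>ys. distinct ys \<and> set ys = {xs\<in>S. last xs = y} \<and>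
     chain (ints s ''nxt'') (ints s ''head'' y) (map code ys)"
  unfolding trie_def by (elim conjE allE)

text \<open>The node goes to the front of the list of its last letter, and as its code is new, the
  links of all other nodes are untouched. The parent \<open>xs\<close> need not lie in
  \<open>S\<close>: it may be a root.\<close>

lemma trie_insert:
  assumes S: "trie S s" and xs: "xs \<in> words" and y: "y \<in> {1..3 * n}" and new: "xs @ [y] \<notin> S"
    and s': "ints s' ''seen'' = (ints s ''seen'')(code (xs @ [y]) := 1)"
      "ints s' ''par'' = (ints s ''par'')(code (xs @ [y]) := code xs)"
      "ints s' ''root'' = (ints s ''root'')(code (xs @ [y]) := hd xs)"
      "reals s' ''wgt'' = (reals s ''wgt'')(code (xs @ [y]) := 3 ^ (length xs - 1))"
      "ints s' ''nxt'' = (ints s ''nxt'')(code (xs @ [y]) := ints s ''head'' y)"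
      "ints s' ''head'' = (ints s ''head'')(y := code (xs @ [y]))"
  shows "trie (insert (xs @ [y]) S) s'"
proof -
  let ?x = "xs @ [y]"
  have w: "?x \<in> words" using xs y by (auto simp: words_def)
  have snoc_last: "last ?x = y" by simp
  have S': "S \<subseteq> words" using S by (simp add: trie_def)
  have ne: "code z \<noteq> code ?x" if "z \<in> S" for z
    using inj_onD[OF inj_code_words, of z ?x] that S' w new by auto
  have ch: "\<exists>ys. distinct ys \<and> set ys = {z \<in> insert ?x S. last z = b} \<and>
        chain (ints s' ''nxt'') (ints s' ''head'' b) (map code ys)" for b
  proof -
    obtain ys where ys: "distinct ys" "set ys = {z\<in>S. last z = b}"
      "chain (ints s ''nxt'') (ints s ''head'' b) (map code ys)"
      using trie_chain[OF S, of b] by (elim exE conjE)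
    have nin: "code ?x \<notin> set (map code ys)" using ne ys(2) by force
    show ?thesis
    proof (cases "b = y")
      case True
      have "chain (ints s' ''nxt'') (ints s' ''head'' b) (map code (?x # ys))"
        using ys(3) True code_pos[OF w] chain_fun_upd[OF nin] by (simp add: s')
      moreover have "distinct (?x # ys)" using ys new by auto
      moreover have "{z \<in> insert ?x S. last z = y} = insert ?x {z \<in> S. last z = y}"
        using snoc_last by blast
      then have "set (?x # ys) = {z \<in> insert ?x S. last z = b}" using ys(2) True by simp
      ultimately show ?thesis by (intro exI[of _ "?x # ys"] conjI)
    next
      case False
      then have "chain (ints s' ''nxt'') (ints s' ''head'' b) (map code ys)"
        using ys(3) chain_fun_upd[OF nin] by (simp add: s')
      moreover have "set ys = {z \<in> insert ?x S. last z = b}" using ys(2) False snoc_last by blast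
      ultimately show ?thesis using ys(1) by (intro exI[of _ ys] conjI)
    qed
  qed
  have "xs \<noteq> []" using xs by (simp add: words_def)
  have old: "ints s ''par'' (code z) = code (butlast z)" "ints s ''root'' (code z) = hd z"
    "reals s ''wgt'' (code z) = 3 ^ (length z - 2)" if "z \<in> S" for z
    using S that by (simp_all add: trie_def)
  have "\<forall>c. ints s' ''seen'' c = (if c \<in> code ` insert ?x S then 1 else 0)"
    using S by (simp add: s' trie_def)
  moreover have "\<forall>z\<in>insert ?x S. ints s' ''par'' (code z) = code (butlast z) \<and>
      ints s' ''root'' (code z) = hd z \<and> reals s' ''wgt'' (code z) = 3 ^ (length z - 2)"
    using old ne \<open>xs \<noteq> []\<close> by (simp add: s')
  ultimately show ?thesis unfolding trie_def
    using S' w ch by simp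
qed

text \<open>The head keeps the derivatives in different directions apart, so that one trie serves
  all of them; the tail is the monomial that term \<open>j\<close> contributes to the derivative in
  direction \<open>u\<close>.\<close>

definition path :: "nat \<Rightarrow> nat \<Rightarrow> nat list" where
  "path j u = u # filter (\<lambda>z. z \<noteq> u) (X j)"

text \<open>The roots are left out: \<open>[u]\<close> holds the constant term of the derivative,
  has code \<open>u\<close>, and is never merged into anything.\<close>

definition prefixes2 :: "nat list \<Rightarrow> nat list set" where
  "prefixes2 xs = (\<lambda>i. take i xs) ` {2..length xs}"

lemma prefixes2_single [simp]: "prefixes2 [u] = {}"
  by (simp add: prefixes2_def)

lemma prefixes2_snoc: "xs \<noteq> [] \<Longrightarrow> prefixes2 (xs @ [y]) = insert (xs @ [y]) (prefixes2 xs)"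
proof -
  assume "xs \<noteq> []"
  then have "{2..length (xs @ [y])} = insert (Suc (length xs)) {2..length xs}" by (cases xs) auto
  then show ?thesis by (auto simp: prefixes2_def)
qed

end

abbreviation letter :: "iexp \<Rightarrow> iexp" where
  "letter p \<equiv> IAdd (ICell ''site'' p) (IAdd (ICell ''site'' p) (IAdd (ICell ''site'' p) (ICell ''pauli'' p)))"

abbreviation INeq :: "iexp \<Rightarrow> iexp \<Rightarrow> test" where
  "INeq e f \<equiv> TNot (TAnd (TNot (ILess e f)) (TNot (ILess f e)))"

definition node_insert :: com where
  "node_insert =
    IStore ''seen'' (iv ''c'') (INat 1) ;; IStore ''par'' (iv ''c'') (iv ''x'') ;;
    IStore ''root'' (iv ''c'') (iv ''u'') ;; RStore ''wgt'' (iv ''c'') (rv ''wt'') ;;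
    IStore ''nxt'' (iv ''c'') (ICell ''head'' (iv ''y'')) ;; IStore ''head'' (iv ''y'') (iv ''c'')"

definition node_step :: com where
  "node_step = iset ''y'' (letter (iv ''l'')) ;;
    Cond (INeq (iv ''y'') (iv ''u''))
      (iset ''c'' (IAdd (iv ''x'') (ICell ''tab'' (IAdd (iv ''row'') (iv ''y'')))) ;;
       Cond (ILess (ICell ''seen'' (iv ''c'')) (INat 1)) node_insert Skip ;;
       iset ''x'' (iv ''c'') ;; iset ''row'' (IAdd (iv ''row'') (iv ''B'')) ;;
       rset ''wt'' (RMul (rnat 3) (rv ''wt'')))
      Skip ;;
    incr ''l''"

definition walk_prog :: com where
  "walk_prog = Loop (ILess (iv ''l'') (iv ''e'')) node_step"

definition path_init :: com where
  "path_init = iset ''u'' (letter (iv ''m'')) ;; iset ''x'' (iv ''u'') ;; iset ''row'' (INat 0) ;;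
    rset ''wt'' (rnat 1) ;; iset ''l'' (iv ''o'')"

text \<open>\<open>V\<close> and \<open>W\<close> receive the square norm of each derivative and its
  version with weight 3 to the degree; \<open>wt\<close> has been multiplied by 3 once per letter
  below the root.\<close>

definition path_finish :: com where
  "path_finish =
    RStore ''beta'' (iv ''x'') (RAdd (RCell ''beta'' (iv ''x'')) (rv ''al'')) ;;
    RStore ''V'' (iv ''u'') (RAdd (RCell ''V'' (iv ''u'')) (RMul (rv ''al'') (rv ''al''))) ;;
    RStore ''W'' (iv ''u'') (RAdd (RCell ''W'' (iv ''u'')) (RMul (rv ''wt'') (RMul (rv ''al'') (rv ''al'')))) ;;
    incr ''m''"

definition path_prog :: com where
  "path_prog = path_init ;; walk_prog ;; path_finish"

definition term_init :: com where
  "term_init = iset ''e'' (IAdd (iv ''o'') (ICell ''weight'' (iv ''j''))) ;;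
    rset ''al'' (RDiv (RCell ''coeff'' (iv ''j''))
      (RPow (rnat 12) (RDiv (RNat (ICell ''weight'' (iv ''j''))) (rnat 2)))) ;;
    RStore ''ca'' (iv ''j'') (rv ''al'') ;; iset ''m'' (iv ''o'')"

definition term_prog :: com where
  "term_prog = term_init ;; Loop (ILess (iv ''m'') (iv ''e'')) path_prog ;;
    (iset ''o'' (iv ''e'') ;; incr ''j'')"

definition build_prog :: com where
  "build_prog = (iset ''o'' (INat 0) ;; iset ''j'' (INat 0)) ;; Loop (ILess (iv ''j'') (iv ''nnz'')) term_prog"

lemma path_prog_writes:
  "int_writes node_step = {''y'', ''c'', ''x'', ''row'', ''l'', ''seen'', ''par'', ''root'', ''nxt'', ''head''}"
  "real_writes node_step = {''wt'', ''wgt''}"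
  "int_writes path_prog = {''y'', ''c'', ''x'', ''row'', ''l'', ''seen'', ''par'', ''root'', ''nxt'', ''head'', ''u'', ''m''}"
  "real_writes path_prog = {''wt'', ''wgt'', ''beta'', ''V'', ''W''}"
  by (simp_all add: node_step_def node_insert_def path_prog_def path_init_def walk_prog_def path_finish_def
      insert_commute)

context hamiltonian_data
begin

text \<open>One step down the trie. The letter \<open>u\<close> is skipped because it already stands
  in front, so the depth, and not the position in \<open>X j\<close>, selects the row of the
  table.\<close>

lemma node_step_exec:
  assumes t: "ints t ''x'' 0 = code xs" "ints t ''row'' 0 = (length xs - 1) * base"
      "reals t ''wt'' 0 = 3 ^ (length xs - 1)" "ints t ''u'' 0 = u" "ints t ''B'' 0 = base"
      "trie S t" "table_ok t"
    and y: "3 * ints t ''site'' (ints t ''l'' 0) + ints t ''pauli'' (ints t ''l'' 0) = y" "y \<in> {1..3 * n}"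
    and xs: "xs \<in> words" "hd xs = u" "y \<noteq> u \<Longrightarrow> length xs \<le> k"
    and ys: "ys = (if y = u then xs else xs @ [y])"
    and t': "t' = exec node_step t"
  shows "ints t' ''l'' 0 = ints t ''l'' 0 + 1 \<and> ints t' ''x'' 0 = code ys \<and>
    ints t' ''row'' 0 = (length ys - 1) * base \<and> reals t' ''wt'' 0 = 3 ^ (length ys - 1) \<and>
    trie (if y = u then S else insert (xs @ [y]) S) t'"
proof (cases "y = u")
  case True
  have "ints t ''site'' (ints t ''l'' 0) + (ints t ''site'' (ints t ''l'' 0) +
    (ints t ''site'' (ints t ''l'' 0) + ints t ''pauli'' (ints t ''l'' 0))) = u" using y True by simp
  then show ?thesis using True t ys
    by (simp add: t' node_step_def trie_cong[OF t(6)])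
next
  case False
  have yy: "ints t ''site'' (ints t ''l'' 0) + (ints t ''site'' (ints t ''l'' 0) +
    (ints t ''site'' (ints t ''l'' 0) + ints t ''pauli'' (ints t ''l'' 0))) = y" using y by simp
  have lt: "y < u \<or> u < y" using False by auto
  have len: "length xs \<ge> 1" using xs(1) by (cases xs) (simp_all add: words_def)
  define j where "j = length xs - 1"
  \<comment> \<open>Position \<open>length xs\<close> carries the factor
    \<open>base ^ length xs\<close>, found in row \<open>length xs - 1\<close>; the bound on the
    length of the path keeps it among the \<open>k\<close> rows.\<close>
  have "j < k" "y < base" using xs(3) False len y(2) by (simp_all add: j_def base_def)
  then have "ints t ''tab'' (j * base + y) = y * base ^ (j + 1)"
    using t(7) by (simp only: table_ok_def)
  then have c: "code xs + ints t ''tab'' (j * base + y) = code (xs @ [y])"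
    using len by (simp only: code_snoc j_def le_add_diff_inverse2)
  have tj: "ints t ''row'' 0 = j * base" "reals t ''wt'' 0 = 3 ^ j" using t(2,3) by (simp_all add: j_def)
  have len_ys: "length ys - 1 = Suc j" and rowj: "Suc j * base = j * base + base"
    using len False ys by (simp_all add: j_def algebra_simps)
  have lj: "length xs - Suc 0 = j" by (simp add: j_def)
  have ys': "ys = xs @ [y]" using False ys by simp
  let ?t = "set_int ''c'' 0 (code (xs @ [y])) (set_int ''y'' 0 y t)"
  let ?p = "iset ''x'' (iv ''c'') ;; iset ''row'' (IAdd (iv ''row'') (iv ''B'')) ;;
       rset ''wt'' (RMul (rnat 3) (rv ''wt'')) ;; incr ''l''"
  have c': "ints (set_int ''y'' 0 y t) ''x'' 0 + ints (set_int ''y'' 0 y t) ''tab''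
      (ints (set_int ''y'' 0 y t) ''row'' 0 + ints (set_int ''y'' 0 y t) ''y'' 0) = code (xs @ [y])"
    using tj t(1) c by simp
  have "tval (set_int ''y'' 0 y t) (INeq (iv ''y'') (iv ''u''))" using lt t(4) by simp
  then have t'': "t' = exec ?p (if ints t ''seen'' (code (xs @ [y])) < 1 then exec node_insert ?t else ?t)"
    unfolding t' node_step_def by (simp only: exec.simps ival.simps yy c') simp
  show ?thesis
  proof (cases "xs @ [y] \<in> S")
    case True
    then have seen: "ints t ''seen'' (code (xs @ [y])) = 1" using t(6) by (simp add: trie_def)
    have t'': "t' = exec ?p ?t" unfolding t'' seen by simp
    have "trie (insert (xs @ [y]) S) t" using t(6) True by (simp add: insert_absorb)
    then have "trie (insert (xs @ [y]) S) t'" by (rule trie_cong) (simp_all add: t'')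
    moreover have "ints t' ''l'' 0 = ints t ''l'' 0 + 1" by (simp add: t'')
    moreover have "ints t' ''x'' 0 = code ys" by (simp add: t'' ys')
    moreover have "ints t' ''row'' 0 = Suc j * base" using t(5) tj by (simp add: t'' rowj)
    moreover have "reals t' ''wt'' 0 = 3 ^ Suc j" using tj by (simp add: t'')
    ultimately show ?thesis unfolding len_ys using False by simp
  next
    case new: False
    have w: "xs @ [y] \<in> words" using xs(1) y(2) by (simp add: words_def)
    have "code (xs @ [y]) \<notin> code ` S"
      using inj_on_image_mem_iff[OF inj_code_words w, of S] new t(6) by (simp add: trie_def)
    then have seen: "ints t ''seen'' (code (xs @ [y])) = 0" using t(6) by (simp add: trie_def)
    have t'': "t' = exec ?p (exec node_insert ?t)" unfolding t'' seen by simp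
    have "trie (insert (xs @ [y]) S) t'"
      by (rule trie_insert[OF t(6) xs(1) y(2) new])
        (use t(1,4,5) tj xs(2) in \<open>simp_all add: t'' node_insert_def lj\<close>)
    moreover have "ints t' ''l'' 0 = ints t ''l'' 0 + 1" by (simp add: t'' node_insert_def)
    moreover have "ints t' ''x'' 0 = code ys" by (simp add: t'' node_insert_def ys')
    moreover have "ints t' ''row'' 0 = Suc j * base" using t(5) tj by (simp add: t'' node_insert_def rowj)
    moreover have "reals t' ''wt'' 0 = 3 ^ Suc j" using tj by (simp add: t'' node_insert_def)
    ultimately show ?thesis unfolding len_ys using False by simp
  qed
qed

lemma set_nth_X: "j < nz \<Longrightarrow> q < length (X j) \<Longrightarrow> X j ! q \<in> {1..3 * n}"
  using set_X nth_mem by blast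

lemma wp_walk:
  assumes ju: "j < nz" "u \<in> set (X j)" and t: "input t" "table_ok t" "trie S t"
    "ints t ''l'' 0 = offset j" "ints t ''e'' 0 = offset j + length (X j)"
    "ints t ''x'' 0 = u" "ints t ''row'' 0 = 0" "reals t ''wt'' 0 = 1" "ints t ''u'' 0 = u"
  shows "wp walk_prog t (length (X j) * 40 + 1) (\<lambda>t'. trie (S \<union> prefixes2 (path j u)) t' \<and>
    ints t' ''x'' 0 = code (path j u) \<and> reals t' ''wt'' 0 = 3 ^ (length (path j u) - 1))"
proof -
  define P where "P = (\<lambda>q. u # filter (\<lambda>z. z \<noteq> u) (take q (X j)))"
  define I where "I = (\<lambda>q (t :: store). ints t ''l'' 0 = offset j + q \<and> ints t ''x'' 0 = code (P q) \<and>
    ints t ''row'' 0 = (length (P q) - 1) * base \<and> reals t ''wt'' 0 = 3 ^ (length (P q) - 1) \<and>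
    trie (S \<union> prefixes2 (P q)) t)"
  have "wp walk_prog t (length (X j) * 40 + 1) (I (length (X j)))"
    unfolding walk_prog_def
  proof (rule wp_Loop[where b = "\<lambda>_. 39"])
    show "I 0 t" using t by (simp add: I_def P_def)
  next
    fix q t' assume q: "q < length (X j)" and I: "I q t'" and fr: "frame node_step t t'"
    let ?y = "X j ! q"
    have in': "input t'" by (rule input_frame[OF t(1) fr]) (simp_all add: path_prog_writes)
    have fr': "ints t' ''tab'' = ints t ''tab''" "ints t' ''B'' = ints t ''B''"
      "ints t' ''u'' = ints t ''u''" "ints t' ''e'' = ints t ''e''"
      using fr by (simp_all add: frame_ints path_prog_writes)
    have tab': "table_ok t'" "ints t' ''B'' 0 = base" using t(2) fr' by (simp_all add: table_ok_def)
    have P: "P (Suc q) = (if ?y = u then P q else P q @ [?y])"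
      using q by (simp add: P_def take_Suc_conv_app_nth)
    have len: "length (P q) \<le> k"
      using length_filter_le[of "\<lambda>z. z \<noteq> u" "take q (X j)"] q length_X[OF ju(1)] by (simp add: P_def)
    have w: "P q \<in> words"
      using set_X[OF ju(1)] ju(2) set_take_subset[of q "X j"] by (auto simp: P_def words_def)
    have step: "ints (exec node_step t') ''l'' 0 = ints t' ''l'' 0 + 1 \<and>
      ints (exec node_step t') ''x'' 0 = code (P (Suc q)) \<and>
      ints (exec node_step t') ''row'' 0 = (length (P (Suc q)) - 1) * base \<and>
      reals (exec node_step t') ''wt'' 0 = 3 ^ (length (P (Suc q)) - 1) \<and>
      trie (if ?y = u then S \<union> prefixes2 (P q) else insert (P q @ [?y]) (S \<union> prefixes2 (P q))) (exec node_step t')"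
    proof (rule node_step_exec)
      show "3 * ints t' ''site'' (ints t' ''l'' 0) + ints t' ''pauli'' (ints t' ''l'' 0) = ?y"
        using in' I ju q by (simp add: input_def I_def)
      show "?y \<in> {1..3 * n}" by (rule set_nth_X[OF ju(1) q])
      show "hd (P q) = u" by (simp add: P_def)
    qed (use I tab' fr' t(9) len w P in \<open>simp_all add: I_def\<close>)
    have "prefixes2 (P (Suc q)) = (if ?y = u then prefixes2 (P q) else insert (P q @ [?y]) (prefixes2 (P q)))"
      using P prefixes2_snoc[of "P q" ?y] by (simp add: P_def)
    then have "I (Suc q) (exec node_step t')" using step I by (simp add: I_def split: if_splits)
    then have "wp node_step t' 39 (I (Suc q))"
      by (rule wp_exec[rotated]) (simp_all add: node_step_def node_insert_def)
    then show "tval t' (ILess (iv ''l'') (iv ''e'')) \<and> wp node_step t' 39 (I (Suc q))"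
      using I q fr' t(5) by (simp add: I_def)
  next
    fix t' assume I: "I (length (X j)) t'" and fr: "frame node_step t t'"
    then show "\<not> tval t' (ILess (iv ''l'') (iv ''e''))"
      using t(5) by (simp add: I_def frame_ints path_prog_writes)
  qed simp
  then show ?thesis by (rule wp_conseq) (simp add: I_def P_def path_def)
qed

text \<open>Since 12 = 3 * 4, the divisor unites the factor sqrt 3 per site of the corner states
  with the factor 2 per site of the halved means.\<close>

definition amp :: "nat \<Rightarrow> real" where "amp j = \<alpha> j / 12 powr (real (length (X j)) / 2)"

definition nodes :: "(nat \<times> nat) set \<Rightarrow> nat list set" where
  "nodes E = (\<Union>(j, u)\<in>E. prefixes2 (path j u))"

text \<open>\<open>E\<close> collects the processed pairs of a term and one of its variables, so
  that a round is an \<open>insert\<close>. Words that are not a full path get coefficient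
  0.\<close>

definition built :: "(nat \<times> nat) set \<Rightarrow> store \<Rightarrow> bool" where
  "built E s \<longleftrightarrow> trie (nodes E) s \<and>
    (\<forall>xs\<in>words. reals s ''beta'' (code xs) = (\<Sum>(j, u)\<in>E. if path j u = xs then amp j else 0)) \<and>
    (\<forall>v. reals s ''V'' v = (\<Sum>(j, u)\<in>E. if u = v then (amp j)\<^sup>2 else 0)) \<and>
    (\<forall>v. reals s ''W'' v = (\<Sum>(j, u)\<in>E. if u = v then 3 ^ (length (X j) - 1) * (amp j)\<^sup>2 else 0))"

lemma distinct_X: "j < nz \<Longrightarrow> distinct (X j)"
  using sorted_X strict_sorted_iff by blast

lemma length_path:
  assumes "j < nz" "u \<in> set (X j)"
  shows "length (path j u) = length (X j)"
proof -
  have d: "distinct (X j)" by (rule distinct_X[OF assms(1)])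
  have "length (filter (\<lambda>z. z \<noteq> u) (X j)) = card (set (X j) - {u})"
    using distinct_card[OF distinct_filter[OF d, of "\<lambda>z. z \<noteq> u"]] by (simp add: set_diff_eq)
  also have "\<dots> = length (X j) - 1"
    using assms(2) distinct_card[OF d] by (simp add: card_Diff_singleton)
  finally show ?thesis using assms(2) by (cases "X j") (simp_all add: path_def)
qed

lemma path_words: "j < nz \<Longrightarrow> u \<in> set (X j) \<Longrightarrow> path j u \<in> words"
  using set_X[of j] by (auto simp: path_def words_def)

lemma wp_path:
  assumes ju: "j < nz" "q < length (X j)" and t: "input t" "table_ok t" "built E t"
    "ints t ''o'' 0 = offset j" "ints t ''e'' 0 = offset j + length (X j)"
    "ints t ''m'' 0 = offset j + q" "reals t ''al'' 0 = amp j"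
    and E: "finite E" "(j, X j ! q) \<notin> E"
  shows "wp path_prog t (length (X j) * 40 + 30) (\<lambda>t'. built (insert (j, X j ! q) E) t' \<and>
    ints t' ''m'' 0 = offset j + Suc q)"
  unfolding path_prog_def
proof (rule wp_straight_Seq)
  let ?u = "X j ! q"
  let ?t = "exec path_init t"
  have u: "?u \<in> set (X j)" using ju(2) by simp
  have l: "ints t ''site'' (offset j + q) + (ints t ''site'' (offset j + q) +
      (ints t ''site'' (offset j + q) + ints t ''pauli'' (offset j + q))) = ?u"
  proof -
    have "3 * ints t ''site'' (offset j + q) + ints t ''pauli'' (offset j + q) = ?u"
      using t(1) ju unfolding input_def by blast
    then show ?thesis by linarith
  qed
  have in': "input ?t" using t(1) by (simp add: input_def path_init_def)
  have tab': "table_ok ?t" using t(2) by (simp add: table_ok_def path_init_def)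
  have "trie (nodes E) t" using t(3) by (simp add: built_def)
  then have tr: "trie (nodes E) ?t" by (rule trie_cong) (simp_all add: path_init_def)
  have E': "nodes (insert (j, ?u) E) = nodes E \<union> prefixes2 (path j ?u)" by (auto simp: nodes_def)
  have init: "ints ?t ''l'' 0 = offset j" "ints ?t ''e'' 0 = offset j + length (X j)"
    "ints ?t ''x'' 0 = ?u" "ints ?t ''row'' 0 = 0" "reals ?t ''wt'' 0 = 1" "ints ?t ''u'' 0 = ?u"
    using t(4-6) by (simp_all add: path_init_def l)
  have "wp walk_prog ?t (length (X j) * 40 + 1) (\<lambda>t'. wp path_finish t' 10
    (\<lambda>t'. built (insert (j, ?u) E) t' \<and> ints t' ''m'' 0 = offset j + Suc q))"
  proof (rule wp_conseq[OF wp_walk[OF ju(1) u in' tab' tr init]], elim conjE)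
    fix t' assume fr: "frame walk_prog ?t t'" and tr': "trie (nodes E \<union> prefixes2 (path j ?u)) t'"
      and x: "ints t' ''x'' 0 = code (path j ?u)" "reals t' ''wt'' 0 = 3 ^ (length (path j ?u) - 1)"
    have fr': "reals t' ''beta'' = reals t ''beta''" "reals t' ''V'' = reals t ''V''"
      "reals t' ''W'' = reals t ''W''" "reals t' ''al'' 0 = amp j" "ints t' ''m'' 0 = offset j + q"
      "ints t' ''u'' 0 = ?u"
      using t(6,7) init(6) fr by (simp_all add: frame_def walk_prog_def path_prog_writes path_init_def)
    let ?f = "exec path_finish t'"
    have "trie (nodes (insert (j, ?u) E)) ?f"
      unfolding E' by (rule trie_cong[OF tr']) (simp_all add: path_finish_def)
    moreover have "reals ?f ''beta'' (code xs) = (\<Sum>(j, u)\<in>insert (j, ?u) E. if path j u = xs then amp j else 0)"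
      if "xs \<in> words" for xs
    proof -
      have "code xs = code (path j ?u) \<longleftrightarrow> path j ?u = xs"
        using inj_onD[OF inj_code_words _ that path_words[OF ju(1) u]] by metis
      moreover have "reals t ''beta'' (code xs) = (\<Sum>(j, u)\<in>E. if path j u = xs then amp j else 0)"
        using t(3) that by (simp add: built_def)
      ultimately show ?thesis using E by (simp add: path_finish_def x fr')
    qed
    moreover have "reals ?f ''V'' v = (\<Sum>(j, u)\<in>insert (j, ?u) E. if u = v then (amp j)\<^sup>2 else 0)" for v
    proof -
      have "reals t ''V'' v = (\<Sum>(j, u)\<in>E. if u = v then (amp j)\<^sup>2 else 0)"
        using t(3) by (simp add: built_def)
      then show ?thesis using E by (cases "v = ?u") (simp_all add: path_finish_def x fr' power2_eq_square)
    qed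
    moreover have "reals ?f ''W'' v = (\<Sum>(j, u)\<in>insert (j, ?u) E.
        if u = v then 3 ^ (length (X j) - 1) * (amp j)\<^sup>2 else 0)" for v
    proof -
      have "reals t ''W'' v = (\<Sum>(j, u)\<in>E. if u = v then 3 ^ (length (X j) - 1) * (amp j)\<^sup>2 else 0)"
        using t(3) by (simp add: built_def)
      then show ?thesis using E length_path[OF ju(1) u]
        by (cases "v = ?u") (simp_all add: path_finish_def x fr' power2_eq_square)
    qed
    ultimately have "built (insert (j, ?u) E) ?f" unfolding built_def by blast
    moreover have "ints ?f ''m'' 0 = offset j + Suc q" by (simp add: path_finish_def fr')
    ultimately show "wp path_finish t' 10 (\<lambda>t'. built (insert (j, ?u) E) t' \<and> ints t' ''m'' 0 = offset j + Suc q)"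
      by (intro wp_exec conjI) (simp_all add: path_finish_def)
  qed
  then show "wp (walk_prog ;; path_finish) ?t (length (X j) * 40 + 12)
     (\<lambda>t'. built (insert (j, ?u) E) t' \<and> ints t' ''m'' 0 = offset j + Suc q)"
    by (rule wp_Seq) simp
qed (simp_all add: path_init_def)

definition entries :: "nat \<Rightarrow> (nat \<times> nat) set" where
  "entries j = (SIGMA i:{..<j}. set (X i))"

lemma finite_entries [simp]: "finite (entries j)"
  by (simp add: entries_def)

lemma wp_term:
  assumes j: "j < nz" and t: "input t" "table_ok t" "built (entries j) t"
    "ints t ''o'' 0 = offset j" "ints t ''j'' 0 = j" "\<And>i. i < j \<Longrightarrow> reals t ''ca'' i = amp i"
  shows "wp term_prog t (length (X j) * (length (X j) * 40 + 40) + 20) (\<lambda>t'. built (entries (Suc j)) t' \<and>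
    ints t' ''o'' 0 = offset (Suc j) \<and> ints t' ''j'' 0 = Suc j \<and> (\<forall>i<Suc j. reals t' ''ca'' i = amp i))"
    (is "wp _ _ _ ?Q")
  unfolding term_prog_def
proof (rule wp_straight_Seq)
  let ?t = "exec term_init t"
  let ?E = "\<lambda>q. entries j \<union> {j} \<times> set (take q (X j))"
  define I where "I = (\<lambda>q (t' :: store). built (?E q) t' \<and> ints t' ''m'' 0 = offset j + q)"
  have in': "input ?t" using t(1) by (simp add: input_def term_init_def)
  have w: "ints t ''weight'' j = length (X j)" "reals t ''coeff'' j = \<alpha> j"
    using t(1) j by (simp_all add: input_def)
  have tab': "table_ok ?t" using t(2) by (simp add: table_ok_def term_init_def)
  have init: "ints ?t ''o'' 0 = offset j" "ints ?t ''e'' 0 = offset j + length (X j)"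
    "ints ?t ''m'' 0 = offset j" "reals ?t ''al'' 0 = amp j" "ints ?t ''j'' 0 = j"
    using t(4-6) by (simp_all add: term_init_def w amp_def)
  have ca: "reals ?t ''ca'' i = amp i" if "i < Suc j" for i
    using t(4,5) t(6)[of i] that by (cases "i = j") (simp_all add: term_init_def w amp_def)
  have "trie (nodes (entries j)) t" using t(3) by (simp add: built_def)
  then have "trie (nodes (entries j)) ?t" by (rule trie_cong) (simp_all add: term_init_def)
  then have b: "built (entries j) ?t" using t(3) by (simp add: built_def term_init_def)
  have "wp (Loop (ILess (iv ''m'') (iv ''e'')) path_prog) ?t (length (X j) * (length (X j) * 40 + 40) + 1) (I (length (X j)))"
  proof (rule wp_Loop[where b = "\<lambda>_. length (X j) * 40 + 39"])
    show "I 0 ?t" using b init by (simp add: I_def)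
  next
    fix q t' assume q: "q < length (X j)" and I: "I q t'" and fr: "frame path_prog ?t t'"
    have in'': "input t'" by (rule input_frame[OF in' fr]) (simp_all add: path_prog_writes)
    have fr': "ints t' ''tab'' = ints ?t ''tab''" "ints t' ''B'' = ints ?t ''B''"
      "ints t' ''o'' = ints ?t ''o''" "ints t' ''e'' = ints ?t ''e''" "reals t' ''al'' = reals ?t ''al''"
      using fr by (simp_all add: frame_def path_prog_writes)
    have tab'': "table_ok t'" using tab' fr' by (simp add: table_ok_def)
    have nin: "(j, X j ! q) \<notin> ?E q"
      using distinct_X[OF j] q by (auto simp: entries_def in_set_conv_nth nth_eq_iff_index_eq)
    have E: "insert (j, X j ! q) (?E q) = ?E (Suc q)"
      using q by (auto simp: take_Suc_conv_app_nth)
    have "wp path_prog t' (length (X j) * 40 + 30) (\<lambda>t'. built (insert (j, X j ! q) (?E q)) t' \<and>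
      ints t' ''m'' 0 = offset j + Suc q)"
      by (rule wp_path[OF j q in'' tab'']) (use I init nin fr' in \<open>simp_all add: I_def\<close>)
    then have "wp path_prog t' (length (X j) * 40 + 39) (I (Suc q))"
      unfolding E by (rule wp_mono) (simp_all add: I_def)
    then show "tval t' (ILess (iv ''m'') (iv ''e'')) \<and> wp path_prog t' (length (X j) * 40 + 39) (I (Suc q))"
      using I q init fr' by (simp add: I_def)
  next
    fix t' assume "I (length (X j)) t'" "frame path_prog ?t t'"
    then show "\<not> tval t' (ILess (iv ''m'') (iv ''e''))"
      using init by (simp add: I_def frame_ints path_prog_writes)
  qed simp
  then have "wp (Loop (ILess (iv ''m'') (iv ''e'')) path_prog) ?t (length (X j) * (length (X j) * 40 + 40) + 1)
    (\<lambda>t'. wp (iset ''o'' (iv ''e'') ;; incr ''j'') t' 3 ?Q)"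
  proof (rule wp_conseq)
    fix t' assume fr: "frame (Loop (ILess (iv ''m'') (iv ''e'')) path_prog) ?t t'" and I: "I (length (X j)) t'"
    let ?f = "exec (iset ''o'' (iv ''e'') ;; incr ''j'') t'"
    have fr': "ints t' ''j'' = ints ?t ''j''" "ints t' ''e'' = ints ?t ''e''" "reals t' ''ca'' = reals ?t ''ca''"
      using fr by (simp_all add: frame_def path_prog_writes)
    have E: "?E (length (X j)) = entries (Suc j)" by (auto simp: entries_def less_Suc_eq)
    have b: "built (entries (Suc j)) t'" using I unfolding I_def E by blast
    then have "trie (nodes (entries (Suc j))) t'" by (simp add: built_def)
    then have "trie (nodes (entries (Suc j))) ?f" by (rule trie_cong) simp_all
    then have "built (entries (Suc j)) ?f" using b by (simp add: built_def)
    then have "?Q ?f" using init fr' ca by (simp add: offset_def)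
    then show "wp (iset ''o'' (iv ''e'') ;; incr ''j'') t' 3 ?Q"
      by (rule wp_exec[rotated]) simp_all
  qed
  then show "wp (Loop (ILess (iv ''m'') (iv ''e'')) path_prog ;; iset ''o'' (iv ''e'') ;; incr ''j'') ?t
     (length (X j) * (length (X j) * 40 + 40) + 5) ?Q"
    by (rule wp_Seq) simp
qed (simp_all add: term_init_def)

definition build_time :: nat where
  "build_time = (\<Sum>j<nz. length (X j) * (length (X j) * 40 + 40) + 21) + 10"

lemma wp_build:
  assumes s: "input s" "table_ok s" and zero: "ints s ''seen'' = (\<lambda>_. 0)" "ints s ''head'' = (\<lambda>_. 0)"
    "reals s ''beta'' = (\<lambda>_. 0)" "reals s ''V'' = (\<lambda>_. 0)" "reals s ''W'' = (\<lambda>_. 0)"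
  shows "wp build_prog s build_time (\<lambda>s'. built (entries nz) s' \<and> (\<forall>j<nz. reals s' ''ca'' j = amp j))"
proof -
  define I where "I = (\<lambda>j (t :: store). built (entries j) t \<and> ints t ''o'' 0 = offset j \<and> ints t ''j'' 0 = j \<and>
    (\<forall>i<j. reals t ''ca'' i = amp i))"
  let ?s = "exec (iset ''o'' (INat 0) ;; iset ''j'' (INat 0)) s"
  have in': "input ?s" and tab': "table_ok ?s" using s by (simp_all add: input_def table_ok_def)
  have "wp build_prog s build_time (I nz)"
    unfolding build_prog_def build_time_def
  proof (rule wp_straight_Seq)
    show "wp (Loop (ILess (iv ''j'') (iv ''nnz'')) term_prog) ?s
      ((\<Sum>j<nz. length (X j) * (length (X j) * 40 + 40) + 21) + 1) (I nz)"
    proof (rule wp_Loop)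
      have "trie {} ?s" using zero by (simp add: trie_def)
      then show "I 0 ?s" using zero by (simp add: I_def built_def entries_def nodes_def offset_def)
    next
      fix j t assume j: "j < nz" and I: "I j t" and fr: "frame term_prog ?s t"
      have in'': "input t"
        by (rule input_frame[OF in' fr]) (simp_all add: term_prog_def term_init_def path_prog_writes)
      have fr': "ints t ''tab'' = ints ?s ''tab''" "ints t ''B'' = ints ?s ''B''"
        using fr by (simp_all add: frame_def term_prog_def term_init_def path_prog_writes)
      have tab'': "table_ok t" using tab' fr' by (simp add: table_ok_def)
      have "wp term_prog t (length (X j) * (length (X j) * 40 + 40) + 20) (I (Suc j))"
        unfolding I_def by (rule wp_term[OF j in'' tab'']) (use I in \<open>simp_all add: I_def\<close>)
      moreover have "ints t ''nnz'' 0 = nz" using in'' by (simp add: input_def)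
      ultimately show "tval t (ILess (iv ''j'') (iv ''nnz'')) \<and>
        wp term_prog t (length (X j) * (length (X j) * 40 + 40) + 20) (I (Suc j))"
        using I j by (simp add: I_def)
    next
      fix t assume I: "I nz t" and fr: "frame term_prog ?s t"
      have in'': "input t"
        by (rule input_frame[OF in' fr]) (simp_all add: term_prog_def term_init_def path_prog_writes)
      then show "\<not> tval t (ILess (iv ''j'') (iv ''nnz''))" using I by (simp add: I_def input_def)
    qed (simp add: add.commute)
  qed simp_all
  then show ?thesis by (rule wp_conseq) (simp add: I_def)
qed

end

subsection \<open>The potential\<close>

text \<open>Applied with \<open>p\<close> the passage to the parent: a merge alters coefficients
  only at parents of the merged layer.\<close>

lemma sum_change_on_image:
  fixes f g :: "'a \<Rightarrow> real"
  assumes "finite A" "p ` L \<subseteq> A" "inj_on p L" "\<And>q. q \<in> A \<Longrightarrow> q \<notin> p ` L \<Longrightarrow> g q = f q"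
  shows "sum g A = sum f A + (\<Sum>x\<in>L. g (p x) - f (p x))"
proof -
  have "sum g A - sum f A = (\<Sum>q\<in>A. g q - f q)" by (simp add: sum_subtractf)
  also have "\<dots> = (\<Sum>q\<in>p ` L. g q - f q)"
    by (rule sum.mono_neutral_right) (use assms in auto)
  also have "\<dots> = (\<Sum>x\<in>L. g (p x) - f (p x))"
    by (simp add: sum.reindex[OF assms(3)])
  finally show ?thesis by simp
qed

text \<open>The supermartingale step: \<open>W\<close> is the weighted square sum before a variable is fixed to \<open>v\<close>,
  \<open>\<delta>\<close> the contribution of the merged nodes measured with the weights of their parents, \<open>D\<close> the
  mixed term. The last summand vanishes on average over \<open>v\<close>.\<close>

lemma merge_weight_bound:
  fixes W \<delta> D v :: real
  assumes "v\<^sup>2 = 1" "D\<^sup>2 \<le> \<delta> * (W - 3 * \<delta>)" "0 \<le> \<delta>"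
  shows "(W - 2 * \<delta> + 2 * v * D)\<^sup>2 \<le> W\<^sup>2 + 4 * v * (W - 2 * \<delta>) * D"
proof -
  have "(W - 2 * \<delta> + 2 * v * D)\<^sup>2 = (W - 2 * \<delta>)\<^sup>2 + 4 * v * (W - 2 * \<delta>) * D + 4 * (v\<^sup>2 * D\<^sup>2)"
    by (simp add: power2_eq_square algebra_simps)
  also have "\<dots> \<le> (W - 2 * \<delta>)\<^sup>2 + 4 * v * (W - 2 * \<delta>) * D + 4 * (\<delta> * (W - 3 * \<delta>))"
    using assms by simp
  \<comment> \<open>The terms in \<open>W * \<delta>\<close> cancel; 3 is the smallest weight for
    which they do not come out positive.\<close>
  also have "\<dots> = W\<^sup>2 + 4 * v * (W - 2 * \<delta>) * D - 8 * \<delta>\<^sup>2"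
    by (simp add: power2_eq_square algebra_simps)
  finally show ?thesis by (simp add: zero_le_power2 order_trans)
qed

section \<open>Merging a layer of the trie\<close>

context hamiltonian_data
begin

abbreviation node_set :: "nat list set" where "node_set \<equiv> nodes (entries nz)"

text \<open>The monomials left in the derivative once the variables from \<open>y\<close> on are
  fixed: tails increase, so the last letter is the largest. The root is added separately because its
  last letter is its head \<open>u\<close>, which may exceed \<open>y\<close>.\<close>

definition active :: "nat \<Rightarrow> nat \<Rightarrow> nat list set" where
  "active y u = insert [u] {xs \<in> node_set. hd xs = u \<and> last xs < y}"

definition layer :: "nat \<Rightarrow> nat list set" where
  "layer y = {xs \<in> node_set. last xs = y}"

definition layer_at :: "nat \<Rightarrow> nat \<Rightarrow> nat list set" where
  "layer_at y u = {xs \<in> node_set. hd xs = u \<and> last xs = y}"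

lemma node_setE:
  assumes "xs \<in> node_set"
  obtains j u i where "j < nz" "u \<in> set (X j)" "xs = take i (path j u)" "2 \<le> i" "i \<le> length (path j u)"
  using assms by (auto simp: nodes_def entries_def prefixes2_def)

lemma node_set_words: "node_set \<subseteq> words"
proof
  fix xs assume "xs \<in> node_set"
  then obtain j u i where *: "j < nz" "u \<in> set (X j)" "xs = take i (path j u)" "2 \<le> i" "i \<le> length (path j u)"
    by (rule node_setE)
  then show "xs \<in> words"
    using path_words[OF *(1,2)] set_take_subset[of i "path j u"] by (auto simp: words_def)
qed

lemma node_set_props:
  assumes "xs \<in> node_set"
  shows "2 \<le> length xs" "sorted_wrt (<) (tl xs)" "length xs > 2 \<Longrightarrow> butlast xs \<in> node_set"
proof -
  from assms obtain j u i where *: "j < nz" "u \<in> set (X j)" "xs = take i (path j u)" "2 \<le> i" "i \<le> length (path j u)"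
    by (rule node_setE)
  show "2 \<le> length xs" using * by simp
  have "tl xs = take (i - 1) (filter (\<lambda>z. z \<noteq> u) (X j))" using *(3,4) by (cases i) (auto simp: path_def)
  then show "sorted_wrt (<) (tl xs)"
    using sorted_wrt_take[OF sorted_wrt_filter[OF sorted_X[OF *(1)]]] by simp
  assume "length xs > 2"
  then have "butlast xs = take (i - 1) (path j u)" "i - 1 \<in> {2..length (path j u)}"
    using * by (auto simp: butlast_take)
  then have "butlast xs \<in> prefixes2 (path j u)" unfolding prefixes2_def by blast
  then show "butlast xs \<in> node_set" using * by (auto simp: nodes_def entries_def)
qed

lemma finite_node_set [simp]: "finite node_set"
  by (auto simp: nodes_def prefixes2_def)

lemma finite_active [simp]: "finite (active y u)" and finite_layer [simp]: "finite (layer y)"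
  and finite_layer_at [simp]: "finite (layer_at y u)"
  by (auto simp: active_def layer_def layer_at_def)

lemma active_Suc: "active (Suc y) u = active y u \<union> layer_at y u"
  by (auto simp: active_def layer_at_def less_Suc_eq)

lemma active_layer_disjoint: "active y u \<inter> layer_at y u = {}"
  using node_set_props(1) by (force simp: active_def layer_at_def)

lemma sum_active_Suc: "(\<Sum>xs\<in>active (Suc y) u. f xs) = (\<Sum>xs\<in>active y u. f xs) + (\<Sum>xs\<in>layer_at y u. f xs)"
  unfolding active_Suc by (rule sum.union_disjoint) (use active_layer_disjoint in auto)

text \<open>In an increasing tail the letter \<open>y\<close> comes last, so substituting it just
  drops it, and what remains is the root or a stored prefix with smaller letters.\<close>

lemma butlast_layer_at:
  assumes "xs \<in> layer_at y u"
  shows "butlast xs \<in> active y u" "xs = butlast xs @ [y]" "butlast xs \<noteq> []" "length (butlast xs) = length xs - 1"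
    "2 \<le> length xs" "tl xs = tl (butlast xs) @ [y]"
proof -
  have xs: "xs \<in> node_set" "hd xs = u" "last xs = y" using assms by (auto simp: layer_at_def)
  note len = node_set_props(1)[OF xs(1)]
  have ne: "xs \<noteq> []" using len by auto
  show app: "xs = butlast xs @ [y]" using xs(3) ne by (metis append_butlast_last_id)
  show bn: "butlast xs \<noteq> []" using len by (cases xs rule: rev_cases) auto
  show "length (butlast xs) = length xs - 1" "2 \<le> length xs" using len by simp_all
  show tl: "tl xs = tl (butlast xs) @ [y]" using app bn by (metis tl_append2)
  have hd: "hd (butlast xs) = u" using xs(2) app bn by (metis hd_append2)
  show "butlast xs \<in> active y u"
  proof (cases "length xs > 2")
    case True
    have "length (tl (butlast xs)) > 0" using True by simp
    then have "tl (butlast xs) \<noteq> []" by blast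
    then have "last (butlast xs) \<in> set (tl (butlast xs))" by (metis last_in_set last_tl)
    moreover have "sorted_wrt (<) (tl (butlast xs) @ [y])" using node_set_props(2)[OF xs(1)] tl by simp
    ultimately have "last (butlast xs) < y" by (simp add: sorted_wrt_append)
    then show ?thesis using node_set_props(3)[OF xs(1) True] hd by (simp add: active_def)
  next
    case False
    then have "length (butlast xs) = 1" using len by simp
    then obtain a where "butlast xs = [a]" by (metis One_nat_def length_0_conv length_Suc_conv)
    then show ?thesis using hd by (simp add: active_def)
  qed
qed

text \<open>A parent has at most one child per letter; hence the changes made by one merge do not
  overlap.\<close>

lemma inj_butlast_layer: "inj_on butlast (layer y)"
proof (rule inj_onI)
  fix a b assume "a \<in> layer y" "b \<in> layer y" "butlast a = butlast b"
  then show "a = b" using butlast_layer_at(2)[of a y "hd a"] butlast_layer_at(2)[of b y "hd b"]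
    by (simp add: layer_def layer_at_def)
qed

lemma layer_at_subset: "layer_at y u \<subseteq> layer y"
  by (auto simp: layer_at_def layer_def)

lemma hd_butlast_layer_at: "x \<in> layer_at y u \<Longrightarrow> hd (butlast x) = u"
  using butlast_layer_at(1)[of x y u] by (auto simp: active_def)

text \<open>Substitutes \<open>v\<close> for the variable \<open>y\<close>. The sum has at most one
  summand and yields 0 where there is no child.\<close>

definition merge :: "nat \<Rightarrow> real \<Rightarrow> (nat list \<Rightarrow> real) \<Rightarrow> nat list \<Rightarrow> real" where
  "merge y v \<beta> q = \<beta> q + v * (\<Sum>x \<in> {x \<in> layer y. butlast x = q}. \<beta> x)"

lemma merge_butlast: "x \<in> layer y \<Longrightarrow> merge y v \<beta> (butlast x) = \<beta> (butlast x) + v * \<beta> x"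
proof -
  assume x: "x \<in> layer y"
  have "{z \<in> layer y. butlast z = butlast x} = {x}"
    using x inj_onD[OF inj_butlast_layer] by auto
  then show ?thesis by (simp add: merge_def)
qed

lemma merge_other: "q \<notin> butlast ` layer y \<Longrightarrow> merge y v \<beta> q = \<beta> q"
proof -
  assume "q \<notin> butlast ` layer y"
  then have "{z \<in> layer y. butlast z = q} = {}" by auto
  then show ?thesis by (simp only: merge_def sum.empty)
qed

text \<open>Stated for an arbitrary \<open>h\<close> to serve the square sum, the weighted sum and
  the value of the derivative alike.\<close>

lemma sum_merge:
  "(\<Sum>q\<in>active y u. h q (merge y v \<beta> q)) = (\<Sum>q\<in>active y u. h q (\<beta> q)) +
    (\<Sum>x\<in>layer_at y u. h (butlast x) (\<beta> (butlast x) + v * \<beta> x) - h (butlast x) (\<beta> (butlast x)) :: real)"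
proof -
  have inj: "inj_on butlast (layer_at y u)"
    by (rule inj_on_subset[OF inj_butlast_layer layer_at_subset])
  have eq: "merge y v \<beta> q = \<beta> q" if "q \<in> active y u" "q \<notin> butlast ` layer_at y u" for q
  proof (rule merge_other, rule notI)
    assume "q \<in> butlast ` layer y"
    then obtain x where x: "x \<in> layer y" "q = butlast x" by auto
    then have "x \<in> layer_at y (hd x)" by (simp add: layer_def layer_at_def)
    then have "hd x = u" using x that(1) hd_butlast_layer_at[of x y "hd x"] by (auto simp: active_def)
    with x that(2) \<open>x \<in> layer_at y (hd x)\<close> show False by auto
  qed
  have "(\<Sum>q\<in>active y u. h q (merge y v \<beta> q)) = (\<Sum>q\<in>active y u. h q (\<beta> q)) +
    (\<Sum>x\<in>layer_at y u. h (butlast x) (merge y v \<beta> (butlast x)) - h (butlast x) (\<beta> (butlast x)))"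
    by (rule sum_change_on_image) (use inj eq butlast_layer_at(1) in auto)
  also have "(\<Sum>x\<in>layer_at y u. h (butlast x) (merge y v \<beta> (butlast x)) - h (butlast x) (\<beta> (butlast x))) =
    (\<Sum>x\<in>layer_at y u. h (butlast x) (\<beta> (butlast x) + v * \<beta> x) - h (butlast x) (\<beta> (butlast x)))"
    using layer_at_subset[of y u] by (intro sum.cong) (auto simp: merge_butlast)
  finally show ?thesis .
qed

definition square_sum :: "nat \<Rightarrow> (nat list \<Rightarrow> real) \<Rightarrow> nat \<Rightarrow> real" where
  "square_sum y \<beta> u = (\<Sum>xs\<in>active y u. (\<beta> xs)\<^sup>2)"

definition weight_sum :: "nat \<Rightarrow> (nat list \<Rightarrow> real) \<Rightarrow> nat \<Rightarrow> real" where
  "weight_sum y \<beta> u = (\<Sum>xs\<in>active y u. 3 ^ (length xs - 1) * (\<beta> xs)\<^sup>2)"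

text \<open>A node \<open>xs\<close> stands for a monomial of degree \<open>length xs - 1\<close>;
  this is the weight of its parent, one degree lower, so in these units the node itself counts
  3.\<close>

definition par_weight :: "nat list \<Rightarrow> real" where "par_weight xs = 3 ^ (length xs - 2)"

lemma weight_sum_Suc:
  "weight_sum (Suc y) \<beta> u = weight_sum y \<beta> u + 3 * (\<Sum>x\<in>layer_at y u. par_weight x * (\<beta> x)\<^sup>2)"
proof -
  have "(\<Sum>x\<in>layer_at y u. 3 ^ (length x - 1) * (\<beta> x)\<^sup>2) = (\<Sum>x\<in>layer_at y u. 3 * (par_weight x * (\<beta> x)\<^sup>2))"
  proof (rule sum.cong[OF refl])
    fix x assume "x \<in> layer_at y u"
    then have "length x - 1 = Suc (length x - 2)" using butlast_layer_at(5)[of x y u] by simp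
    then show "3 ^ (length x - 1) * (\<beta> x)\<^sup>2 = 3 * (par_weight x * (\<beta> x)\<^sup>2)"
      by (simp only: par_weight_def) simp
  qed
  then show ?thesis unfolding weight_sum_def sum_active_Suc by (simp add: sum_distrib_left)
qed

text \<open>The part of the weighted sum after the merge that does not depend on \<open>v\<close>: a
  merged square drops from weight 3 to weight 1 in units of its parent.\<close>

definition shrunk_weight :: "nat \<Rightarrow> (nat list \<Rightarrow> real) \<Rightarrow> nat \<Rightarrow> real" where
  "shrunk_weight y \<beta> u = weight_sum (Suc y) \<beta> u - 2 * (\<Sum>x\<in>layer_at y u. par_weight x * (\<beta> x)\<^sup>2)"

lemma weight_sum_merge:
  assumes "v\<^sup>2 = 1"
  shows "weight_sum y (merge y v \<beta>) u = shrunk_weight y \<beta> u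
    + 2 * v * (\<Sum>x\<in>layer_at y u. par_weight x * \<beta> (butlast x) * \<beta> x)"
proof -
  have "weight_sum y (merge y v \<beta>) u = weight_sum y \<beta> u + (\<Sum>x\<in>layer_at y u.
      3 ^ (length (butlast x) - 1) * (\<beta> (butlast x) + v * \<beta> x)\<^sup>2 - 3 ^ (length (butlast x) - 1) * (\<beta> (butlast x))\<^sup>2)"
    unfolding weight_sum_def by (rule sum_merge)
  also have "(\<Sum>x\<in>layer_at y u.
      3 ^ (length (butlast x) - 1) * (\<beta> (butlast x) + v * \<beta> x)\<^sup>2 - 3 ^ (length (butlast x) - 1) * (\<beta> (butlast x))\<^sup>2)
    = (\<Sum>x\<in>layer_at y u. 2 * v * (par_weight x * \<beta> (butlast x) * \<beta> x) + par_weight x * (\<beta> x)\<^sup>2)"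
  proof (rule sum.cong[OF refl])
    fix x assume "x \<in> layer_at y u"
    then have "length (butlast x) - 1 = length x - 2" by simp
    moreover have "(\<beta> (butlast x) + v * \<beta> x)\<^sup>2 = (\<beta> (butlast x))\<^sup>2 + 2 * v * (\<beta> (butlast x) * \<beta> x) + (\<beta> x)\<^sup>2"
      using assms by (simp add: power2_sum power_mult_distrib)
    ultimately show "3 ^ (length (butlast x) - 1) * (\<beta> (butlast x) + v * \<beta> x)\<^sup>2 -
        3 ^ (length (butlast x) - 1) * (\<beta> (butlast x))\<^sup>2
      = 2 * v * (par_weight x * \<beta> (butlast x) * \<beta> x) + par_weight x * (\<beta> x)\<^sup>2"
      by (simp only: par_weight_def) (simp add: algebra_simps)
  qed
  also have "\<dots> = 2 * v * (\<Sum>x\<in>layer_at y u. par_weight x * \<beta> (butlast x) * \<beta> x)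
      + (\<Sum>x\<in>layer_at y u. par_weight x * (\<beta> x)\<^sup>2)"
    by (simp add: sum.distrib sum_distrib_left)
  finally show ?thesis by (simp add: shrunk_weight_def weight_sum_Suc)
qed

lemma square_sum_merge:
  assumes "v\<^sup>2 = 1"
  shows "square_sum y (merge y v \<beta>) u = square_sum (Suc y) \<beta> u + 2 * v * (\<Sum>x\<in>layer_at y u. \<beta> (butlast x) * \<beta> x)"
proof -
  have "square_sum y (merge y v \<beta>) u = square_sum y \<beta> u +
      (\<Sum>x\<in>layer_at y u. (\<beta> (butlast x) + v * \<beta> x)\<^sup>2 - (\<beta> (butlast x))\<^sup>2)"
    unfolding square_sum_def by (rule sum_merge)
  also have "(\<Sum>x\<in>layer_at y u. (\<beta> (butlast x) + v * \<beta> x)\<^sup>2 - (\<beta> (butlast x))\<^sup>2)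
    = (\<Sum>x\<in>layer_at y u. 2 * v * (\<beta> (butlast x) * \<beta> x) + (\<beta> x)\<^sup>2)"
    using assms by (intro sum.cong) (simp_all add: power2_sum power_mult_distrib)
  finally show ?thesis
    unfolding square_sum_def sum_active_Suc by (simp add: sum.distrib sum_distrib_left)
qed

text \<open>Merging is substitution, so the value at every sign vector that agrees with the chosen
  sign is preserved; after the last merge the constant term is that value.\<close>

lemma gradient_merge:
  fixes \<sigma> :: "nat \<Rightarrow> real"
  shows "(\<Sum>xs\<in>active y u. merge y (\<sigma> y) \<beta> xs * prod_list (map \<sigma> (tl xs)))
    = (\<Sum>xs\<in>active (Suc y) u. \<beta> xs * prod_list (map \<sigma> (tl xs)))"
proof -
  have "(\<Sum>xs\<in>active y u. merge y (\<sigma> y) \<beta> xs * prod_list (map \<sigma> (tl xs))) =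
    (\<Sum>xs\<in>active y u. \<beta> xs * prod_list (map \<sigma> (tl xs))) + (\<Sum>x\<in>layer_at y u.
      (\<beta> (butlast x) + \<sigma> y * \<beta> x) * prod_list (map \<sigma> (tl (butlast x))) - \<beta> (butlast x) * prod_list (map \<sigma> (tl (butlast x))))"
    by (rule sum_merge)
  also have "(\<Sum>x\<in>layer_at y u.
      (\<beta> (butlast x) + \<sigma> y * \<beta> x) * prod_list (map \<sigma> (tl (butlast x))) - \<beta> (butlast x) * prod_list (map \<sigma> (tl (butlast x))))
    = (\<Sum>x\<in>layer_at y u. \<beta> x * prod_list (map \<sigma> (tl x)))"
  proof (rule sum.cong[OF refl])
    fix x assume "x \<in> layer_at y u"
    then have t: "tl x = tl (butlast x) @ [y]" by (rule butlast_layer_at(6))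
    show "(\<beta> (butlast x) + \<sigma> y * \<beta> x) * prod_list (map \<sigma> (tl (butlast x))) - \<beta> (butlast x) * prod_list (map \<sigma> (tl (butlast x)))
      = \<beta> x * prod_list (map \<sigma> (tl x))"
      unfolding t by (simp add: algebra_simps)
  qed
  finally show ?thesis by (simp add: sum_active_Suc)
qed

definition potential :: "(nat \<Rightarrow> real) \<Rightarrow> (nat \<Rightarrow> real) \<Rightarrow> nat \<Rightarrow> (nat list \<Rightarrow> real) \<Rightarrow> real" where
  "potential a b y \<beta> = (\<Sum>u\<in>{1..3 * n}. a u * square_sum y \<beta> u - b u * (weight_sum y \<beta> u)\<^sup>2)"

text \<open>Half the coefficient of \<open>v\<close> in the lower bound for the potential after the
  merge, arranged as one sum over the nodes of the layer for the program.\<close>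

definition sign_score :: "(nat \<Rightarrow> real) \<Rightarrow> (nat \<Rightarrow> real) \<Rightarrow> nat \<Rightarrow> (nat list \<Rightarrow> real) \<Rightarrow> real" where
  "sign_score a b y \<beta> = (\<Sum>x\<in>layer y. \<beta> (butlast x) * \<beta> x *
     (a (hd x) - 2 * b (hd x) * par_weight x * shrunk_weight y \<beta> (hd x)))"

lemma sum_layer: "(\<Sum>x\<in>layer y. f x) = (\<Sum>u\<in>{1..3 * n}. \<Sum>x\<in>layer_at y u. f x)"
proof -
  have "hd x \<in> {1..3 * n}" if "x \<in> layer y" for x
    using that node_set_words by (cases x) (auto simp: layer_def words_def)
  then have "(\<Sum>x\<in>layer y. f x) = (\<Sum>u\<in>{1..3 * n}. sum f {x \<in> layer y. hd x = u})"
    by (intro sum.group[symmetric]) auto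
  moreover have "{x \<in> layer y. hd x = u} = layer_at y u" for u by (auto simp: layer_def layer_at_def)
  ultimately show ?thesis by simp
qed

text \<open>By \<open>merge_weight_bound\<close> the new potential is at least the old one plus
  \<open>2 * v * sign_score\<close>; the sign \<open>v\<close> is chosen to make this increment
  nonnegative.\<close>

lemma potential_merge:
  assumes v: "v\<^sup>2 = 1" "0 \<le> v * sign_score a b y \<beta>" and b: "\<And>u. 0 \<le> b u"
  shows "potential a b (Suc y) \<beta> \<le> potential a b y (merge y v \<beta>)"
proof -
  let ?W = "weight_sum (Suc y) \<beta>" and ?Z = "shrunk_weight y \<beta>"
  let ?C = "\<lambda>u. \<Sum>x\<in>layer_at y u. \<beta> (butlast x) * \<beta> x"
  let ?D = "\<lambda>u. \<Sum>x\<in>layer_at y u. par_weight x * \<beta> (butlast x) * \<beta> x"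
  let ?d = "\<lambda>u. \<Sum>x\<in>layer_at y u. par_weight x * (\<beta> x)\<^sup>2"
  have bound: "(weight_sum y (merge y v \<beta>) u)\<^sup>2 \<le> (?W u)\<^sup>2 + 4 * v * ?Z u * ?D u" for u
  proof -
    \<comment> \<open>Cauchy-Schwarz: the children give \<open>?d u\<close>, and the parents, all in
      \<open>active y u\<close>, give at most the weighted sum without the layer, which is
      \<open>?W u - 3 * ?d u\<close>.\<close>
    have "(?D u)\<^sup>2 = (\<Sum>x\<in>layer_at y u. (sqrt (par_weight x) * \<beta> x) * (sqrt (par_weight x) * \<beta> (butlast x)))\<^sup>2"
      by (intro arg_cong[where f = "\<lambda>z. z\<^sup>2"] sum.cong) (simp_all add: par_weight_def)
    also have "\<dots> \<le> (\<Sum>x\<in>layer_at y u. (sqrt (par_weight x) * \<beta> x)\<^sup>2) *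
        (\<Sum>x\<in>layer_at y u. (sqrt (par_weight x) * \<beta> (butlast x))\<^sup>2)"
      by (rule Cauchy_Schwarz_ineq_sum)
    also have "(\<Sum>x\<in>layer_at y u. (sqrt (par_weight x) * \<beta> x)\<^sup>2) = ?d u"
      by (simp add: power_mult_distrib par_weight_def)
    also have "(\<Sum>x\<in>layer_at y u. (sqrt (par_weight x) * \<beta> (butlast x))\<^sup>2)
       = (\<Sum>x\<in>layer_at y u. 3 ^ (length (butlast x) - 1) * (\<beta> (butlast x))\<^sup>2)"
      by (intro sum.cong) (simp_all add: power_mult_distrib par_weight_def numeral_2_eq_2)
    also have "\<dots> = (\<Sum>q\<in>butlast ` layer_at y u. 3 ^ (length q - 1) * (\<beta> q)\<^sup>2)"
      by (subst sum.reindex[OF inj_on_subset[OF inj_butlast_layer layer_at_subset]]) simp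
    also have "\<dots> \<le> weight_sum y \<beta> u"
      unfolding weight_sum_def by (rule sum_mono2) (use butlast_layer_at(1) in auto)
    also have "weight_sum y \<beta> u = ?W u - 3 * ?d u" by (simp add: weight_sum_Suc)
    finally have "(?D u)\<^sup>2 \<le> ?d u * (?W u - 3 * ?d u)"
      by (simp add: mult_left_mono sum_nonneg par_weight_def)
    from merge_weight_bound[OF v(1) this] show ?thesis
      unfolding weight_sum_merge[OF v(1)] by (simp add: shrunk_weight_def sum_nonneg par_weight_def)
  qed
  have score: "sign_score a b y \<beta> = (\<Sum>u\<in>{1..3 * n}. a u * ?C u - 2 * b u * ?Z u * ?D u)"
    unfolding sign_score_def sum_layer
  proof (rule sum.cong[OF refl])
    fix u assume "u \<in> {1..3 * n}"
    have "(\<Sum>x\<in>layer_at y u. \<beta> (butlast x) * \<beta> x * (a (hd x) - 2 * b (hd x) * par_weight x * ?Z (hd x)))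
      = (\<Sum>x\<in>layer_at y u. a u * (\<beta> (butlast x) * \<beta> x) - 2 * b u * ?Z u * (par_weight x * \<beta> (butlast x) * \<beta> x))"
      by (rule sum.cong) (auto simp: layer_at_def algebra_simps)
    then show "(\<Sum>x\<in>layer_at y u. \<beta> (butlast x) * \<beta> x * (a (hd x) - 2 * b (hd x) * par_weight x * ?Z (hd x)))
      = a u * ?C u - 2 * b u * ?Z u * ?D u"
      by (simp add: sum_subtractf sum_distrib_left)
  qed
  have "potential a b (Suc y) \<beta> \<le> potential a b (Suc y) \<beta> + 2 * (v * sign_score a b y \<beta>)"
    using v(2) by simp
  also have "\<dots> = (\<Sum>u\<in>{1..3 * n}. a u * square_sum (Suc y) \<beta> u - b u * (?W u)\<^sup>2 + 2 * v * (a u * ?C u - 2 * b u * ?Z u * ?D u))"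
    unfolding potential_def score by (simp only: sum.distrib sum_distrib_left[symmetric] mult.assoc)
  also have "\<dots> \<le> (\<Sum>u\<in>{1..3 * n}. a u * square_sum y (merge y v \<beta>) u - b u * (weight_sum y (merge y v \<beta>) u)\<^sup>2)"
  proof (rule sum_mono)
    fix u
    have "b u * (weight_sum y (merge y v \<beta>) u)\<^sup>2 \<le> b u * ((?W u)\<^sup>2 + 4 * v * ?Z u * ?D u)"
      by (rule mult_left_mono[OF bound b])
    then show "a u * square_sum (Suc y) \<beta> u - b u * (?W u)\<^sup>2 + 2 * v * (a u * ?C u - 2 * b u * ?Z u * ?D u)
      \<le> a u * square_sum y (merge y v \<beta>) u - b u * (weight_sum y (merge y v \<beta>) u)\<^sup>2"
      unfolding square_sum_merge[OF v(1)] by (simp add: algebra_simps)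
  qed
  finally show ?thesis by (simp only: potential_def)
qed

end

subsection \<open>Choosing the signs\<close>

lemma exec_frame: "straight c \<Longrightarrow> frame c s (exec c s)"
  by (induction c arbitrary: s) (auto simp: frame_def)

definition list_loop :: "com \<Rightarrow> com" where
  "list_loop p = Loop (ILess (INat 0) (iv ''c'')) (p ;; iset ''c'' (ICell ''nxt'' (iv ''c'')))"

lemma wp_list_loop:
  assumes p: "straight p" "''c'' \<notin> int_writes p" "''nxt'' \<notin> int_writes p"
    and chain: "chain (ints s ''nxt'') (ints s ''c'' 0) cs"
    and start: "I 0 s"
    and step: "\<And>q t. q < length cs \<Longrightarrow> I q t \<Longrightarrow> frame (list_loop p) s t \<Longrightarrow> ints t ''c'' 0 = cs ! q \<Longrightarrow>
      I (Suc q) (exec p t)"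
    and c: "\<And>q t i. I q t \<Longrightarrow> I q (set_int ''c'' 0 i t)"
  shows "wp (list_loop p) s (length cs * (cost p + 3) + 1) (I (length cs))"
proof -
  define J where "J = (\<lambda>q t. chain (ints t ''nxt'') (ints t ''c'' 0) (drop q cs) \<and> I q t)"
  have "wp (list_loop p) s (length cs * (cost p + 3) + 1) (J (length cs))"
    unfolding list_loop_def
  proof (rule wp_Loop[where b = "\<lambda>_. cost p + 2"])
    show "J 0 s" using chain start by (simp add: J_def)
  next
    fix q t assume q: "q < length cs" and J: "J q t" and fr: "frame (p ;; iset ''c'' (ICell ''nxt'' (iv ''c''))) s t"
    have d: "drop q cs = cs ! q # drop (Suc q) cs" using q by (simp add: Cons_nth_drop_Suc)
    have c': "ints t ''c'' 0 = cs ! q" "0 < cs ! q" "chain (ints t ''nxt'') (ints t ''nxt'' (cs ! q)) (drop (Suc q) cs)"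
      using J unfolding J_def d by simp_all
    have fr': "frame (list_loop p) s t" using fr by (simp add: frame_def list_loop_def)
    have "I (Suc q) (exec p t)" using step[OF q _ fr' c'(1)] J by (simp add: J_def)
    moreover have "ints (exec p t) ''c'' = ints t ''c''" "ints (exec p t) ''nxt'' = ints t ''nxt''"
      using exec_frame[OF p(1), of t] p(2,3) by (simp_all add: frame_ints)
    ultimately have "J (Suc q) (exec (p ;; iset ''c'' (ICell ''nxt'' (iv ''c''))) t)"
      using c c' by (simp add: J_def)
    then have "wp (p ;; iset ''c'' (ICell ''nxt'' (iv ''c''))) t (cost p + 2) (J (Suc q))"
      by (rule wp_exec[rotated]) (simp_all add: p)
    then show "tval t (ILess (INat 0) (iv ''c'')) \<and>
      wp (p ;; iset ''c'' (ICell ''nxt'' (iv ''c''))) t (cost p + 2) (J (Suc q))"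
      using c' by simp
  next
    fix t assume "J (length cs) t"
    then show "\<not> tval t (ILess (INat 0) (iv ''c''))" by (simp add: J_def)
  qed (simp add: algebra_simps)
  then show ?thesis by (rule wp_conseq) (simp add: J_def)
qed

abbreviation rhalf :: rexp where "rhalf \<equiv> RDiv (rnat 1) (rnat 2)"
abbreviation cur :: "vname \<Rightarrow> rexp" where "cur a \<equiv> RCell a (iv ''c'')"
abbreviation at_root :: "vname \<Rightarrow> rexp" where "at_root a \<equiv> RCell a (ICell ''root'' (iv ''c''))"
abbreviation par_beta :: rexp where "par_beta \<equiv> RCell ''beta'' (ICell ''par'' (iv ''c''))"

definition shrink_step :: com where
  "shrink_step = RStore ''W'' (ICell ''root'' (iv ''c''))
     (RSub (at_root ''W'') (RMul (rnat 2) (RMul (cur ''wgt'') (RMul (cur ''beta'') (cur ''beta'')))))"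

text \<open>The quotients are \<open>lin_coef\<close> and \<open>sq_coef\<close>, recomputed from
  \<open>K\<close> and \<open>V\<close> for each node; \<open>W\<close> already holds the shrunk
  sum.\<close>

definition score_step :: com where
  "score_step = rset ''T'' (RAdd (rv ''T'') (RMul (RMul par_beta (cur ''beta''))
     (RSub (RDiv (rnat 3) (RMul (rnat 2) (RMul (rv ''K'') (RPow (at_root ''V'') rhalf))))
       (RMul (RMul (RMul (rnat 2) (RDiv (rnat 1) (RMul (rnat 2) (RPow (RMul (rv ''K'') (RPow (at_root ''V'') rhalf)) (rnat 3)))))
         (cur ''wgt'')) (at_root ''W'')))))"

text \<open>The weighted sum comes first, as it needs the coefficient of the parent before the
  merge.\<close>

definition update_step :: com where
  "update_step = RStore ''W'' (ICell ''root'' (iv ''c'')) (RAdd (at_root ''W'')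
      (RMul (RMul (rnat 2) (RCell ''v'' (iv ''y''))) (RMul (RMul (cur ''wgt'') par_beta) (cur ''beta'')))) ;;
    RStore ''beta'' (ICell ''par'' (iv ''c'')) (RAdd par_beta (RMul (RCell ''v'' (iv ''y'')) (cur ''beta'')))"

definition sign_step :: com where
  "sign_step = Cond (RLess (rv ''T'') (rnat 0)) (RStore ''v'' (iv ''y'') (RSub (rnat 0) (rnat 1)))
      (RStore ''v'' (iv ''y'') (rnat 1)) ;; iset ''c'' (ICell ''head'' (iv ''y''))"

text \<open>Three passes are made: a score refers to the completely shrunk sums, and the sign is
  known only after the last score.\<close>

definition layer_prog :: com where
  "layer_prog = iset ''c'' (ICell ''head'' (iv ''y'')) ;; list_loop shrink_step ;;
    (iset ''c'' (ICell ''head'' (iv ''y'')) ;; rset ''T'' (rnat 0)) ;; list_loop score_step ;;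
    sign_step ;; list_loop update_step ;; iset ''y'' (ISub (iv ''y'') (INat 1))"

definition merge_prog :: com where
  "merge_prog = (rset ''K'' (RPow (rnat 3) (RNat (ISub (iv ''k'') (INat 1)))) ;;
     iset ''y'' (IAdd (iv ''n'') (IAdd (iv ''n'') (iv ''n'')))) ;; Loop (ILess (INat 0) (iv ''y'')) layer_prog"

lemma layer_writes:
  "int_writes (list_loop p) = insert ''c'' (int_writes p)" "real_writes (list_loop p) = real_writes p"
  "int_writes layer_prog = {''c'', ''y''}" "real_writes layer_prog = {''W'', ''T'', ''v'', ''beta''}"
  by (simp_all add: list_loop_def layer_prog_def shrink_step_def score_step_def sign_step_def
      update_step_def insert_commute)

context hamiltonian_data
begin

definition coef :: "store \<Rightarrow> nat list \<Rightarrow> real" where "coef s xs = reals s ''beta'' (code xs)"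

text \<open>With r = 3^(k-1) sqrt V, this and the next constant are the coefficients 3/(2r) and
  1/(2r^3) of \<open>abs_ge_quartic\<close>. \<open>V\<close> is not changed by merging, so they
  stay fixed throughout; for V = 0 both are 0.\<close>

definition lin_coef :: "store \<Rightarrow> nat \<Rightarrow> real" where
  "lin_coef s u = 3 / (2 * (3 ^ (k - 1) * \<bar>reals s ''V'' u\<bar> powr (1 / 2)))"

definition sq_coef :: "store \<Rightarrow> nat \<Rightarrow> real" where
  "sq_coef s u = 1 / (2 * (3 ^ (k - 1) * \<bar>reals s ''V'' u\<bar> powr (1 / 2)) ^ 3)"

text \<open>A store agrees with the intended coefficients only at codes of words; the sums over
  active monomials look at nothing else.\<close>

lemma coef_cong:
  assumes "\<And>xs. xs \<in> words \<Longrightarrow> \<beta> xs = \<beta>' xs" "u \<in> {1..3 * n}"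
  shows "square_sum y \<beta> u = square_sum y \<beta>' u" "weight_sum y \<beta> u = weight_sum y \<beta>' u"
    "(\<Sum>xs\<in>active y u. \<beta> xs * f xs) = (\<Sum>xs\<in>active y u. \<beta>' xs * f xs)"
proof -
  have "\<beta> xs = \<beta>' xs" if "xs \<in> active y u" for xs
    using that assms node_set_words by (auto simp: active_def words_def)
  then show "square_sum y \<beta> u = square_sum y \<beta>' u" "weight_sum y \<beta> u = weight_sum y \<beta>' u"
    "(\<Sum>xs\<in>active y u. \<beta> xs * f xs) = (\<Sum>xs\<in>active y u. \<beta>' xs * f xs)"
    unfolding square_sum_def weight_sum_def by (simp_all cong: sum.cong)
qed

lemma potential_cong:
  assumes "\<And>xs. xs \<in> words \<Longrightarrow> \<beta> xs = \<beta>' xs"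
  shows "potential a b y \<beta> = potential a b y \<beta>'"
  unfolding potential_def using coef_cong[OF assms] by (intro sum.cong) simp_all

lemma trie_node:
  assumes "trie node_set s" "x \<in> node_set"
  shows "ints s ''par'' (code x) = code (butlast x)" "ints s ''root'' (code x) = hd x"
    "reals s ''wgt'' (code x) = par_weight x"
  using assms by (simp_all add: trie_def par_weight_def)

lemma sum_layer_at: "(\<Sum>x\<in>layer y. if hd x = u then f x else 0) = (\<Sum>x\<in>layer_at y u. f x :: real)"
proof -
  have "layer_at y u = {x \<in> layer y. hd x = u}" by (auto simp: layer_def layer_at_def)
  then show ?thesis by (simp add: sum.inter_filter)
qed

lemma layer_hd: "x \<in> layer y \<Longrightarrow> hd x \<in> {1..3 * n}"
  using node_set_words by (cases x) (auto simp: layer_def words_def)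

lemma butlast_layer_words: "x \<in> layer y \<Longrightarrow> butlast x \<in> words"
  and layer_words: "x \<in> layer y \<Longrightarrow> x \<in> words"
proof -
  assume x: "x \<in> layer y"
  then show w: "x \<in> words" using node_set_words by (auto simp: layer_def)
  have "x \<in> layer_at y (hd x)" using x by (simp add: layer_def layer_at_def)
  then have "butlast x \<noteq> []" by (rule butlast_layer_at(3))
  then show "butlast x \<in> words" using w by (auto simp: words_def dest: in_set_butlastD)
qed

text \<open>Guarantees that a pass over one layer never overwrites the coefficient of a node that it
  still has to read.\<close>

lemma butlast_notin_layer: "x \<in> layer y \<Longrightarrow> butlast x \<notin> layer y"
proof
  assume x: "x \<in> layer y" and b: "butlast x \<in> layer y"
  have "x \<in> layer_at y (hd x)" using x by (simp add: layer_def layer_at_def)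
  note butlast_layer_at(1)[OF this]
  moreover have "length (butlast x) \<ge> 2" "last (butlast x) = y"
    using b node_set_props(1)[of "butlast x"] by (simp_all add: layer_def)
  ultimately show False by (auto simp: active_def)
qed

context
  fixes y :: nat and ys :: "nat list list"
  assumes ys: "distinct ys" "set ys = layer y"
begin

lemma nth_layer: "q < length ys \<Longrightarrow> ys ! q \<in> layer y" "q < length ys \<Longrightarrow> ys ! q \<in> node_set"
  using ys(2) nth_mem[of q ys] by (auto simp: layer_def)

lemma sum_take_Suc:
  "q < length ys \<Longrightarrow> (\<Sum>x\<in>set (take (Suc q) ys). f x) = f (ys ! q) + (\<Sum>x\<in>set (take q ys). f x :: real)"
proof -
  assume q: "q < length ys"
  have "ys ! q \<notin> set (take q ys)"
    using ys(1) q by (auto simp: in_set_conv_nth nth_eq_iff_index_eq)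
  then show ?thesis using q by (simp add: take_Suc_conv_app_nth)
qed

lemma wp_shrink:
  assumes s: "trie node_set s" "chain (ints s ''nxt'') (ints s ''c'' 0) (map code ys)"
    "\<And>u. u \<in> {1..3 * n} \<Longrightarrow> reals s ''W'' u = weight_sum (Suc y) (coef s) u"
  shows "wp (list_loop shrink_step) s (length ys * 10 + 1)
    (\<lambda>t. \<forall>u\<in>{1..3 * n}. reals t ''W'' u = shrunk_weight y (coef s) u)"
proof -
  define I where "I = (\<lambda>q (t :: store). \<forall>u\<in>{1..3 * n}. reals t ''W'' u = weight_sum (Suc y) (coef s) u -
    2 * (\<Sum>x\<in>set (take q ys). if hd x = u then par_weight x * (coef s x)\<^sup>2 else 0))"
  have "wp (list_loop shrink_step) s (length (map code ys) * (cost shrink_step + 3) + 1) (I (length (map code ys)))"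
  proof (rule wp_list_loop)
    show "I 0 s" using s(3) by (simp add: I_def)
  next
    fix q t assume q: "q < length (map code ys)" and I: "I q t" and fr: "frame (list_loop shrink_step) s t"
      and c: "ints t ''c'' 0 = map code ys ! q"
    let ?x = "ys ! q"
    have x: "?x \<in> layer y" "?x \<in> node_set" using q nth_layer[of q] by simp_all
    have fr': "ints t ''root'' = ints s ''root''" "reals t ''wgt'' = reals s ''wgt''" "reals t ''beta'' = reals s ''beta''"
      using fr by (simp_all add: frame_def layer_writes shrink_step_def)
    have "reals (exec shrink_step t) ''W'' u = weight_sum (Suc y) (coef s) u -
      2 * (\<Sum>x\<in>set (take (Suc q) ys). if hd x = u then par_weight x * (coef s x)\<^sup>2 else 0)"
      if u: "u \<in> {1..3 * n}" for u
      using u I q c sum_take_Suc[of q "\<lambda>x. if hd x = u then par_weight x * (coef s x)\<^sup>2 else 0"]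
      by (cases "hd ?x = u") (simp_all add: I_def shrink_step_def fr' trie_node[OF s(1) x(2)] coef_def power2_eq_square)
    then show "I (Suc q) (exec shrink_step t)" by (simp add: I_def)
  qed (use s(2) in \<open>simp_all add: shrink_step_def I_def\<close>)
  then show ?thesis
    by (rule wp_mono) (simp_all add: shrink_step_def I_def ys(2) shrunk_weight_def sum_layer_at)
qed

lemma wp_score:
  assumes s: "trie node_set s" "chain (ints s ''nxt'') (ints s ''c'' 0) (map code ys)"
    "\<And>u. u \<in> {1..3 * n} \<Longrightarrow> reals s ''W'' u = shrunk_weight y (coef s) u" "reals s ''T'' 0 = 0"
    "reals s ''K'' 0 = 3 ^ (k - 1)"
  shows "wp (list_loop score_step) s (length ys * 10 + 1)
    (\<lambda>t. reals t ''T'' 0 = sign_score (lin_coef s) (sq_coef s) y (coef s))"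
proof -
  define F where "F = (\<lambda>x. coef s (butlast x) * coef s x * (lin_coef s (hd x) -
     2 * sq_coef s (hd x) * par_weight x * shrunk_weight y (coef s) (hd x)))"
  define I where "I = (\<lambda>q (t :: store). reals t ''T'' 0 = (\<Sum>x\<in>set (take q ys). F x))"
  have "wp (list_loop score_step) s (length (map code ys) * (cost score_step + 3) + 1) (I (length (map code ys)))"
  proof (rule wp_list_loop)
    show "I 0 s" using s(4) by (simp add: I_def)
  next
    fix q t assume q: "q < length (map code ys)" and I: "I q t" and fr: "frame (list_loop score_step) s t"
      and c: "ints t ''c'' 0 = map code ys ! q"
    let ?x = "ys ! q"
    have x: "?x \<in> layer y" "?x \<in> node_set" using q nth_layer[of q] by simp_all
    have fr': "ints t ''root'' = ints s ''root''" "ints t ''par'' = ints s ''par''" "reals t ''wgt'' = reals s ''wgt''"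
      "reals t ''beta'' = reals s ''beta''" "reals t ''W'' = reals s ''W''" "reals t ''V'' = reals s ''V''"
      "reals t ''K'' = reals s ''K''"
      using fr by (simp_all add: frame_def layer_writes score_step_def)
    have p3: "\<bar>z\<bar> powr 3 = z ^ 3" if "z \<ge> 0" for z :: real
      using that by (simp add: powr_numeral)
    have "reals (exec score_step t) ''T'' 0 = F ?x + (\<Sum>x\<in>set (take q ys). F x)"
      using I q c s(3)[OF layer_hd[OF x(1)]]
      by (simp add: I_def score_step_def fr' trie_node[OF s(1) x(2)] F_def coef_def lin_coef_def sq_coef_def s(5) p3)
    then show "I (Suc q) (exec score_step t)" using q sum_take_Suc[of q F] by (simp add: I_def)
  qed (use s(2) in \<open>simp_all add: score_step_def I_def\<close>)
  then show ?thesis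
    by (rule wp_mono) (simp_all add: score_step_def I_def ys(2) F_def sign_score_def)
qed

lemma wp_update:
  assumes s: "trie node_set s" "chain (ints s ''nxt'') (ints s ''c'' 0) (map code ys)"
    "\<And>u. u \<in> {1..3 * n} \<Longrightarrow> reals s ''W'' u = shrunk_weight y \<beta> u" "reals s ''v'' y = v" "v\<^sup>2 = 1"
    "ints s ''y'' 0 = y" "coef s = \<beta>"
  shows "wp (list_loop update_step) s (length ys * 10 + 1)
    (\<lambda>t. (\<forall>u\<in>{1..3 * n}. reals t ''W'' u = weight_sum y (merge y v \<beta>) u) \<and>
      (\<forall>xs\<in>words. coef t xs = merge y v \<beta> xs))"
proof -
  define I where "I = (\<lambda>q (t :: store). (\<forall>u\<in>{1..3 * n}. reals t ''W'' u = shrunk_weight y \<beta> u +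
      2 * v * (\<Sum>x\<in>set (take q ys). if hd x = u then par_weight x * \<beta> (butlast x) * \<beta> x else 0)) \<and>
    (\<forall>xs\<in>words. coef t xs = \<beta> xs + v * (\<Sum>x\<in>set (take q ys). if butlast x = xs then \<beta> x else 0)))"
  have "wp (list_loop update_step) s (length (map code ys) * (cost update_step + 3) + 1) (I (length (map code ys)))"
  proof (rule wp_list_loop)
    show "I 0 s" using s(3,7) by (simp add: I_def)
  next
    fix q t assume q: "q < length (map code ys)" and I: "I q t" and fr: "frame (list_loop update_step) s t"
      and c: "ints t ''c'' 0 = map code ys ! q"
    let ?x = "ys ! q"
    have x: "?x \<in> layer y" "?x \<in> node_set" using q nth_layer[of q] by simp_all
    have fr': "ints t ''root'' = ints s ''root''" "ints t ''par'' = ints s ''par''" "reals t ''wgt'' = reals s ''wgt''"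
      "reals t ''v'' = reals s ''v''" "ints t ''y'' = ints s ''y''"
      using fr by (simp_all add: frame_def layer_writes update_step_def)
    have sub: "set (take q ys) \<subseteq> layer y" using ys(2) set_take_subset[of q ys] by simp
    have nin: "?x \<notin> set (take q ys)"
      using ys(1) q by (auto simp: in_set_conv_nth nth_eq_iff_index_eq)
    \<comment> \<open>The nodes visited before have other parents, so the coefficient of this parent
      is still the old one.\<close>
    have "(\<Sum>z\<in>set (take q ys). if butlast z = butlast ?x then \<beta> z else 0) = 0"
    proof (rule sum.neutral, rule ballI)
      fix z assume "z \<in> set (take q ys)"
      then have "butlast z \<noteq> butlast ?x"
        using inj_onD[OF inj_butlast_layer, of z ?x y] sub x(1) nin by auto
      then show "(if butlast z = butlast ?x then \<beta> z else 0) = 0" by simp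
    qed
    then have b: "reals t ''beta'' (code (butlast ?x)) = \<beta> (butlast ?x)"
      using I butlast_layer_words[OF x(1)] by (simp add: I_def coef_def)
    have "(\<Sum>z\<in>set (take q ys). if butlast z = ?x then \<beta> z else 0) = 0"
    proof (rule sum.neutral, rule ballI)
      fix z assume "z \<in> set (take q ys)"
      then have "butlast z \<noteq> ?x" using sub x(1) butlast_notin_layer[of z y] by auto
      then show "(if butlast z = ?x then \<beta> z else 0) = 0" by simp
    qed
    then have b': "reals t ''beta'' (code ?x) = \<beta> ?x"
      using I layer_words[OF x(1)] by (simp add: I_def coef_def)
    have "code (butlast ?x) \<noteq> code ?x"
      using inj_onD[OF inj_code_words, of "butlast ?x" ?x] butlast_layer_words[OF x(1)] layer_words[OF x(1)]
        butlast_notin_layer[OF x(1)] x(1) by metis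
    have W: "reals (exec update_step t) ''W'' u = shrunk_weight y \<beta> u +
      2 * v * (\<Sum>x\<in>set (take (Suc q) ys). if hd x = u then par_weight x * \<beta> (butlast x) * \<beta> x else 0)"
      if u: "u \<in> {1..3 * n}" for u
      using u I q c sum_take_Suc[of q "\<lambda>x. if hd x = u then par_weight x * \<beta> (butlast x) * \<beta> x else 0"]
      by (cases "hd ?x = u") (simp_all add: I_def update_step_def fr' trie_node[OF s(1) x(2)] b b' s(4,6) algebra_simps)
    have B: "coef (exec update_step t) xs = \<beta> xs + v * (\<Sum>x\<in>set (take (Suc q) ys). if butlast x = xs then \<beta> x else 0)"
      if xs: "xs \<in> words" for xs
    proof -
      have iff: "code xs = code (butlast ?x) \<longleftrightarrow> butlast ?x = xs"
        using inj_onD[OF inj_code_words _ xs butlast_layer_words[OF x(1)]] by metis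
      have old: "reals t ''beta'' (code xs) = \<beta> xs + v * (\<Sum>x\<in>set (take q ys). if butlast x = xs then \<beta> x else 0)"
        using I xs by (simp add: I_def coef_def)
      have "coef (exec update_step t) xs = reals t ''beta'' (code xs) + v * (if butlast ?x = xs then \<beta> ?x else 0)"
        using q c iff by (cases "butlast ?x = xs")
          (simp_all add: coef_def update_step_def fr' trie_node[OF s(1) x(2)] b' s(4,6))
      then show ?thesis
        using q sum_take_Suc[of q "\<lambda>x. if butlast x = xs then \<beta> x else 0"] by (simp add: old algebra_simps)
    qed
    show "I (Suc q) (exec update_step t)" using W B by (simp add: I_def)
  qed (use s(2) in \<open>simp_all add: update_step_def I_def coef_def\<close>)
  then show ?thesis
  proof (rule wp_mono)
    fix t assume "I (length (map code ys)) t"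
    moreover have "(\<Sum>x\<in>layer y. if butlast x = xs then \<beta> x else 0) = (\<Sum>x\<in>{x \<in> layer y. butlast x = xs}. \<beta> x)" for xs
      by (simp add: sum.inter_filter)
    ultimately show "(\<forall>u\<in>{1..3 * n}. reals t ''W'' u = weight_sum y (merge y v \<beta>) u) \<and>
      (\<forall>xs\<in>words. coef t xs = merge y v \<beta> xs)"
      by (simp add: I_def ys(2) weight_sum_merge[OF s(5)] sum_layer_at merge_def)
  qed (simp add: update_step_def)
qed

end

lemma layer_chain:
  assumes "trie node_set s"
  obtains ys where "distinct ys" "set ys = layer y" "chain (ints s ''nxt'') (ints s ''head'' y) (map code ys)"
    "length ys = card (layer y)"
proof -
  from trie_chain[OF assms, of y] obtain ys where *: "distinct ys" "set ys = {xs \<in> node_set. last xs = y}"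
    "chain (ints s ''nxt'') (ints s ''head'' y) (map code ys)" by (elim exE conjE)
  moreover have "length ys = card (layer y)" using distinct_card[OF *(1)] *(2) by (simp add: layer_def)
  ultimately show ?thesis using that by (simp add: layer_def)
qed

lemma wp_layer:
  assumes s: "trie node_set s" "ints s ''y'' 0 = y" "reals s ''K'' 0 = 3 ^ (k - 1)"
    "\<And>u. u \<in> {1..3 * n} \<Longrightarrow> reals s ''W'' u = weight_sum (Suc y) (coef s) u"
  shows "wp layer_prog s (card (layer y) * 30 + 30) (\<lambda>t. ints t ''y'' 0 = y - 1 \<and>
    (\<forall>z. z \<noteq> y \<longrightarrow> reals t ''v'' z = reals s ''v'' z) \<and> reals t ''v'' y \<in> {1, -1} \<and>
    0 \<le> reals t ''v'' y * sign_score (lin_coef s) (sq_coef s) y (coef s) \<and>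
    (\<forall>u\<in>{1..3 * n}. reals t ''W'' u = weight_sum y (merge y (reals t ''v'' y) (coef s)) u) \<and>
    (\<forall>xs\<in>words. coef t xs = merge y (reals t ''v'' y) (coef s) xs))" (is "wp _ _ _ ?Q")
proof -
  obtain ys where ys: "distinct ys" "set ys = layer y"
    and ch: "chain (ints s ''nxt'') (ints s ''head'' y) (map code ys)" and len: "length ys = card (layer y)"
    using layer_chain[OF s(1)] .
  let ?s = "exec (iset ''c'' (ICell ''head'' (iv ''y''))) s"
  have tr0: "trie node_set ?s" by (rule trie_cong[OF s(1)]) simp_all
  have c0: "coef ?s = coef s" by (simp add: coef_def fun_eq_iff)
  have "wp (list_loop shrink_step) ?s (length ys * 10 + 1)
    (\<lambda>t. \<forall>u\<in>{1..3 * n}. reals t ''W'' u = shrunk_weight y (coef s) u)"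
    using wp_shrink[OF ys tr0, unfolded c0] ch s(2,4) by simp
  then have "wp (list_loop shrink_step) ?s (length ys * 10 + 1)
    (\<lambda>t. wp ((iset ''c'' (ICell ''head'' (iv ''y'')) ;; rset ''T'' (rnat 0)) ;; list_loop score_step ;;
      sign_step ;; list_loop update_step ;; iset ''y'' (ISub (iv ''y'') (INat 1))) t (length ys * 20 + 20) ?Q)"
  proof (rule wp_conseq)
    fix t assume fr1: "frame (list_loop shrink_step) ?s t"
      and W1: "\<forall>u\<in>{1..3 * n}. reals t ''W'' u = shrunk_weight y (coef s) u"
    have f1: "ints t ''nxt'' = ints s ''nxt''" "ints t ''head'' = ints s ''head''" "ints t ''seen'' = ints s ''seen''"
      "ints t ''par'' = ints s ''par''" "ints t ''root'' = ints s ''root''" "reals t ''wgt'' = reals s ''wgt''"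
      "reals t ''beta'' = reals s ''beta''" "reals t ''V'' = reals s ''V''" "reals t ''K'' = reals s ''K''"
      "reals t ''v'' = reals s ''v''" "ints t ''y'' = ints s ''y''"
      using fr1 by (simp_all add: frame_def layer_writes shrink_step_def)
    let ?t = "exec (iset ''c'' (ICell ''head'' (iv ''y'')) ;; rset ''T'' (rnat 0)) t"
    have tr1: "trie node_set ?t" by (rule trie_cong[OF s(1)]) (simp_all add: f1)
    have c1: "coef ?t = coef s" by (simp add: coef_def fun_eq_iff f1)
    have l1: "lin_coef ?t = lin_coef s" "sq_coef ?t = sq_coef s"
      by (simp_all add: lin_coef_def sq_coef_def fun_eq_iff f1)
    have ch1: "chain (ints ?t ''nxt'') (ints ?t ''c'' 0) (map code ys)" using ch by (simp add: f1 s(2))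
    have "wp (list_loop score_step) ?t (length ys * 10 + 1)
      (\<lambda>t. reals t ''T'' 0 = sign_score (lin_coef s) (sq_coef s) y (coef s))"
      using wp_score[OF ys tr1 ch1, unfolded c1 l1] W1 s(3) by (simp add: f1)
    then have "wp (list_loop score_step) ?t (length ys * 10 + 1)
      (\<lambda>t. wp (sign_step ;; list_loop update_step ;; iset ''y'' (ISub (iv ''y'') (INat 1))) t (length ys * 10 + 12) ?Q)"
    proof (rule wp_conseq)
      fix t' assume fr2: "frame (list_loop score_step) ?t t'"
        and T: "reals t' ''T'' 0 = sign_score (lin_coef s) (sq_coef s) y (coef s)"
      have f2: "ints t' ''nxt'' = ints s ''nxt''" "ints t' ''head'' = ints s ''head''" "ints t' ''seen'' = ints s ''seen''"
        "ints t' ''par'' = ints s ''par''" "ints t' ''root'' = ints s ''root''" "reals t' ''wgt'' = reals s ''wgt''"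
        "reals t' ''beta'' = reals s ''beta''" "reals t' ''v'' = reals s ''v''" "ints t' ''y'' = ints s ''y''"
        "reals t' ''W'' = reals t ''W''"
        using fr2 f1 by (simp_all add: frame_def layer_writes score_step_def)
      let ?r = "exec sign_step t'"
      define v :: real where "v = (if reals t' ''T'' 0 < 0 then -1 else 1)"
      have v: "v\<^sup>2 = 1" "v \<in> {1, -1}" "0 \<le> v * sign_score (lin_coef s) (sq_coef s) y (coef s)"
        using T by (auto simp: v_def)
      have tr2: "trie node_set ?r" by (rule trie_cong[OF s(1)]) (simp_all add: f2 sign_step_def)
      have c2: "coef ?r = coef s" by (simp add: coef_def fun_eq_iff f2 sign_step_def)
      have ch2: "chain (ints ?r ''nxt'') (ints ?r ''c'' 0) (map code ys)"
        using ch by (simp add: f2 s(2) sign_step_def)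
      have W2: "reals ?r ''W'' u = shrunk_weight y (coef s) u" if "u \<in> {1..3 * n}" for u
        using W1 that by (simp add: sign_step_def f2)
      have v2: "reals ?r ''v'' y = v" "\<And>z. z \<noteq> y \<Longrightarrow> reals ?r ''v'' z = reals s ''v'' z" "ints ?r ''y'' 0 = y"
        by (simp_all add: sign_step_def f2 s(2) v_def)
      have "wp (list_loop update_step) ?r (length ys * 10 + 1) (\<lambda>t. wp (iset ''y'' (ISub (iv ''y'') (INat 1))) t 1 ?Q)"
      proof (rule wp_conseq, rule wp_update[OF ys tr2 ch2 _ v2(1) v(1) v2(3) c2], erule W2, elim conjE)
        fix r assume fr3: "frame (list_loop update_step) ?r r"
          and r: "\<forall>u\<in>{1..3 * n}. reals r ''W'' u = weight_sum y (merge y v (coef s)) u"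
            "\<forall>xs\<in>words. coef r xs = merge y v (coef s) xs"
        have f3: "reals r ''v'' = reals ?r ''v''" "ints r ''y'' = ints ?r ''y''"
          using fr3 by (simp_all add: frame_def layer_writes update_step_def)
        have "?Q (exec (iset ''y'' (ISub (iv ''y'') (INat 1))) r)"
          using r v v2 by (simp add: f3 coef_def)
        then show "wp (iset ''y'' (ISub (iv ''y'') (INat 1))) r 1 ?Q"
          by (rule wp_exec[rotated]) simp_all
      qed
      then have "wp (list_loop update_step ;; iset ''y'' (ISub (iv ''y'') (INat 1))) ?r (length ys * 10 + 4) ?Q"
        by (rule wp_Seq) simp
      then show "wp (sign_step ;; list_loop update_step ;; iset ''y'' (ISub (iv ''y'') (INat 1))) t' (length ys * 10 + 12) ?Q"
        by (rule wp_straight_Seq[rotated]) (simp_all add: sign_step_def)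
    qed
    then have "wp (list_loop score_step ;; sign_step ;; list_loop update_step ;; iset ''y'' (ISub (iv ''y'') (INat 1))) ?t
      (length ys * 20 + 15) ?Q"
      by (rule wp_Seq) simp
    then show "wp ((iset ''c'' (ICell ''head'' (iv ''y'')) ;; rset ''T'' (rnat 0)) ;; list_loop score_step ;;
      sign_step ;; list_loop update_step ;; iset ''y'' (ISub (iv ''y'') (INat 1))) t (length ys * 20 + 20) ?Q"
      by (rule wp_straight_Seq[rotated]) simp_all
  qed
  then have "wp (list_loop shrink_step ;; (iset ''c'' (ICell ''head'' (iv ''y'')) ;; rset ''T'' (rnat 0)) ;; list_loop score_step ;;
      sign_step ;; list_loop update_step ;; iset ''y'' (ISub (iv ''y'') (INat 1))) ?s (length ys * 30 + 25) ?Q"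
    by (rule wp_Seq) simp
  then show ?thesis
    unfolding layer_prog_def by (rule wp_straight_Seq[rotated]) (simp_all add: len)
qed

section \<open>The potential before the first and after the last merge\<close>

definition grad :: "(nat \<Rightarrow> real) \<Rightarrow> nat \<Rightarrow> real" where
  "grad \<sigma> u = (\<Sum>(j, u')\<in>entries nz. if u' = u then amp j * prod_list (map \<sigma> (tl (path j u))) else 0)"

text \<open>The mean of the squared derivative over independent uniform signs, as its monomials are
  distinct and therefore orthogonal.\<close>

definition sq_norm :: "nat \<Rightarrow> real" where
  "sq_norm u = (\<Sum>(j, u')\<in>entries nz. if u' = u then (amp j)\<^sup>2 else 0)"

text \<open>The head recovers \<open>u\<close>, and the tail together with \<open>u\<close> recovers
  the variables of the term; different terms thus give different monomials in every
  derivative.\<close>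

lemma inj_path: "inj_on (\<lambda>(j, u). path j u) (entries nz)"
proof (rule inj_onI, clarify)
  fix i u j w assume *: "(i, u) \<in> entries nz" "(j, w) \<in> entries nz" "path i u = path j w"
  then have uw: "u = w" and f: "filter (\<lambda>z. z \<noteq> u) (X i) = filter (\<lambda>z. z \<noteq> u) (X j)" by (auto simp: path_def)
  have ij: "i < nz" "j < nz" "u \<in> set (X i)" "u \<in> set (X j)" using * uw by (auto simp: entries_def)
  have "set (X i) - {u} = set (X j) - {u}"
    using arg_cong[OF f, of set] by (simp add: set_diff_eq)
  then have "set (X i) = set (X j)" using ij by auto
  then have "X i = X j"
    using strict_sorted_equal[OF sorted_X[OF ij(1)] sorted_X[OF ij(2)]] by simp
  then have "i = j" using inj_onD[OF inj_X] ij by auto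
  then show "i = j \<and> u = w" using uw by simp
qed

lemma path_active:
  assumes "(j, u) \<in> entries nz"
  shows "path j u \<in> active (Suc (3 * n)) u"
proof (cases "tl (path j u) = []")
  case True
  then show ?thesis by (simp add: active_def path_def)
next
  case False
  have ju: "j < nz" "u \<in> set (X j)" using assms by (auto simp: entries_def)
  have len: "2 \<le> length (path j u)" using False by (cases "tl (path j u)") (auto simp: path_def)
  then have "path j u \<in> prefixes2 (path j u)"
    unfolding prefixes2_def by (intro image_eqI[of _ _ "length (path j u)"]) auto
  then have "path j u \<in> node_set" using assms by (auto simp: nodes_def)
  moreover have "path j u \<noteq> []" "set (path j u) \<subseteq> {1..3 * n}" using path_words[OF ju] by (auto simp: words_def)
  then have "last (path j u) \<le> 3 * n" using last_in_set by fastforce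
  ultimately show ?thesis by (simp add: active_def path_def)
qed

text \<open>Passes from trie nodes to terms. A node that is only an inner point of paths has
  coefficient 0, and \<open>h\<close> sends it to 0.\<close>

lemma sum_initial:
  assumes b: "\<And>xs. xs \<in> words \<Longrightarrow> \<beta> xs = (\<Sum>(j, u)\<in>entries nz. if path j u = xs then amp j else 0)"
    and u: "u \<in> {1..3 * n}" and h: "\<And>xs. h xs 0 = (0::real)"
  shows "(\<Sum>xs\<in>active (Suc (3 * n)) u. h xs (\<beta> xs))
    = (\<Sum>(j, u')\<in>entries nz. if u' = u then h (path j u) (amp j) else 0)"
proof -
  let ?E = "{e \<in> entries nz. snd e = u}"
  have w: "active (Suc (3 * n)) u \<subseteq> words" using node_set_words u by (auto simp: active_def words_def)
  have val: "\<beta> (path j u') = amp j" if "(j, u') \<in> entries nz" for j u'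
  proof -
    have "path j u' \<in> words" using that by (auto simp: entries_def intro: path_words)
    then have "\<beta> (path j u') = (\<Sum>e\<in>entries nz. if e = (j, u') then amp (fst e) else 0)"
      unfolding b[OF \<open>path j u' \<in> words\<close>] using inj_onD[OF inj_path] that
      by (intro sum.cong) (auto split: if_splits)
    then show ?thesis using that by simp
  qed
  have "(\<Sum>xs\<in>active (Suc (3 * n)) u. h xs (\<beta> xs)) = (\<Sum>xs\<in>(\<lambda>(j, u). path j u) ` ?E. h xs (\<beta> xs))"
  proof (rule sum.mono_neutral_right)
    show "(\<lambda>(j, u). path j u) ` ?E \<subseteq> active (Suc (3 * n)) u" using path_active by auto
    show "\<forall>xs\<in>active (Suc (3 * n)) u - (\<lambda>(j, u). path j u) ` ?E. h xs (\<beta> xs) = 0"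
    proof
      fix xs assume xs: "xs \<in> active (Suc (3 * n)) u - (\<lambda>(j, u). path j u) ` ?E"
      have "hd xs = u" using xs by (auto simp: active_def)
      have "\<beta> xs = 0"
        unfolding b[OF subsetD[OF w DiffD1[OF xs]]]
      proof (rule sum.neutral, clarify)
        fix j u' assume e: "(j, u') \<in> entries nz"
        have "path j u' \<noteq> xs"
        proof
          assume "path j u' = xs"
          then have "u' = u" using \<open>hd xs = u\<close> by (auto simp: path_def)
          then have "xs \<in> (\<lambda>(j, u). path j u) ` ?E" using \<open>path j u' = xs\<close> e by force
          then show False using xs by blast
        qed
        then show "(if path j u' = xs then amp j else 0) = 0" by simp
      qed
      then show "h xs (\<beta> xs) = 0" by (simp add: h)
    qed
  qed simp
  also have "\<dots> = (\<Sum>e\<in>?E. h ((\<lambda>(j, u). path j u) e) (\<beta> ((\<lambda>(j, u). path j u) e)))"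
    by (subst sum.reindex) (auto intro: inj_on_subset[OF inj_path])
  also have "\<dots> = (\<Sum>e\<in>?E. h (path (fst e) u) (amp (fst e)))"
    using val by (intro sum.cong) auto
  also have "\<dots> = (\<Sum>(j, u')\<in>entries nz. if u' = u then h (path j u) (amp j) else 0)"
    by (simp add: sum.inter_filter case_prod_beta)
  finally show ?thesis .
qed

lemma sq_norm_nonneg: "0 \<le> sq_norm u"
  unfolding sq_norm_def by (rule sum_nonneg) auto

text \<open>A derivative has degree at most k - 1, so its weighted sum is at most 3^(k-1) times its
  square norm V. Measured in units of sqrt V / 3^(k-1), the two summands are 3/2 and at most
  1/2.\<close>

lemma potential_initial:
  assumes b: "built (entries nz) s"
  shows "(\<Sum>u\<in>{1..3 * n}. sqrt (sq_norm u) / 3 ^ (k - 1))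
    \<le> potential (lin_coef s) (sq_coef s) (Suc (3 * n)) (coef s)"
  unfolding potential_def
proof (rule sum_mono)
  fix u assume u: "u \<in> {1..3 * n}"
  let ?K = "3 ^ (k - 1) :: real"
  have co: "coef s xs = (\<Sum>(j, u)\<in>entries nz. if path j u = xs then amp j else 0)" if "xs \<in> words" for xs
    using b that by (simp add: built_def coef_def)
  have V: "reals s ''V'' u = sq_norm u" using b by (simp add: built_def sq_norm_def)
  have sq: "square_sum (Suc (3 * n)) (coef s) u = sq_norm u"
    unfolding square_sum_def sq_norm_def using sum_initial[OF co u, of "\<lambda>xs b. b\<^sup>2"] by simp
  have "weight_sum (Suc (3 * n)) (coef s) u
      = (\<Sum>(j, u')\<in>entries nz. if u' = u then 3 ^ (length (path j u) - 1) * (amp j)\<^sup>2 else 0)"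
    unfolding weight_sum_def using sum_initial[OF co u, of "\<lambda>xs b. 3 ^ (length xs - 1) * b\<^sup>2"] by simp
  also have "\<dots> \<le> (\<Sum>(j, u')\<in>entries nz. ?K * (if u' = u then (amp j)\<^sup>2 else 0))"
  proof (rule sum_mono, clarify)
    fix j u' assume "(j, u') \<in> entries nz"
    then have "u' = u \<Longrightarrow> length (path j u) \<le> k"
      using length_path[of j u] length_X[of j] by (auto simp: entries_def)
    then show "(if u' = u then 3 ^ (length (path j u) - 1) * (amp j)\<^sup>2 else 0) \<le> ?K * (if u' = u then (amp j)\<^sup>2 else 0)"
      by (auto intro!: mult_right_mono power_increasing)
  qed
  also have "\<dots> = ?K * sq_norm u"
    unfolding sq_norm_def sum_distrib_left by (simp add: case_prod_beta)
  finally have W: "weight_sum (Suc (3 * n)) (coef s) u \<le> ?K * sq_norm u" .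
  have W0: "0 \<le> weight_sum (Suc (3 * n)) (coef s) u" unfolding weight_sum_def by (rule sum_nonneg) simp
  define r where "r = sqrt (sq_norm u)"
  have r: "r \<ge> 0" "sq_norm u = r\<^sup>2" using sq_norm_nonneg[of u] by (simp_all add: r_def)
  have rp: "\<bar>reals s ''V'' u\<bar> powr (1 / 2) = r"
    using sq_norm_nonneg[of u] by (simp add: V r_def powr_half_sqrt)
  show "r / ?K \<le> lin_coef s u * square_sum (Suc (3 * n)) (coef s) u
     - sq_coef s u * (weight_sum (Suc (3 * n)) (coef s) u)\<^sup>2"
  proof (cases "r = 0")
    case True
    then show ?thesis using r by (simp add: sq lin_coef_def sq_coef_def rp)
  next
    case False
    have "sq_coef s u * (weight_sum (Suc (3 * n)) (coef s) u)\<^sup>2 \<le> sq_coef s u * (?K * sq_norm u)\<^sup>2"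
      using W W0 r(1) by (intro mult_left_mono power_mono) (simp_all add: sq_coef_def rp)
    also have "\<dots> = r / (2 * ?K)"
      unfolding sq_coef_def rp r(2) using False by (simp add: power2_eq_square power3_eq_cube field_simps)
    finally have "sq_coef s u * (weight_sum (Suc (3 * n)) (coef s) u)\<^sup>2 \<le> r / (2 * ?K)" .
    moreover have "lin_coef s u * square_sum (Suc (3 * n)) (coef s) u = 3 * r / (2 * ?K)"
      unfolding sq lin_coef_def rp r(2) using False by (simp add: power2_eq_square field_simps)
    moreover have "3 * r / (2 * ?K) - r / (2 * ?K) = r / ?K" by (simp add: field_simps)
    ultimately show ?thesis by linarith
  qed
qed

text \<open>Scaled to h = |g| / r this is h * (h - 1)^2 * (h + 2) >= 0. Both sides agree at |g| = r,
  the size for which the coefficients are tuned; for \<open>r = 0\<close> the left side is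
  0.\<close>

lemma abs_ge_quartic:
  fixes a g r :: real
  assumes "r \<ge> 0"
  shows "3 / (2 * r) * g\<^sup>2 - 1 / (2 * r ^ 3) * (g\<^sup>2)\<^sup>2 \<le> \<bar>g\<bar>"
proof (cases "r = 0")
  case False
  define h where "h = \<bar>g\<bar> / r"
  have h: "h \<ge> 0" "\<bar>g\<bar> = h * r" using assms False by (simp_all add: h_def)
  have g2: "g\<^sup>2 = h\<^sup>2 * r\<^sup>2" using h(2) by (metis power2_abs power_mult_distrib)
  have "3 * h\<^sup>2 - h ^ 4 \<le> 2 * h"
  proof -
    have "0 \<le> h * ((h - 1)\<^sup>2 * (h + 2))" using h by simp
    then show ?thesis by (simp add: power2_eq_square power4_eq_xxxx algebra_simps)
  qed
  then have "(3 * h\<^sup>2 - h ^ 4) / 2 * r \<le> h * r" using assms by (intro mult_right_mono) auto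
  moreover have "3 / (2 * r) * g\<^sup>2 - 1 / (2 * r ^ 3) * (g\<^sup>2)\<^sup>2 = (3 * h\<^sup>2 - h ^ 4) / 2 * r"
    unfolding g2 using False by (simp add: power2_eq_square power3_eq_cube power4_eq_xxxx field_simps)
  ultimately show ?thesis by (simp add: h(2))
qed simp

definition merge_time :: nat where
  "merge_time = (\<Sum>i<3 * n. card (layer (3 * n - i)) * 30 + 31) + 20"

lemma active_one: "active 1 u = {[u]}"
proof -
  have "last xs \<ge> 1" if "xs \<in> node_set" for xs
  proof -
    have "xs \<noteq> []" "set xs \<subseteq> {1..3 * n}" using that node_set_words by (auto simp: words_def)
    then show ?thesis using last_in_set by fastforce
  qed
  then show ?thesis by (force simp: active_def)
qed

lemma wp_merge:
  assumes s: "input s" "built (entries nz) s"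
  shows "wp merge_prog s merge_time (\<lambda>t. (\<forall>z\<in>{1..3 * n}. reals t ''v'' z \<in> {1, -1}) \<and>
    (\<forall>u\<in>{1..3 * n}. reals t ''beta'' u = grad (reals t ''v'') u) \<and>
    (\<Sum>u\<in>{1..3 * n}. sqrt (sq_norm u) / 3 ^ (k - 1)) \<le> (\<Sum>u\<in>{1..3 * n}. \<bar>grad (reals t ''v'') u\<bar>))"
proof -
  let ?init = "rset ''K'' (RPow (rnat 3) (RNat (ISub (iv ''k'') (INat 1)))) ;;
     iset ''y'' (IAdd (iv ''n'') (IAdd (iv ''n'') (iv ''n'')))"
  let ?s = "exec ?init s"
  let ?a = "lin_coef s" and ?b = "sq_coef s"
  let ?y = "\<lambda>i. 3 * n - i"
  \<comment> \<open>The last clause speaks of every extension \<sigma> of the signs fixed so far,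
    because the signs of the smaller variables are still open.\<close>
  define I where "I = (\<lambda>i (t :: store). ints t ''y'' 0 = ?y i \<and>
    (\<forall>u\<in>{1..3 * n}. reals t ''W'' u = weight_sum (Suc (?y i)) (coef t) u) \<and>
    potential ?a ?b (Suc (3 * n)) (coef s) \<le> potential ?a ?b (Suc (?y i)) (coef t) \<and>
    (\<forall>z. ?y i < z \<and> z \<le> 3 * n \<longrightarrow> reals t ''v'' z \<in> {1, -1}) \<and>
    (\<forall>\<sigma>. (\<forall>z. ?y i < z \<and> z \<le> 3 * n \<longrightarrow> \<sigma> z = reals t ''v'' z) \<longrightarrow> (\<forall>u\<in>{1..3 * n}.
       (\<Sum>xs\<in>active (Suc (?y i)) u. coef t xs * prod_list (map \<sigma> (tl xs))) = grad \<sigma> u)))"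
  have tr: "trie node_set s" using s(2) by (simp add: built_def)
  then have tr': "trie node_set ?s" by (rule trie_cong) simp_all
  have co: "coef s xs = (\<Sum>(j, u)\<in>entries nz. if path j u = xs then amp j else 0)" if "xs \<in> words" for xs
    using s(2) that by (simp add: built_def coef_def)
  have "wp merge_prog s merge_time (I (3 * n))"
    unfolding merge_prog_def merge_time_def
  proof (rule wp_straight_Seq)
    show "wp (Loop (ILess (INat 0) (iv ''y'')) layer_prog) ?s
      ((\<Sum>i<3 * n. card (layer (3 * n - i)) * 30 + 31) + 1) (I (3 * n))"
    proof (rule wp_Loop[where b = "\<lambda>i. card (layer (3 * n - i)) * 30 + 30"])
      have c: "coef ?s = coef s" by (simp add: coef_def fun_eq_iff)
      have W: "reals s ''W'' u = weight_sum (Suc (3 * n)) (coef s) u" if "u \<in> {1..3 * n}" for u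
      proof -
        have "reals s ''W'' u = (\<Sum>(j, u')\<in>entries nz. if u' = u then 3 ^ (length (X j) - 1) * (amp j)\<^sup>2 else 0)"
          using s(2) by (simp add: built_def)
        also have "\<dots> = (\<Sum>(j, u')\<in>entries nz. if u' = u then 3 ^ (length (path j u) - 1) * (amp j)\<^sup>2 else 0)"
          using length_path by (intro sum.cong) (auto simp: entries_def)
        finally show ?thesis
          unfolding weight_sum_def using sum_initial[OF co that, of "\<lambda>xs b. 3 ^ (length xs - 1) * b\<^sup>2"] by simp
      qed
      have G: "(\<Sum>xs\<in>active (Suc (3 * n)) u. coef s xs * prod_list (map \<sigma> (tl xs))) = grad \<sigma> u"
        if "u \<in> {1..3 * n}" for u \<sigma>
        unfolding grad_def using sum_initial[OF co that, of "\<lambda>xs b. b * prod_list (map \<sigma> (tl xs))"] by simp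
      have "ints ?s ''y'' 0 = 3 * n" using s(1) by (simp add: input_def)
      moreover have "reals ?s ''W'' = reals s ''W''" by (simp add: fun_eq_iff)
      ultimately show "I 0 ?s" unfolding I_def c using W G by simp
    next
      fix i t assume i: "i < 3 * n" and I: "I i t" and fr: "frame layer_prog ?s t"
      let ?z = "?y i"
      have z: "1 \<le> ?z" "?z \<le> 3 * n" "?y (Suc i) = ?z - 1" "Suc (?z - 1) = ?z" using i by auto
      have fr': "ints t ''seen'' = ints ?s ''seen''" "ints t ''par'' = ints ?s ''par''" "ints t ''root'' = ints ?s ''root''"
        "reals t ''wgt'' = reals ?s ''wgt''" "ints t ''nxt'' = ints ?s ''nxt''" "ints t ''head'' = ints ?s ''head''"
        "reals t ''V'' = reals ?s ''V''" "reals t ''K'' = reals ?s ''K''"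
        using fr by (simp_all add: frame_def layer_writes)
      have trt: "trie node_set t" by (rule trie_cong[OF tr' fr'(1-6)])
      have ab: "lin_coef t = ?a" "sq_coef t = ?b"
        by (simp_all add: lin_coef_def sq_coef_def fun_eq_iff fr'(7))
      have K: "reals t ''K'' 0 = 3 ^ (k - 1)" using s(1) by (simp add: fr' input_def powr_realpow)
      have It: "ints t ''y'' 0 = ?z" "\<And>u. u \<in> {1..3 * n} \<Longrightarrow> reals t ''W'' u = weight_sum (Suc ?z) (coef t) u"
        "\<And>\<sigma> u. (\<forall>z. ?z < z \<and> z \<le> 3 * n \<longrightarrow> \<sigma> z = reals t ''v'' z) \<Longrightarrow> u \<in> {1..3 * n} \<Longrightarrow>
          (\<Sum>xs\<in>active (Suc ?z) u. coef t xs * prod_list (map \<sigma> (tl xs))) = grad \<sigma> u"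
        using I by (simp_all add: I_def)
      have "wp layer_prog t (card (layer ?z) * 30 + 30) (I (Suc i))"
      proof (rule wp_conseq, rule wp_layer[OF trt It(1) K], erule It(2), elim conjE)
        fix t' assume y': "ints t' ''y'' 0 = ?z - 1"
          and v': "\<forall>w. w \<noteq> ?z \<longrightarrow> reals t' ''v'' w = reals t ''v'' w" "reals t' ''v'' ?z \<in> {1, -1}"
            "0 \<le> reals t' ''v'' ?z * sign_score (lin_coef t) (sq_coef t) ?z (coef t)"
          and W': "\<forall>u\<in>{1..3 * n}. reals t' ''W'' u = weight_sum ?z (merge ?z (reals t' ''v'' ?z) (coef t)) u"
          and c': "\<forall>xs\<in>words. coef t' xs = merge ?z (reals t' ''v'' ?z) (coef t) xs"
        let ?v = "reals t' ''v'' ?z"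
        have v2: "?v\<^sup>2 = 1" using v'(2) by auto
        have "potential ?a ?b (Suc (3 * n)) (coef s) \<le> potential ?a ?b (Suc ?z) (coef t)"
          using I by (simp add: I_def)
        also have "\<dots> \<le> potential ?a ?b ?z (merge ?z ?v (coef t))"
          by (rule potential_merge[OF v2]) (use v'(3) ab in \<open>simp_all add: sq_coef_def\<close>)
        also have "\<dots> = potential ?a ?b ?z (coef t')" using c' by (intro potential_cong) simp
        finally have P: "potential ?a ?b (Suc (3 * n)) (coef s) \<le> potential ?a ?b ?z (coef t')" .
        have W: "reals t' ''W'' u = weight_sum ?z (coef t') u" if "u \<in> {1..3 * n}" for u
          using W' coef_cong(2)[of "coef t'" "merge ?z ?v (coef t)" u] c' that by simp
        have V: "reals t' ''v'' w \<in> {1, -1}" if "?z - 1 < w" "w \<le> 3 * n" for w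
        proof (cases "w = ?z")
          case False
          then have "?z < w" using that by linarith
          then show ?thesis using I v'(1) that False unfolding I_def by auto
        qed (use v'(2) in simp)
        have G: "(\<Sum>xs\<in>active ?z u. coef t' xs * prod_list (map \<sigma> (tl xs))) = grad \<sigma> u"
          if \<sigma>: "\<forall>w. ?z - 1 < w \<and> w \<le> 3 * n \<longrightarrow> \<sigma> w = reals t' ''v'' w" and u: "u \<in> {1..3 * n}" for \<sigma> u
        proof -
          have sz: "\<sigma> ?z = ?v" using \<sigma> z(1,2) by simp
          have "\<sigma> w = reals t ''v'' w" if "?z < w" "w \<le> 3 * n" for w
          proof -
            have "?z - 1 < w" "w \<noteq> ?z" using that(1) by linarith+
            then show ?thesis using \<sigma> v'(1) that(2) by metis
          qed
          then have "(\<Sum>xs\<in>active (Suc ?z) u. coef t xs * prod_list (map \<sigma> (tl xs))) = grad \<sigma> u"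
            by (intro It(3) u) simp
          moreover have "(\<Sum>xs\<in>active ?z u. coef t' xs * prod_list (map \<sigma> (tl xs))) =
            (\<Sum>xs\<in>active ?z u. merge ?z ?v (coef t) xs * prod_list (map \<sigma> (tl xs)))"
            by (rule coef_cong(3)) (use c' u in auto)
          ultimately show ?thesis using gradient_merge[of ?z \<sigma> "coef t" u] by (simp add: sz)
        qed
        show "I (Suc i) t'" unfolding I_def z(3) z(4) by (intro conjI allI impI ballI y' P W V G) simp_all
      qed
      then show "tval t (ILess (INat 0) (iv ''y'')) \<and> wp layer_prog t (card (layer ?z) * 30 + 30) (I (Suc i))"
        using It(1) z(1) by simp
    next
      fix t assume "I (3 * n) t"
      then show "\<not> tval t (ILess (INat 0) (iv ''y''))" by (simp add: I_def)
    qed (simp add: add.commute)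
  qed simp_all
  then show ?thesis
  proof (rule wp_conseq)
    fix t assume I: "I (3 * n) t"
    let ?v = "reals t ''v''"
    have V: "\<forall>z\<in>{1..3 * n}. ?v z \<in> {1, -1}" using I by (simp add: I_def)
    \<comment> \<open>No variable is left, so each derivative has shrunk to its root and the
      potential to a sum of quartics in the final values.\<close>
    have "(\<Sum>xs\<in>active 1 u. coef t xs * prod_list (map ?v (tl xs))) = grad ?v u" if "u \<in> {1..3 * n}" for u
      using I that unfolding I_def by simp
    then have c: "coef t [u] = grad ?v u" if "u \<in> {1..3 * n}" for u
      using that by (simp add: active_one del: One_nat_def)
    have "(\<Sum>u\<in>{1..3 * n}. sqrt (sq_norm u) / 3 ^ (k - 1)) \<le> potential ?a ?b 1 (coef t)"
      using potential_initial[OF s(2)] I by (simp add: I_def)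
    also have "\<dots> \<le> (\<Sum>u\<in>{1..3 * n}. \<bar>grad ?v u\<bar>)"
      unfolding potential_def
    proof (rule sum_mono)
      fix u assume u: "u \<in> {1..3 * n}"
      let ?r = "3 ^ (k - 1) * \<bar>reals s ''V'' u\<bar> powr (1 / 2)"
      have "?a u * square_sum 1 (coef t) u - ?b u * (weight_sum 1 (coef t) u)\<^sup>2
        = 3 / (2 * ?r) * (grad ?v u)\<^sup>2 - 1 / (2 * ?r ^ 3) * ((grad ?v u)\<^sup>2)\<^sup>2"
        using c[OF u] unfolding square_sum_def weight_sum_def active_one lin_coef_def sq_coef_def by simp
      also have "\<dots> \<le> \<bar>grad ?v u\<bar>" by (rule abs_ge_quartic) simp
      finally show "?a u * square_sum 1 (coef t) u - ?b u * (weight_sum 1 (coef t) u)\<^sup>2 \<le> \<bar>grad ?v u\<bar>" .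
    qed
    finally have "(\<Sum>u\<in>{1..3 * n}. sqrt (sq_norm u) / 3 ^ (k - 1)) \<le> (\<Sum>u\<in>{1..3 * n}. \<bar>grad ?v u\<bar>)" .
    moreover have "\<forall>u\<in>{1..3 * n}. reals t ''beta'' u = grad ?v u"
      using c by (simp add: coef_def)
    ultimately show "(\<forall>z\<in>{1..3 * n}. ?v z \<in> {1, -1}) \<and> (\<forall>u\<in>{1..3 * n}. reals t ''beta'' u = grad ?v u) \<and>
      (\<Sum>u\<in>{1..3 * n}. sqrt (sq_norm u) / 3 ^ (k - 1)) \<le> (\<Sum>u\<in>{1..3 * n}. \<bar>grad ?v u\<bar>)"
      using V by blast
  qed
qed

end

subsection \<open>Scanning a line\<close>

definition gradient_sign :: com where
  "gradient_sign = Cond (RLess (RCell ''beta'' (iv ''y'')) (rnat 0))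
      (RStore ''sg'' (iv ''y'') (RSub (rnat 0) (rnat 1))) (RStore ''sg'' (iv ''y'') (rnat 1)) ;; incr ''y''"

text \<open>\<open>B\<close> still holds 3 * n + 1 from the table, so the loop from 1 runs through
  the variables; a vanishing derivative gets the sign 1.\<close>

definition sign_prog :: com where
  "sign_prog = iset ''y'' (INat 1) ;; Loop (ILess (iv ''y'') (iv ''B'')) gradient_sign"

definition factor_step :: com where
  "factor_step = rset ''pr'' (RMul (rv ''pr'') (RAdd (RCell ''v'' (letter (iv ''o'')))
      (RMul (rv ''t'') (RCell ''sg'' (letter (iv ''o'')))))) ;; incr ''o''"

definition monomial_init :: com where
  "monomial_init = rset ''pr'' (RCell ''ca'' (iv ''j'')) ;;
    Cond (ILess (INat 0) (ICell ''weight'' (iv ''j''))) Skip (rset ''pr'' (rnat 0)) ;;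
    iset ''e'' (IAdd (iv ''o'') (ICell ''weight'' (iv ''j'')))"

definition monomial_prog :: com where
  "monomial_prog = monomial_init ;; Loop (ILess (iv ''o'') (iv ''e'')) factor_step ;;
    (rset ''val'' (RAdd (rv ''val'') (rv ''pr'')) ;; incr ''j'')"

definition eval_init :: com where
  "eval_init = rset ''t'' (RDiv (RSub (RNat (iv ''q'')) (RNat (iv ''k''))) (RNat (iv ''k''))) ;;
    rset ''val'' (rnat 0) ;; iset ''o'' (INat 0) ;; iset ''j'' (INat 0)"

text \<open>\<open>RPow\<close> takes the absolute value of its base, so the exponent 1 computes
  |val|.\<close>

definition compare_step :: com where
  "compare_step = Cond (RLess (rv ''best'') (RPow (rv ''val'') (rnat 1)))
      (rset ''best'' (RPow (rv ''val'') (rnat 1)) ;; rset ''tb'' (rv ''t'')) Skip ;; incr ''q''"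

definition eval_prog :: com where
  "eval_prog = eval_init ;; Loop (ILess (iv ''j'') (iv ''nnz'')) monomial_prog ;; compare_step"

definition scan_prog :: com where
  "scan_prog = (rset ''best'' (rnat 0) ;; rset ''tb'' (rnat 0) ;; iset ''q'' (INat 0)) ;;
    Loop (ILess (iv ''q'') (IAdd (iv ''k'') (IAdd (iv ''k'') (INat 1)))) eval_prog"

lemma scan_writes:
  "int_writes gradient_sign = {''y''}" "real_writes gradient_sign = {''sg''}"
  "int_writes factor_step = {''o''}" "real_writes factor_step = {''pr''}"
  "int_writes monomial_prog = {''o'', ''e'', ''j''}" "real_writes monomial_prog = {''pr'', ''val''}"
  "int_writes eval_prog = {''o'', ''e'', ''j'', ''q''}" "real_writes eval_prog = {''pr'', ''val'', ''t'', ''best'', ''tb''}"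
  by (simp_all add: gradient_sign_def factor_step_def monomial_prog_def monomial_init_def eval_prog_def
      eval_init_def compare_step_def insert_commute)

context hamiltonian_data
begin

lemma wp_sign:
  assumes "ints s ''B'' 0 = base"
  shows "wp sign_prog s (n * 30 + 10) (\<lambda>t. \<forall>u\<in>{1..3 * n}. reals t ''sg'' u \<in> {1, -1} \<and>
    reals t ''sg'' u * reals s ''beta'' u = \<bar>reals s ''beta'' u\<bar>)"
proof -
  define sg :: "nat \<Rightarrow> real" where "sg = (\<lambda>u. if reals s ''beta'' u < 0 then -1 else 1)"
  define I where "I = (\<lambda>i (t :: store). ints t ''y'' 0 = Suc i \<and> (\<forall>u. 1 \<le> u \<and> u \<le> i \<longrightarrow> reals t ''sg'' u = sg u))"
  let ?s = "exec (iset ''y'' (INat 1)) s"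
  have "wp sign_prog s (n * 30 + 10) (I (3 * n))"
    unfolding sign_prog_def
  proof (rule wp_straight_Seq)
    show "wp (Loop (ILess (iv ''y'') (iv ''B'')) gradient_sign) ?s (n * 30 + 1) (I (3 * n))"
    proof (rule wp_Loop[where b = "\<lambda>_. 7"])
      show "I 0 ?s" by (simp add: I_def)
    next
      fix i t assume i: "i < 3 * n" and I: "I i t" and fr: "frame gradient_sign ?s t"
      have fr': "ints t ''B'' 0 = base" "reals t ''beta'' = reals s ''beta''"
        using fr assms by (simp_all add: frame_def scan_writes)
      have y: "ints t ''y'' 0 = Suc i" using I by (simp add: I_def)
      have "reals (exec gradient_sign t) ''sg'' u = sg u" if "1 \<le> u" "u \<le> Suc i" for u
        using that I by (cases "u = Suc i") (simp_all add: I_def gradient_sign_def fr' sg_def)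
      then have "I (Suc i) (exec gradient_sign t)" using y by (simp add: I_def gradient_sign_def)
      then have "wp gradient_sign t 7 (I (Suc i))"
        by (rule wp_exec[rotated]) (simp_all add: gradient_sign_def)
      then show "tval t (ILess (iv ''y'') (iv ''B'')) \<and> wp gradient_sign t 7 (I (Suc i))"
        using y i fr' by (simp add: base_def)
    next
      fix t assume "I (3 * n) t" "frame gradient_sign ?s t"
      then show "\<not> tval t (ILess (iv ''y'') (iv ''B''))"
        using assms by (simp add: I_def frame_def scan_writes base_def)
    qed simp
  qed simp_all
  then show ?thesis by (rule wp_conseq) (simp add: I_def sg_def)
qed

text \<open>The identity observable is skipped: it contributes exactly the Haar expectation, and the
  rest is the signed gain at \<open>t\<close>.\<close>

definition ray_poly :: "(nat \<Rightarrow> real) \<Rightarrow> (nat \<Rightarrow> real) \<Rightarrow> real \<Rightarrow> real" where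
  "ray_poly v w t = (\<Sum>j<nz. if X j = [] then 0 else amp j * prod_list (map (\<lambda>z. v z + t * w z) (X j)))"

lemma wp_monomial:
  assumes j: "j < nz" and s: "input s" "ints s ''j'' 0 = j" "ints s ''o'' 0 = offset j" "reals s ''ca'' j = amp j"
    "reals s ''v'' = v" "reals s ''sg'' = w" "reals s ''t'' 0 = t"
  shows "wp monomial_prog s (length (X j) * 4 + 20) (\<lambda>r. ints r ''j'' 0 = Suc j \<and> ints r ''o'' 0 = offset (Suc j) \<and>
    reals r ''val'' 0 = reals s ''val'' 0 +
      (if X j = [] then 0 else amp j * prod_list (map (\<lambda>z. v z + t * w z) (X j))))" (is "wp _ _ _ ?Q")
  unfolding monomial_prog_def
proof (rule wp_straight_Seq)
  let ?s = "exec monomial_init s"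
  let ?p = "if X j = [] then 0 else amp j"
  define I where "I = (\<lambda>l (r :: store). ints r ''o'' 0 = offset j + l \<and>
    reals r ''pr'' 0 = ?p * prod_list (map (\<lambda>z. v z + t * w z) (take l (X j))))"
  have wt: "ints s ''weight'' j = length (X j)" using s(1) j by (simp add: input_def)
  have init: "ints ?s ''e'' 0 = offset j + length (X j)" "ints ?s ''o'' 0 = offset j" "reals ?s ''pr'' 0 = ?p"
    "reals ?s ''v'' = v" "reals ?s ''sg'' = w" "reals ?s ''t'' 0 = t" "ints ?s ''j'' 0 = j"
    "reals ?s ''val'' = reals s ''val''" "ints ?s ''site'' = ints s ''site''" "ints ?s ''pauli'' = ints s ''pauli''"
    using s wt by (simp_all add: monomial_init_def)
  have "wp (Loop (ILess (iv ''o'') (iv ''e'')) factor_step) ?s (length (X j) * 4 + 1) (I (length (X j)))"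
  proof (rule wp_Loop[where b = "\<lambda>_. 3"])
    show "I 0 ?s" using init by (simp add: I_def)
  next
    fix l r assume l: "l < length (X j)" and I: "I l r" and fr: "frame factor_step ?s r"
    have fr': "reals r ''v'' = v" "reals r ''sg'' = w" "reals r ''t'' 0 = t" "ints r ''e'' 0 = offset j + length (X j)"
      "ints r ''site'' = ints s ''site''" "ints r ''pauli'' = ints s ''pauli''"
      using fr init by (simp_all add: frame_def scan_writes)
    have o: "ints r ''o'' 0 = offset j + l" using I by (simp add: I_def)
    have x: "ints s ''site'' (offset j + l) + (ints s ''site'' (offset j + l) +
        (ints s ''site'' (offset j + l) + ints s ''pauli'' (offset j + l))) = X j ! l"
    proof -
      have "3 * ints s ''site'' (offset j + l) + ints s ''pauli'' (offset j + l) = X j ! l"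
        using s(1) j l unfolding input_def by blast
      then show ?thesis by linarith
    qed
    have "reals (exec factor_step r) ''pr'' 0 = reals r ''pr'' 0 * (v (X j ! l) + t * w (X j ! l))"
      by (simp add: factor_step_def o x fr')
    also have "\<dots> = ?p * prod_list (map (\<lambda>z. v z + t * w z) (take (Suc l) (X j)))"
      using I l by (simp add: I_def take_Suc_conv_app_nth)
    finally have "I (Suc l) (exec factor_step r)" using o by (simp add: I_def factor_step_def)
    then have "wp factor_step r 3 (I (Suc l))"
      by (rule wp_exec[rotated]) (simp_all add: factor_step_def)
    then show "tval r (ILess (iv ''o'') (iv ''e'')) \<and> wp factor_step r 3 (I (Suc l))"
      using o l fr' by simp
  next
    fix r assume "I (length (X j)) r" "frame factor_step ?s r"
    then show "\<not> tval r (ILess (iv ''o'') (iv ''e''))" using init by (simp add: I_def frame_def scan_writes)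
  qed simp
  then have "wp (Loop (ILess (iv ''o'') (iv ''e'')) factor_step) ?s (length (X j) * 4 + 1)
    (\<lambda>r. wp (rset ''val'' (RAdd (rv ''val'') (rv ''pr'')) ;; incr ''j'') r 3 ?Q)"
  proof (rule wp_conseq)
    fix r assume fr: "frame (Loop (ILess (iv ''o'') (iv ''e'')) factor_step) ?s r" and I: "I (length (X j)) r"
    have "reals r ''val'' = reals s ''val''" "ints r ''j'' 0 = j"
      using fr init by (simp_all add: frame_def scan_writes)
    then have "?Q (exec (rset ''val'' (RAdd (rv ''val'') (rv ''pr'')) ;; incr ''j'') r)"
      using I by (simp add: I_def offset_def)
    then show "wp (rset ''val'' (RAdd (rv ''val'') (rv ''pr'')) ;; incr ''j'') r 3 ?Q"
      by (rule wp_exec[rotated]) simp_all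
  qed
  then show "wp (Loop (ILess (iv ''o'') (iv ''e'')) factor_step ;; rset ''val'' (RAdd (rv ''val'') (rv ''pr'')) ;; incr ''j'')
     ?s (length (X j) * 4 + 5) ?Q"
    by (rule wp_Seq) simp
qed (simp_all add: monomial_init_def)

definition eval_time :: nat where
  "eval_time = (\<Sum>j<nz. length (X j) * 4 + 21) + 20"

lemma wp_eval:
  assumes s: "input s" "ints s ''q'' 0 = q" "\<And>j. j < nz \<Longrightarrow> reals s ''ca'' j = amp j"
    "reals s ''v'' = v" "reals s ''sg'' = w" and t: "t = (real q - real k) / real k"
  shows "wp eval_prog s eval_time (\<lambda>r. ints r ''q'' 0 = Suc q \<and>
    (if reals s ''best'' 0 < \<bar>ray_poly v w t\<bar> then reals r ''best'' 0 = \<bar>ray_poly v w t\<bar> \<and> reals r ''tb'' 0 = t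
     else reals r ''best'' 0 = reals s ''best'' 0 \<and> reals r ''tb'' 0 = reals s ''tb'' 0))" (is "wp _ _ _ ?Q")
  unfolding eval_prog_def
proof (rule wp_straight_Seq)
  let ?s = "exec eval_init s"
  define F where "F = (\<lambda>j. if X j = [] then 0 else amp j * prod_list (map (\<lambda>z. v z + t * w z) (X j)))"
  define I where "I = (\<lambda>j (r :: store). ints r ''j'' 0 = j \<and> ints r ''o'' 0 = offset j \<and>
    reals r ''val'' 0 = (\<Sum>i<j. F i))"
  have in': "input ?s" using s(1) by (simp add: input_def eval_init_def)
  have init: "reals ?s ''t'' 0 = t" "ints ?s ''q'' 0 = q" "reals ?s ''v'' = v" "reals ?s ''sg'' = w"
    "reals ?s ''ca'' = reals s ''ca''" "reals ?s ''best'' = reals s ''best''" "reals ?s ''tb'' = reals s ''tb''"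
    "ints ?s ''nnz'' 0 = nz"
    using s t by (simp_all add: eval_init_def input_def)
  have "wp (Loop (ILess (iv ''j'') (iv ''nnz'')) monomial_prog) ?s ((\<Sum>j<nz. length (X j) * 4 + 21) + 1) (I nz)"
  proof (rule wp_Loop[where b = "\<lambda>j. length (X j) * 4 + 20"])
    show "I 0 ?s" by (simp add: I_def eval_init_def offset_def)
  next
    fix j r assume j: "j < nz" and I: "I j r" and fr: "frame monomial_prog ?s r"
    have in'': "input r" by (rule input_frame[OF in' fr]) (simp_all add: scan_writes)
    have fr': "reals r ''v'' = v" "reals r ''sg'' = w" "reals r ''t'' 0 = t" "reals r ''ca'' j = amp j" "ints r ''nnz'' 0 = nz"
      using fr init s(3)[OF j] by (simp_all add: frame_def scan_writes)
    have Ij: "ints r ''j'' 0 = j" "ints r ''o'' 0 = offset j" using I by (simp_all add: I_def)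
    have "wp monomial_prog r (length (X j) * 4 + 20) (I (Suc j))"
      by (rule wp_conseq[OF wp_monomial[OF j in'' Ij fr'(4,1,2,3)]]) (use I in \<open>simp add: I_def F_def\<close>)
    then show "tval r (ILess (iv ''j'') (iv ''nnz'')) \<and> wp monomial_prog r (length (X j) * 4 + 20) (I (Suc j))"
      using Ij fr' j by simp
  next
    fix r assume "I nz r" "frame monomial_prog ?s r"
    then show "\<not> tval r (ILess (iv ''j'') (iv ''nnz''))" using init by (simp add: I_def frame_def scan_writes)
  qed (simp add: add.commute)
  then have "wp (Loop (ILess (iv ''j'') (iv ''nnz'')) monomial_prog) ?s ((\<Sum>j<nz. length (X j) * 4 + 21) + 1)
    (\<lambda>r. wp compare_step r 7 ?Q)"
  proof (rule wp_conseq)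
    fix r assume fr: "frame (Loop (ILess (iv ''j'') (iv ''nnz'')) monomial_prog) ?s r" and I: "I nz r"
    have fr': "reals r ''t'' 0 = t" "ints r ''q'' 0 = q" "reals r ''best'' = reals s ''best''" "reals r ''tb'' = reals s ''tb''"
      using fr init by (simp_all add: frame_def scan_writes)
    have val: "reals r ''val'' 0 = ray_poly v w t" using I by (simp add: I_def F_def ray_poly_def)
    have "?Q (exec compare_step r)" by (simp add: compare_step_def fr' val)
    then show "wp compare_step r 7 ?Q" by (rule wp_exec[rotated]) (simp_all add: compare_step_def)
  qed
  then show "wp (Loop (ILess (iv ''j'') (iv ''nnz'')) monomial_prog ;; compare_step) ?s
    ((\<Sum>j<nz. length (X j) * 4 + 21) + 9) ?Q"
    by (rule wp_Seq) simp
qed (simp_all add: eval_init_def eval_time_def)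

definition scan_time :: nat where
  "scan_time = (2 * k + 1) * (eval_time + 1) + 10"

lemma wp_scan:
  assumes s: "input s" "\<And>j. j < nz \<Longrightarrow> reals s ''ca'' j = amp j" "reals s ''v'' = v" "reals s ''sg'' = w"
  shows "wp scan_prog s scan_time (\<lambda>r. \<bar>reals r ''tb'' 0\<bar> \<le> 1 \<and>
    (\<forall>q\<le>2 * k. \<bar>ray_poly v w ((real q - real k) / real k)\<bar> \<le> \<bar>ray_poly v w (reals r ''tb'' 0)\<bar>))"
proof -
  \<comment> \<open>Only an inequality for \<open>best\<close>: it starts at 0, which may lie below
    the value at \<open>tb\<close> = 0.\<close>
  define I where "I = (\<lambda>i (r :: store). ints r ''q'' 0 = i \<and> reals r ''best'' 0 \<le> \<bar>ray_poly v w (reals r ''tb'' 0)\<bar> \<and>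
    \<bar>reals r ''tb'' 0\<bar> \<le> 1 \<and> (\<forall>q<i. \<bar>ray_poly v w ((real q - real k) / real k)\<bar> \<le> reals r ''best'' 0))"
  let ?s = "exec (rset ''best'' (rnat 0) ;; rset ''tb'' (rnat 0) ;; iset ''q'' (INat 0)) s"
  have in': "input ?s" using s(1) by (simp add: input_def)
  have "wp scan_prog s scan_time (I (2 * k + 1))"
    unfolding scan_prog_def scan_time_def
  proof (rule wp_straight_Seq)
    show "wp (Loop (ILess (iv ''q'') (IAdd (iv ''k'') (IAdd (iv ''k'') (INat 1)))) eval_prog) ?s
      ((2 * k + 1) * (eval_time + 1) + 1) (I (2 * k + 1))"
    proof (rule wp_Loop[where b = "\<lambda>_. eval_time"])
      show "I 0 ?s" by (simp add: I_def)
    next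
      fix q r assume q: "q < 2 * k + 1" and I: "I q r" and fr: "frame eval_prog ?s r"
      have in'': "input r" by (rule input_frame[OF in' fr]) (simp_all add: scan_writes)
      have fr': "reals r ''v'' = v" "reals r ''sg'' = w" "reals r ''ca'' = reals s ''ca''"
        using fr s by (simp_all add: frame_def scan_writes)
      let ?t = "(real q - real k) / real k"
      have t: "\<bar>?t\<bar> \<le> 1" using q k_pos by (simp add: abs_le_iff field_simps)
      have ca: "\<And>j. j < nz \<Longrightarrow> reals r ''ca'' j = amp j" using s(2) fr' by simp
      have Iq: "ints r ''q'' 0 = q" using I by (simp add: I_def)
      have "wp eval_prog r eval_time (I (Suc q))"
      proof (rule wp_conseq, rule wp_eval[OF in'' Iq ca fr'(1,2) refl])
        fix r' :: store assume Q: "ints r' ''q'' 0 = Suc q \<and> (if reals r ''best'' 0 < \<bar>ray_poly v w ?t\<bar>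
          then reals r' ''best'' 0 = \<bar>ray_poly v w ?t\<bar> \<and> reals r' ''tb'' 0 = ?t
          else reals r' ''best'' 0 = reals r ''best'' 0 \<and> reals r' ''tb'' 0 = reals r ''tb'' 0)"
        have old: "\<bar>ray_poly v w ((real p - real k) / real k)\<bar> \<le> reals r ''best'' 0" if "p < q" for p
          using I that by (simp add: I_def)
        show "I (Suc q) r'"
        proof (cases "reals r ''best'' 0 < \<bar>ray_poly v w ?t\<bar>")
          case True
          then show ?thesis using Q t old by (force simp: I_def less_Suc_eq)
        next
          case False
          then show ?thesis using Q I old by (auto simp: I_def less_Suc_eq)
        qed
      qed
      then show "tval r (ILess (iv ''q'') (IAdd (iv ''k'') (IAdd (iv ''k'') (INat 1)))) \<and> wp eval_prog r eval_time (I (Suc q))"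
        using Iq q in'' by (simp add: input_def)
    next
      fix r assume I: "I (2 * k + 1) r" and fr: "frame eval_prog ?s r"
      have in'': "input r" by (rule input_frame[OF in' fr]) (simp_all add: scan_writes)
      then show "\<not> tval r (ILess (iv ''q'') (IAdd (iv ''k'') (IAdd (iv ''k'') (INat 1))))"
        using I by (simp add: I_def input_def)
    qed simp
  qed simp_all
  then show ?thesis by (rule wp_conseq) (force simp: I_def less_Suc_eq_le)
qed

end

subsection \<open>Sampling corner states\<close>

lemma expectation_bind_finite:
  fixes g :: "'b \<Rightarrow> real"
  assumes "finite (set_pmf p)" "\<And>x. finite (set_pmf (f x))"
  shows "measure_pmf.expectation (bind_pmf p f) g
    = measure_pmf.expectation p (\<lambda>x. measure_pmf.expectation (f x) g)"
proof -
  have "measure_pmf.expectation (bind_pmf p f) g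
      = (\<Sum>x\<in>set_pmf p. pmf p x *\<^sub>R measure_pmf.expectation (f x) g)"
    by (rule pmf_expectation_bind) (use assms in auto)
  also have "\<dots> = measure_pmf.expectation p (\<lambda>x. measure_pmf.expectation (f x) g)"
    by (rule integral_measure_pmf[symmetric]) (use assms in auto)
  finally show ?thesis .
qed

text \<open>The counterpart of \<open>reaches\<close> for a random final store, with the same step
  count on every outcome; the sampling code does not branch on its coins.\<close>

definition yields :: "com \<Rightarrow> store \<Rightarrow> nat \<Rightarrow> store pmf \<Rightarrow> bool" where
  "yields c s m D \<longleftrightarrow> (\<forall>K. run m (c # K, s) = map_pmf (Pair K) D)"

lemma yields_reaches: "reaches c s m s' \<Longrightarrow> yields c s m (return_pmf s')"
  by (simp add: yields_def reaches_def)

lemma yields_Coin: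
  "yields (Coin a i e) s 1 (map_pmf (\<lambda>b. set_int a (ival s i) (if b then 1 else 0) s) (bernoulli_pmf (rval s e)))"
  by (simp add: yields_def map_pmf_def bind_assoc_pmf bind_return_pmf)

lemma yields_Seq:
  assumes "yields p s m D" "\<And>s'. s' \<in> set_pmf D \<Longrightarrow> yields q s' m' (E s')"
  shows "yields (Seq p q) s (Suc (m + m')) (bind_pmf D E)"
proof -
  have "run (Suc (m + m')) (Seq p q # K, s) = map_pmf (Pair K) (bind_pmf D E)" for K
  proof -
    have "run (Suc (m + m')) (Seq p q # K, s) = bind_pmf D (\<lambda>s'. run m' (q # K, s'))"
      using assms(1) by (simp add: yields_def run_add bind_return_pmf bind_map_pmf)
    also have "\<dots> = bind_pmf D (\<lambda>s'. map_pmf (Pair K) (E s'))"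
      by (rule bind_pmf_cong[OF refl]) (use assms(2) in \<open>simp add: yields_def\<close>)
    finally show ?thesis by (simp add: map_bind_pmf)
  qed
  then show ?thesis by (simp add: yields_def)
qed

primrec iterate_pmf :: "('a \<Rightarrow> 'a pmf) \<Rightarrow> nat \<Rightarrow> 'a \<Rightarrow> 'a pmf" where
  "iterate_pmf B 0 s = return_pmf s"
| "iterate_pmf B (Suc r) s = bind_pmf (B s) (iterate_pmf B r)"

text \<open>In contrast to \<open>wp_Loop\<close> the invariant counts the rounds still to come, to
  match the recursion of \<open>iterate_pmf\<close>.\<close>

lemma yields_Loop:
  assumes "\<And>r s. r < N \<Longrightarrow> I (Suc r) s \<Longrightarrow> tval s t \<and> yields p s m (B s) \<and> (\<forall>s'\<in>set_pmf (B s). I r s')"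
    and "\<And>s. I 0 s \<Longrightarrow> \<not> tval s t"
  shows "r \<le> N \<Longrightarrow> I r s \<Longrightarrow> yields (Loop t p) s (r * (m + 1) + 1) (iterate_pmf B r s)"
proof (induction r arbitrary: s)
  case 0
  then show ?case using assms(2) by (simp add: yields_def bind_return_pmf)
next
  case (Suc r)
  from Suc.prems assms(1)[of r s] have 1: "tval s t" "yields p s m (B s)" "\<And>s'. s' \<in> set_pmf (B s) \<Longrightarrow> I r s'"
    by auto
  have "run (Suc r * (m + 1) + 1) (Loop t p # K, s) = map_pmf (Pair K) (iterate_pmf B (Suc r) s)" for K
  proof -
    have "Suc r * (m + 1) + 1 = Suc (m + (r * (m + 1) + 1))" by simp
    then have "run (Suc r * (m + 1) + 1) (Loop t p # K, s) = run (m + (r * (m + 1) + 1)) (p # Loop t p # K, s)"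
      using 1(1) by (simp only: run.simps step.simps if_True bind_return_pmf)
    also have "\<dots> = bind_pmf (B s) (\<lambda>s'. run (r * (m + 1) + 1) (Loop t p # K, s'))"
      unfolding run_add using 1(2) by (simp add: yields_def bind_map_pmf del: run.simps)
    also have "\<dots> = bind_pmf (B s) (\<lambda>s'. map_pmf (Pair K) (iterate_pmf B r s'))"
      by (rule bind_pmf_cong[OF refl])
        (use Suc.IH[OF _ 1(3)] Suc.prems(1) in \<open>simp add: yields_def\<close>)
    finally show ?thesis by (simp add: map_bind_pmf)
  qed
  then show ?case by (simp add: yields_def)
qed

abbreviation var_index :: "nat \<Rightarrow> iexp" where
  "var_index a \<equiv> IAdd (iv ''i'') (IAdd (iv ''i'') (IAdd (iv ''i'') (INat a)))"

text \<open>A sign of mean m is +1 with probability (1 + m) / 2; the inner halving is the one in the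
  definition of the means.\<close>

definition head_prob :: "nat \<Rightarrow> rexp" where
  "head_prob a = RDiv (RAdd (rnat 1) (RDiv (RAdd (RCell ''v'' (var_index a))
     (RMul (rv ''tb'') (RCell ''sg'' (var_index a)))) (rnat 2))) (rnat 2)"

abbreviation spin :: "vname \<Rightarrow> rexp" where
  "spin a \<equiv> RDiv (RSub (RMul (rnat 2) (RNat (iv a))) (rnat 1)) (RPow (rnat 3) rhalf)"

text \<open>The phase is chosen so that the amplitude at 0 is real; its imaginary part is never
  written and keeps its initial value 0.\<close>

definition write_qubit :: com where
  "write_qubit =
    RStore ''re0'' (iv ''i'') (RPow (RDiv (RAdd (rnat 1) (spin ''cz'')) (rnat 2)) rhalf) ;;
    RStore ''re1'' (iv ''i'') (RDiv (spin ''cx'') (RMul (rnat 2) (RCell ''re0'' (iv ''i'')))) ;;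
    RStore ''im1'' (iv ''i'') (RDiv (spin ''cy'') (RMul (rnat 2) (RCell ''re0'' (iv ''i'')))) ;;
    incr ''i''"

definition qubit_prog :: com where
  "qubit_prog = Coin ''cx'' (INat 0) (head_prob 1) ;; Coin ''cy'' (INat 0) (head_prob 2) ;;
    Coin ''cz'' (INat 0) (head_prob 3) ;; write_qubit"

definition sample_loop :: com where
  "sample_loop = Loop (ILess (iv ''i'') (iv ''n'')) qubit_prog"

definition sgn_bool :: "bool \<Rightarrow> real" where "sgn_bool b = (if b then 1 else -1)"

text \<open>For a Bloch vector (bx, by, bz) with bz > -1 the amplitudes are r = sqrt ((1 + bz) / 2)
  and (bx + i by) / (2 r); here all components are +-1 / sqrt 3, so r > 0.\<close>

definition corner :: "bool \<Rightarrow> bool \<Rightarrow> bool \<Rightarrow> qubit" where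
  "corner x y z = (let r = sqrt ((1 + sgn_bool z / sqrt 3) / 2)
     in (Complex r 0, Complex (sgn_bool x / sqrt 3 / (2 * r)) (sgn_bool y / sqrt 3 / (2 * r))))"

definition qubit_pmf :: "(nat \<Rightarrow> real) \<Rightarrow> nat \<Rightarrow> qubit pmf" where
  "qubit_pmf m i = bind_pmf (bernoulli_pmf ((1 + m (3 * i + 1)) / 2)) (\<lambda>x.
     bind_pmf (bernoulli_pmf ((1 + m (3 * i + 2)) / 2)) (\<lambda>y.
     map_pmf (corner x y) (bernoulli_pmf ((1 + m (3 * i + 3)) / 2))))"

definition mean_of :: "store \<Rightarrow> nat \<Rightarrow> real" where
  "mean_of s u = (reals s ''v'' u + reals s ''tb'' 0 * reals s ''sg'' u) / 2"

definition qubit_step :: "store \<Rightarrow> store pmf" where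
  "qubit_step s = (let i = ints s ''i'' 0; m = mean_of s in
     bind_pmf (bernoulli_pmf ((1 + m (3 * i + 1)) / 2)) (\<lambda>x.
     bind_pmf (bernoulli_pmf ((1 + m (3 * i + 2)) / 2)) (\<lambda>y.
     map_pmf (\<lambda>z. exec write_qubit (set_int ''cz'' 0 (of_bool z) (set_int ''cy'' 0 (of_bool y) (set_int ''cx'' 0 (of_bool x) s))))
       (bernoulli_pmf ((1 + m (3 * i + 3)) / 2)))))"

lemma head_prob_val: "rval s (head_prob a) = (1 + mean_of s (3 * ints s ''i'' 0 + a)) / 2"
proof -
  have "ival s (var_index a) = 3 * ints s ''i'' 0 + a" by simp
  then show ?thesis by (simp only: head_prob_def rval.simps mean_of_def) simp
qed

lemma reaches_write_qubit: "reaches write_qubit s 7 (exec write_qubit s)"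
  by (simp add: reaches_def write_qubit_def bind_return_pmf eval_nat_numeral)

lemma yields_Coin_Seq:
  assumes "\<And>s'. yields q s' m (E s')"
  shows "yields (Coin a i e ;; q) s (m + 2)
    (bind_pmf (bernoulli_pmf (rval s e)) (\<lambda>b. E (set_int a (ival s i) (of_bool b) s)))"
  using yields_Seq[OF yields_Coin[of a i e s], of q m E] assms
  by (simp add: bind_map_pmf of_bool_def)

lemma yields_qubit: "yields qubit_prog s 13 (qubit_step s)"
proof -
  have m: "mean_of (set_int a i c s) = mean_of s" for a i c s by (simp add: mean_of_def fun_eq_iff)
  have w: "yields write_qubit s 7 (return_pmf (exec write_qubit s))" for s
    by (rule yields_reaches[OF reaches_write_qubit])
  have "yields qubit_prog s (7 + 2 + 2 + 2) (bind_pmf (bernoulli_pmf (rval s (head_prob 1))) (\<lambda>x.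
     let s1 = set_int ''cx'' 0 (of_bool x) s in bind_pmf (bernoulli_pmf (rval s1 (head_prob 2))) (\<lambda>y.
     let s2 = set_int ''cy'' 0 (of_bool y) s1 in bind_pmf (bernoulli_pmf (rval s2 (head_prob 3))) (\<lambda>z.
     return_pmf (exec write_qubit (set_int ''cz'' 0 (of_bool z) s2))))))"
    unfolding qubit_prog_def Let_def
    using yields_Coin_Seq[where i = "INat 0" and a = "''cx''", OF yields_Coin_Seq[where i = "INat 0" and a = "''cy''",
        OF yields_Coin_Seq[where i = "INat 0" and a = "''cz''", OF w]]]
    by (simp only: ival.simps)
  moreover have "ints (set_int ''cx'' 0 x s) ''i'' = ints s ''i''" "ints (set_int ''cy'' 0 y s) ''i'' = ints s ''i''"
    for x y s by simp_all
  ultimately show ?thesis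
    by (simp only: head_prob_val m Let_def qubit_step_def map_pmf_def o_def) simp
qed

lemma finite_qubit_step [simp]: "finite (set_pmf (qubit_step s))"
  by (simp add: qubit_step_def Let_def)

lemma finite_iterate [simp]: "finite (set_pmf (iterate_pmf qubit_step r s))"
  by (induction r arbitrary: s) simp_all

lemma output_write_qubit:
  fixes s :: store and x y z :: bool
  defines "t \<equiv> exec write_qubit (set_int ''cz'' 0 (of_bool z) (set_int ''cy'' 0 (of_bool y) (set_int ''cx'' 0 (of_bool x) s)))"
  assumes "reals s ''im0'' = (\<lambda>_. 0)"
  shows "output_qubits t l = (if l = ints s ''i'' 0 then corner x y z else output_qubits s l)"
    "ints t ''i'' 0 = Suc (ints s ''i'' 0)" "ints t ''n'' = ints s ''n''" "mean_of t = mean_of s"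
    "reals t ''im0'' = (\<lambda>_. 0)"
proof -
  have r3: "sqrt 3 \<ge> 1" by simp
  have pos: "0 \<le> 1 + sgn_bool z / sqrt 3" using r3 by (simp add: sgn_bool_def divide_simps)
  have sp: "2 * real (of_bool b) - 1 = sgn_bool b" for b by (simp add: sgn_bool_def)
  have out: "reals t ''re0'' = (reals s ''re0'')(ints s ''i'' 0 := sqrt ((1 + sgn_bool z / sqrt 3) / 2))"
    "reals t ''im0'' = reals s ''im0''"
    "reals t ''re1'' = (reals s ''re1'')(ints s ''i'' 0 := sgn_bool x / sqrt 3 / (2 * sqrt ((1 + sgn_bool z / sqrt 3) / 2)))"
    "reals t ''im1'' = (reals s ''im1'')(ints s ''i'' 0 := sgn_bool y / sqrt 3 / (2 * sqrt ((1 + sgn_bool z / sqrt 3) / 2)))"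
    using pos by (simp_all add: t_def write_qubit_def sp powr_half_sqrt fun_eq_iff del: of_nat_of_bool)
  show "output_qubits t l = (if l = ints s ''i'' 0 then corner x y z else output_qubits s l)"
    using assms(2) by (simp add: output_qubits_def out corner_def Let_def)
  show "ints t ''i'' 0 = Suc (ints s ''i'' 0)" "ints t ''n'' = ints s ''n''" "mean_of t = mean_of s"
    by (simp_all add: t_def write_qubit_def mean_of_def fun_eq_iff)
  show "reals t ''im0'' = (\<lambda>_. 0)" using assms(2) by (simp add: out)
qed

lemma qubit_step_support:
  assumes "s' \<in> set_pmf (qubit_step s)" "reals s ''im0'' = (\<lambda>_. 0)"
  shows "ints s' ''i'' 0 = Suc (ints s ''i'' 0)" "ints s' ''n'' = ints s ''n''" "mean_of s' = mean_of s"
    "reals s' ''im0'' = (\<lambda>_. 0)"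
    "\<exists>x y z. \<forall>l. output_qubits s' l = (if l = ints s ''i'' 0 then corner x y z else output_qubits s l)"
proof -
  from assms(1) obtain x y z where s':
    "s' = exec write_qubit (set_int ''cz'' 0 (of_bool z) (set_int ''cy'' 0 (of_bool y) (set_int ''cx'' 0 (of_bool x) s)))"
    unfolding qubit_step_def Let_def by auto
  show "ints s' ''i'' 0 = Suc (ints s ''i'' 0)" "ints s' ''n'' = ints s ''n''" "mean_of s' = mean_of s"
    "reals s' ''im0'' = (\<lambda>_. 0)"
    unfolding s' by (rule output_write_qubit[OF assms(2)])+
  show "\<exists>x y z. \<forall>l. output_qubits s' l = (if l = ints s ''i'' 0 then corner x y z else output_qubits s l)"
    unfolding s' by (intro exI allI) (rule output_write_qubit(1)[OF assms(2)])
qed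

lemma map_qubit_step:
  assumes "reals s ''im0'' = (\<lambda>_. 0)"
  shows "map_pmf (\<lambda>s'. output_qubits s' (ints s ''i'' 0)) (qubit_step s) = qubit_pmf (mean_of s) (ints s ''i'' 0)"
  unfolding qubit_step_def qubit_pmf_def Let_def
  by (simp add: map_bind_pmf pmf.map_comp o_def output_write_qubit(1)[OF assms])

lemma iterate_support:
  assumes "s' \<in> set_pmf (iterate_pmf qubit_step r s)" "reals s ''im0'' = (\<lambda>_. 0)"
  shows "(l < ints s ''i'' 0 \<longrightarrow> output_qubits s' l = output_qubits s l) \<and>
    (ints s ''i'' 0 \<le> l \<and> l < ints s ''i'' 0 + r \<longrightarrow> (\<exists>x y z. output_qubits s' l = corner x y z))"
  using assms
proof (induction r arbitrary: s)
  case (Suc r)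
  then obtain s1 where s1: "s1 \<in> set_pmf (qubit_step s)" "s' \<in> set_pmf (iterate_pmf qubit_step r s1)" by auto
  note sup = qubit_step_support[OF s1(1) Suc.prems(2)]
  obtain x y z where 1: "\<And>l. output_qubits s1 l = (if l = ints s ''i'' 0 then corner x y z else output_qubits s l)"
    using sup(5) by blast
  note IH = Suc.IH[OF s1(2) sup(4), unfolded sup(1)]
  consider "l < ints s ''i'' 0" | "l = ints s ''i'' 0" | "ints s ''i'' 0 < l" by linarith
  then show ?case
  proof cases
    case 2
    then have "output_qubits s' l = corner x y z" using IH 1[of l] by simp
    then show ?thesis using 2 by blast
  qed (use IH 1[of l] in simp_all)
qed auto

text \<open>Each qubit is written once, with probabilities that depend only on the unchanging
  \<open>mean_of\<close>; the qubits are therefore independent and expectations of products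
  factor.\<close>

lemma expectation_iterate:
  fixes h :: "nat \<Rightarrow> qubit \<Rightarrow> real"
  assumes "reals s ''im0'' = (\<lambda>_. 0)" "ints s ''i'' 0 = i" "mean_of s = m"
  shows "measure_pmf.expectation (iterate_pmf qubit_step r s) (\<lambda>s'. \<Prod>l\<in>{i..<i + r}. h l (output_qubits s' l))
    = (\<Prod>l\<in>{i..<i + r}. measure_pmf.expectation (qubit_pmf m l) (h l))"
  using assms
proof (induction r arbitrary: s i)
  case (Suc r)
  let ?E = "measure_pmf.expectation"
  let ?M = "\<Prod>l\<in>{Suc i..<Suc i + r}. ?E (qubit_pmf m l) (h l)"
  have sp: "{i..<i + Suc r} = insert i {Suc i..<Suc i + r}" by auto
  have "?E (iterate_pmf qubit_step (Suc r) s) (\<lambda>s'. \<Prod>l\<in>{i..<i + Suc r}. h l (output_qubits s' l))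
    = ?E (qubit_step s) (\<lambda>s1. ?E (iterate_pmf qubit_step r s1) (\<lambda>s'. \<Prod>l\<in>{i..<i + Suc r}. h l (output_qubits s' l)))"
    unfolding iterate_pmf.simps by (rule expectation_bind_finite) simp_all
  also have "\<dots> = ?E (qubit_step s) (\<lambda>s1. h i (output_qubits s1 i) * ?M)"
  proof (rule integral_cong_AE)
    show "AE s1 in qubit_step s. ?E (iterate_pmf qubit_step r s1) (\<lambda>s'. \<Prod>l\<in>{i..<i + Suc r}. h l (output_qubits s' l))
      = h i (output_qubits s1 i) * ?M"
    proof (rule AE_pmfI)
      fix s1 assume s1: "s1 \<in> set_pmf (qubit_step s)"
      note sup = qubit_step_support[OF s1 Suc.prems(1)]
      have 1: "ints s1 ''i'' 0 = Suc i" "reals s1 ''im0'' = (\<lambda>_. 0)" "mean_of s1 = m"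
        using sup(1,3,4) Suc.prems(2,3) by simp_all
      \<comment> \<open>Later rounds do not touch qubit \<open>i\<close>, so its factor is constant
        in the inner expectation.\<close>
      have "?E (iterate_pmf qubit_step r s1) (\<lambda>s'. \<Prod>l\<in>{i..<i + Suc r}. h l (output_qubits s' l))
        = ?E (iterate_pmf qubit_step r s1) (\<lambda>s'. h i (output_qubits s1 i) * (\<Prod>l\<in>{Suc i..<Suc i + r}. h l (output_qubits s' l)))"
      proof (rule integral_cong_AE)
        show "AE s' in iterate_pmf qubit_step r s1. (\<Prod>l\<in>{i..<i + Suc r}. h l (output_qubits s' l))
          = h i (output_qubits s1 i) * (\<Prod>l\<in>{Suc i..<Suc i + r}. h l (output_qubits s' l))"
          by (rule AE_pmfI) (use iterate_support[OF _ 1(2)] 1(1) sp in simp)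
      qed simp_all
      also have "\<dots> = h i (output_qubits s1 i) * ?M"
        using Suc.IH[OF 1(2,1,3)] by simp
      finally show "?E (iterate_pmf qubit_step r s1) (\<lambda>s'. \<Prod>l\<in>{i..<i + Suc r}. h l (output_qubits s' l))
        = h i (output_qubits s1 i) * ?M" .
    qed
  qed simp_all
  also have "\<dots> = ?E (map_pmf (\<lambda>s'. output_qubits s' i) (qubit_step s)) (h i) * ?M"
    by simp
  also have "\<dots> = (\<Prod>l\<in>{i..<i + Suc r}. ?E (qubit_pmf m l) (h l))"
    using map_qubit_step[OF Suc.prems(1)] Suc.prems(2,3) sp by simp
  finally show ?case .
qed simp

lemma yields_sample:
  assumes "ints s ''n'' 0 = n" "ints s ''i'' 0 = 0" "reals s ''im0'' = (\<lambda>_. 0)"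
  shows "yields sample_loop s (n * 14 + 1) (iterate_pmf qubit_step n s)"
proof -
  define I where "I = (\<lambda>r (t :: store). ints t ''i'' 0 + r = n \<and> ints t ''n'' 0 = n \<and> reals t ''im0'' = (\<lambda>_. 0))"
  have "yields sample_loop s (n * (13 + 1) + 1) (iterate_pmf qubit_step n s)"
    unfolding sample_loop_def
  proof (rule yields_Loop[where N = n and I = I])
    fix r t assume "r < n" and I: "I (Suc r) t"
    have "I r t'" if "t' \<in> set_pmf (qubit_step t)" for t'
    proof -
      have im: "reals t ''im0'' = (\<lambda>_. 0)" using I by (simp add: I_def)
      note qubit_step_support(1,2,4)[OF that im]
      then show ?thesis using I by (simp add: I_def)
    qed
    then show "tval t (ILess (iv ''i'') (iv ''n'')) \<and> yields qubit_prog t 13 (qubit_step t) \<and>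
      (\<forall>t'\<in>set_pmf (qubit_step t). I r t')"
      using I yields_qubit by (simp add: I_def)
  next
    show "\<not> tval t (ILess (iv ''i'') (iv ''n''))" if "I 0 t" for t
      using that by (simp add: I_def)
  qed (use assms in \<open>simp_all add: I_def\<close>)
  then show ?thesis by simp
qed

subsection \<open>Blei's inequality\<close>

text \<open>Blei's inequality. The proof is Hoelder's inequality for
  \<open>a^(2d) = (\<Prod>j. A j (\<phi> j P)) * (\<Prod>j. a^2 / A j (\<phi> j P))\<close>, where \<open>A j x\<close> is the
  square norm of \<open>a\<close> on the slice \<open>\<phi> j P = x\<close>, carried out as an arithmetic-geometric mean estimate.\<close>

lemma mixed_norm_inequality:
  fixes a :: "'p \<Rightarrow> real" and \<phi> :: "nat \<Rightarrow> 'p \<Rightarrow> 'i"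
  assumes fin: "finite \<P>" and pos: "\<And>P. P \<in> \<P> \<Longrightarrow> 0 < a P" and d: "d \<ge> 1"
    and fib: "\<And>P. P \<in> \<P> \<Longrightarrow> real (card {Q \<in> \<P>. \<forall>j<d. \<phi> j Q = \<phi> j P}) \<le> c"
    and S: "\<And>j. j < d \<Longrightarrow> (\<Sum>x\<in>\<phi> j ` \<P>. sqrt (\<Sum>P\<in>{P \<in> \<P>. \<phi> j P = x}. (a P)\<^sup>2)) \<le> S"
  shows "(\<Sum>P\<in>\<P>. a P powr (2 * real d / (real d + 1)))
    \<le> c powr (1 / (real d + 1)) * S powr (2 * real d / (real d + 1))"
proof (cases "\<P> = {}")
  case True
  then show ?thesis by simp
next
  case False
  define A where "A = (\<lambda>j x. sqrt (\<Sum>P\<in>{P \<in> \<P>. \<phi> j P = x}. (a P)\<^sup>2))"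
  have A_pos: "0 < A j (\<phi> j P)" if "P \<in> \<P>" for j P
  proof -
    have "0 < (\<Sum>Q\<in>{Q \<in> \<P>. \<phi> j Q = \<phi> j P}. (a Q)\<^sup>2)"
    proof (rule sum_pos)
      fix Q assume "Q \<in> {Q \<in> \<P>. \<phi> j Q = \<phi> j P}"
      then have "0 < a Q" using pos by simp
      then show "0 < (a Q)\<^sup>2" by simp
    qed (use fin that in auto)
    then show ?thesis by (simp add: A_def)
  qed
  have A_nonneg: "0 \<le> A j x" for j x unfolding A_def by (simp add: sum_nonneg)
  obtain P0 where P0: "P0 \<in> \<P>" using False by blast
  have c_pos: "0 < c"
  proof -
    have "card {Q \<in> \<P>. \<forall>j<d. \<phi> j Q = \<phi> j P0} > 0" using fin P0 by (auto simp: card_gt_0_iff)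
    then show ?thesis using fib[OF P0] by linarith
  qed
  have S_pos: "0 < S"
  proof -
    have "0 < (\<Sum>x\<in>\<phi> 0 ` \<P>. A 0 x)"
      by (rule sum_pos2[of _ "\<phi> 0 P0"]) (use fin P0 A_pos A_nonneg in auto)
    also have "\<dots> \<le> S" using S[of 0] d by (simp add: A_def)
    finally show ?thesis .
  qed
  define T where "T = (\<lambda>P. restrict (\<lambda>j. \<phi> j P) {..<d})"
  define R where "R = PiE {..<d} (\<lambda>j. \<phi> j ` \<P>)"
  \<comment> \<open>The first Hoelder factor: the sum is taken over the box \<open>R\<close> of all
    tuples instead, where a tuple has at most \<open>c\<close> preimages and the sum splits into a
    product.\<close>
  have "(\<Sum>P\<in>\<P>. \<Prod>j<d. A j (\<phi> j P)) = (\<Sum>P\<in>\<P>. \<Prod>j<d. A j (T P j))"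
    by (simp add: T_def)
  also have "\<dots> = (\<Sum>t\<in>R. real (card {P \<in> \<P>. T P = t}) * (\<Prod>j<d. A j (t j)))"
  proof (rule sum_fun_comp[OF fin])
    show "finite R" using fin by (auto simp: R_def intro!: finite_PiE)
    show "T ` \<P> \<subseteq> R"
      by (intro image_subsetI) (simp add: T_def R_def restrict_PiE_iff)
  qed
  also have "\<dots> \<le> (\<Sum>t\<in>R. c * (\<Prod>j<d. A j (t j)))"
  proof (intro sum_mono mult_right_mono)
    fix t
    show "real (card {P \<in> \<P>. T P = t}) \<le> c"
    proof (cases "\<exists>P\<in>\<P>. T P = t")
      case True
      then obtain P where P: "P \<in> \<P>" "T P = t" by blast
      have "{Q \<in> \<P>. T Q = t} = {Q \<in> \<P>. \<forall>j<d. \<phi> j Q = \<phi> j P}"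
        unfolding P(2)[symmetric] T_def by (auto simp: fun_eq_iff restrict_def)
      then show ?thesis using fib[OF P(1)] by simp
    next
      case False
      then have "{P \<in> \<P>. T P = t} = {}" by auto
      then show ?thesis using c_pos by (simp only: card.empty)
    qed
  qed (simp add: prod_nonneg A_nonneg)
  also have "\<dots> = c * (\<Prod>j<d. \<Sum>x\<in>\<phi> j ` \<P>. A j x)"
    unfolding R_def sum_distrib_left[symmetric]
    by (subst prod_sum_PiE) (use fin in auto)
  also have "\<dots> \<le> c * (\<Prod>j<d. S)"
    using c_pos S by (intro mult_left_mono prod_mono) (auto simp: A_def intro!: sum_nonneg)
  finally have first: "(\<Sum>P\<in>\<P>. \<Prod>j<d. A j (\<phi> j P)) \<le> c * S ^ d" by simp
  \<comment> \<open>On a slice the denominator is constant and the squares add up to its square,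
    which leaves the sum of the \<open>A j x\<close>.\<close>
  have second: "(\<Sum>P\<in>\<P>. (a P)\<^sup>2 / A j (\<phi> j P)) \<le> S" if "j < d" for j
  proof -
    have "(\<Sum>P\<in>\<P>. (a P)\<^sup>2 / A j (\<phi> j P)) = (\<Sum>x\<in>\<phi> j ` \<P>. \<Sum>P\<in>{P \<in> \<P>. \<phi> j P = x}. (a P)\<^sup>2 / A j (\<phi> j P))"
      using fin by (rule sum.image_gen)
    also have "\<dots> = (\<Sum>x\<in>\<phi> j ` \<P>. A j x)"
    proof (rule sum.cong[OF refl])
      fix x assume "x \<in> \<phi> j ` \<P>"
      then have Ax: "0 < A j x" using A_pos by auto
      have "(\<Sum>P\<in>{P \<in> \<P>. \<phi> j P = x}. (a P)\<^sup>2 / A j (\<phi> j P)) = (\<Sum>P\<in>{P \<in> \<P>. \<phi> j P = x}. (a P)\<^sup>2) / A j x"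
        by (simp add: sum_divide_distrib)
      also have "(\<Sum>P\<in>{P \<in> \<P>. \<phi> j P = x}. (a P)\<^sup>2) = (A j x)\<^sup>2" by (simp add: A_def sum_nonneg)
      finally show "(\<Sum>P\<in>{P \<in> \<P>. \<phi> j P = x}. (a P)\<^sup>2 / A j (\<phi> j P)) = A j x"
        using Ax by (simp add: power2_eq_square)
    qed
    also have "\<dots> \<le> S" using S[OF that] by (simp add: A_def)
    finally show ?thesis .
  qed
  define N where "N = real d + 1"
  define Z where "Z = c * S ^ (2 * d)"
  have Z_pos: "0 < Z" using c_pos S_pos by (simp add: Z_def)
  \<comment> \<open>Arithmetic-geometric mean of d + 1 factors, one normalised by
    \<open>c * S ^ d\<close> and the other d by \<open>S\<close>, so that each sums to at most 1;
    the normalisations multiply to \<open>Z\<close>.\<close>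
  have each: "(a P ^ (2 * d) / Z) powr (1 / N)
      \<le> ((\<Prod>j<d. A j (\<phi> j P)) / (c * S ^ d) + (\<Sum>j<d. (a P)\<^sup>2 / A j (\<phi> j P) / S)) / N" if P: "P \<in> \<P>" for P
  proof -
    define y where "y = (\<lambda>i. if i = d then (\<Prod>j<d. A j (\<phi> j P)) / (c * S ^ d) else (a P)\<^sup>2 / A i (\<phi> i P) / S)"
    have "(\<Prod>i\<in>{..d}. y i) powr (1 / real (card {..d})) \<le> (\<Sum>i\<in>{..d}. y i / real (card {..d}))"
      by (rule arith_geom_mean) (use c_pos S_pos A_nonneg in \<open>auto simp: y_def intro!: divide_nonneg_pos prod_nonneg\<close>)
    moreover have "(\<Prod>i\<in>{..d}. y i) = a P ^ (2 * d) / Z"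
    proof -
      have "(\<Prod>i\<in>{..d}. y i) = (\<Prod>i<d. (a P)\<^sup>2 / A i (\<phi> i P) / S) * ((\<Prod>j<d. A j (\<phi> j P)) / (c * S ^ d))"
        by (simp add: lessThan_Suc_atMost[symmetric] y_def)
      also have "(\<Prod>i<d. (a P)\<^sup>2 / A i (\<phi> i P) / S) = a P ^ (2 * d) / (\<Prod>j<d. A j (\<phi> j P)) / S ^ d"
        by (simp add: prod_dividef prod.distrib power_mult)
      finally have "(\<Prod>i\<in>{..d}. y i) = a P ^ (2 * d) / (\<Prod>j<d. A j (\<phi> j P)) / S ^ d * ((\<Prod>j<d. A j (\<phi> j P)) / (c * S ^ d))" .
      moreover have "x / q / s * (q / (c * s)) = x / (c * (s * s))" if "q > 0" for x q s :: real
        using that by simp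
      moreover have "0 < (\<Prod>j<d. A j (\<phi> j P))" by (rule prod_pos) (use A_pos[OF P] in blast)
      ultimately show ?thesis by (simp only: Z_def mult_2 power_add)
    qed
    moreover have "(\<Sum>i\<in>{..d}. y i / real (card {..d}))
      = ((\<Prod>j<d. A j (\<phi> j P)) / (c * S ^ d) + (\<Sum>j<d. (a P)\<^sup>2 / A j (\<phi> j P) / S)) / N"
      by (simp add: lessThan_Suc_atMost[symmetric] y_def N_def sum_divide_distrib[symmetric] add_divide_distrib[symmetric] add.commute)
    ultimately show ?thesis by (simp add: N_def add.commute)
  qed
  have "(\<Sum>P\<in>\<P>. (a P ^ (2 * d) / Z) powr (1 / N))
    \<le> (\<Sum>P\<in>\<P>. ((\<Prod>j<d. A j (\<phi> j P)) / (c * S ^ d) + (\<Sum>j<d. (a P)\<^sup>2 / A j (\<phi> j P) / S)) / N)"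
    by (rule sum_mono) (rule each)
  also have "\<dots> = ((\<Sum>P\<in>\<P>. \<Prod>j<d. A j (\<phi> j P)) / (c * S ^ d) + (\<Sum>j<d. (\<Sum>P\<in>\<P>. (a P)\<^sup>2 / A j (\<phi> j P)) / S)) / N"
    by (simp only: sum_divide_distrib[symmetric] sum.distrib) (subst sum.swap, rule refl)
  also have "\<dots> \<le> (1 + (\<Sum>j<d. 1)) / N"
  proof (intro divide_right_mono add_mono sum_mono)
    show "(\<Sum>P\<in>\<P>. \<Prod>j<d. A j (\<phi> j P)) / (c * S ^ d) \<le> 1" using first c_pos S_pos by simp
    show "(\<Sum>P\<in>\<P>. (a P)\<^sup>2 / A j (\<phi> j P)) / S \<le> 1" if "j \<in> {..<d}" for j using second that S_pos by simp
  qed (simp add: N_def)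
  also have "\<dots> = 1" by (simp add: N_def)
  finally have "(\<Sum>P\<in>\<P>. a P powr (2 * real d / N)) / Z powr (1 / N) \<le> 1"
    using pos Z_pos by (simp add: sum_divide_distrib powr_divide powr_realpow[symmetric] powr_powr less_imp_le)
  then have "(\<Sum>P\<in>\<P>. a P powr (2 * real d / N)) \<le> Z powr (1 / N)" using Z_pos by simp
  also have "Z powr (1 / N) = c powr (1 / N) * S powr (2 * real d / N)"
    using c_pos S_pos by (simp add: Z_def powr_mult powr_realpow[symmetric] powr_powr)
  finally show ?thesis by (simp add: N_def)
qed

section \<open>Pauli coefficients in the mixed norm\<close>

lemma finite_paulis [simp]: "finite (paulis n)"
proof -
  have "finite (UNIV :: pauli set)"
    by (rule finite_subset[of _ "{PI, PX, PY, PZ}"]) (use pauli.exhaust in auto)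
  then show ?thesis using finite_lists_length_eq[of "UNIV :: pauli set" n] by (simp add: paulis_def)
qed

lemma finite_pauli_dom [simp]: "finite (pauli_dom P)"
  by (simp add: pauli_dom_def)

lemma pauli_dom_subset: "P \<in> paulis n \<Longrightarrow> pauli_dom P \<subseteq> {..<n}"
  by (auto simp: paulis_def pauli_dom_def)

lemma pauli_dom_empty: "P \<in> paulis n \<Longrightarrow> pauli_dom P = {} \<Longrightarrow> P = pauli_id n"
  by (auto simp: paulis_def pauli_dom_def pauli_id_def intro: nth_equalityI)

definition site_norm_sum :: "nat \<Rightarrow> (pauli list \<Rightarrow> real) \<Rightarrow> real" where
  "site_norm_sum n \<alpha> = (\<Sum>i<n. sqrt (\<Sum>P\<in>{P \<in> paulis n. i \<in> pauli_dom P}. (\<alpha> P)\<^sup>2))"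

text \<open>An observable of weight below \<open>d\<close> is assigned the \<open>d\<close>-tuple of its sites with the last one
  repeated, so that no dummy sites are needed.\<close>

lemma coeff_norm_le_site_norm_sum:
  assumes "expansion n \<alpha> c d"
  shows "coeff_norm n \<alpha> (rexpo d) \<le> c powr (1 / (2 * real d)) * site_norm_sum n \<alpha>"
proof -
  from assms have c: "c \<ge> 1" and d: "1 \<le> d" "d \<le> n" and
    count: "\<And>\<Upsilon>. \<Upsilon> \<subseteq> {..<n} \<Longrightarrow> card \<Upsilon> = d \<Longrightarrow>
      real (card {P\<in>paulis n. \<alpha> P \<noteq> 0 \<and> (\<Upsilon> \<subseteq> pauli_dom P \<or> pauli_dom P \<subseteq> \<Upsilon>)}) \<le> c"
    by (auto simp: expansion_def)
  define \<P> where "\<P> = {P \<in> paulis n - {pauli_id n}. \<alpha> P \<noteq> 0}"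
  define \<phi> where "\<phi> = (\<lambda>j P. sites P ! min j (pauli_weight P - 1))"
  let ?S = "site_norm_sum n \<alpha>"
  have len: "length (sites P) = pauli_weight P" "set (sites P) = pauli_dom P" "distinct (sites P)" for P
    by (simp_all add: sites_def pauli_weight_def)
  have w: "pauli_weight P \<ge> 1" "P \<in> paulis n" if "P \<in> \<P>" for P
    using that pauli_dom_empty by (auto simp: \<P>_def pauli_weight_def Suc_le_eq card_gt_0_iff)
  have \<phi>_dom: "\<phi> j P \<in> pauli_dom P" if "P \<in> \<P>" for j P
    using w(1)[OF that] nth_mem[of "min j (pauli_weight P - 1)" "sites P"] by (simp add: \<phi>_def len)
  have fib: "real (card {Q \<in> \<P>. \<forall>j<d. \<phi> j Q = \<phi> j P}) \<le> c" if P: "P \<in> \<P>" for P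
  proof -
    let ?Y = "(\<lambda>j. \<phi> j P) ` {..<d}"
    have Yn: "?Y \<subseteq> {..<n}" using \<phi>_dom[OF P] pauli_dom_subset[OF w(2)[OF P]] by blast
    have img: "(\<lambda>j. \<phi> j Q) ` {..<d} = set (take d (sites Q))" if Q: "Q \<in> \<P>" for Q
    proof -
      have "set (take d (sites Q)) = (\<lambda>i. sites Q ! i) ` {..<min d (pauli_weight Q)}"
        using nth_image[of "min d (pauli_weight Q)" "sites Q"] by (simp add: len atLeast0LessThan min_def split: if_splits)
      also have "{..<min d (pauli_weight Q)} = (\<lambda>j. min j (pauli_weight Q - 1)) ` {..<d}"
      proof
        show "{..<min d (pauli_weight Q)} \<subseteq> (\<lambda>j. min j (pauli_weight Q - 1)) ` {..<d}"
        proof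
          fix x assume "x \<in> {..<min d (pauli_weight Q)}"
          then have "x = min x (pauli_weight Q - 1)" "x \<in> {..<d}" by auto
          then show "x \<in> (\<lambda>j. min j (pauli_weight Q - 1)) ` {..<d}" by (rule image_eqI)
        qed
        show "(\<lambda>j. min j (pauli_weight Q - 1)) ` {..<d} \<subseteq> {..<min d (pauli_weight Q)}"
          using w(1)[OF Q] by auto
      qed
      finally show ?thesis by (simp add: \<phi>_def image_image)
    qed
    have card_img: "card (set (take d (sites Q))) = min d (pauli_weight Q)" for Q
      using distinct_card[OF distinct_take[OF len(3)], of d Q] by (simp add: len(1) min.commute)
    \<comment> \<open>The slots of \<open>P\<close> may cover fewer than \<open>d\<close> sites, but
      the expansion property speaks of exactly \<open>d\<close>; hence the enlargement, possible as
      d <= n.\<close>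
    obtain Z where Z: "?Y \<subseteq> Z" "Z \<subseteq> {..<n}" "card Z = d"
    proof -
      have "card ?Y \<le> d" using card_image_le[of "{..<d}" "\<lambda>j. \<phi> j P"] by simp
      then show ?thesis
        using exists_subset_between[of ?Y d "{..<n}"] Yn d that by auto
    qed
    have "{Q \<in> \<P>. \<forall>j<d. \<phi> j Q = \<phi> j P} \<subseteq> {P\<in>paulis n. \<alpha> P \<noteq> 0 \<and> (Z \<subseteq> pauli_dom P \<or> pauli_dom P \<subseteq> Z)}"
    proof
      fix Q assume "Q \<in> {Q \<in> \<P>. \<forall>j<d. \<phi> j Q = \<phi> j P}"
      then have Q: "Q \<in> \<P>" "\<forall>j<d. \<phi> j Q = \<phi> j P" by auto
      then have Y: "?Y = set (take d (sites Q))" using img[OF Q(1)] by auto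
      \<comment> \<open>Either the slots of \<open>Q\<close> are \<open>d\<close> distinct sites of
        its support and fill \<open>Z\<close>, or they exhaust the support: the two alternatives of
        the expansion property.\<close>
      have "Z \<subseteq> pauli_dom Q \<or> pauli_dom Q \<subseteq> Z"
      proof (cases "d \<le> pauli_weight Q")
        case True
        then have "card ?Y = d" using card_img[of Q] Y by simp
        then have "?Y = Z" using Z finite_subset[OF Z(2)] by (intro card_subset_eq) auto
        then show ?thesis using Y set_take_subset[of d "sites Q"] len(2)[of Q] by simp
      next
        case False
        then have "take d (sites Q) = sites Q" by (simp add: len)
        then show ?thesis using Y Z(1) len(2)[of Q] by simp
      qed
      then show "Q \<in> {P\<in>paulis n. \<alpha> P \<noteq> 0 \<and> (Z \<subseteq> pauli_dom P \<or> pauli_dom P \<subseteq> Z)}"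
        using Q(1) by (auto simp: \<P>_def)
    qed
    then have "card {Q \<in> \<P>. \<forall>j<d. \<phi> j Q = \<phi> j P} \<le> card {P\<in>paulis n. \<alpha> P \<noteq> 0 \<and> (Z \<subseteq> pauli_dom P \<or> pauli_dom P \<subseteq> Z)}"
      by (intro card_mono) auto
    then show ?thesis using count[OF Z(2,3)] by linarith
  qed
  have slots: "(\<Sum>x\<in>\<phi> j ` \<P>. sqrt (\<Sum>P\<in>{P \<in> \<P>. \<phi> j P = x}. \<bar>\<alpha> P\<bar>\<^sup>2)) \<le> ?S" if "j < d" for j
  proof -
    have "(\<Sum>x\<in>\<phi> j ` \<P>. sqrt (\<Sum>P\<in>{P \<in> \<P>. \<phi> j P = x}. \<bar>\<alpha> P\<bar>\<^sup>2))
      \<le> (\<Sum>x\<in>\<phi> j ` \<P>. sqrt (\<Sum>P\<in>{P \<in> paulis n. x \<in> pauli_dom P}. (\<alpha> P)\<^sup>2))"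
    proof (intro sum_mono real_sqrt_le_mono)
      fix x
      have "(\<Sum>P\<in>{P \<in> \<P>. \<phi> j P = x}. \<bar>\<alpha> P\<bar>\<^sup>2) = (\<Sum>P\<in>{P \<in> \<P>. \<phi> j P = x}. (\<alpha> P)\<^sup>2)" by simp
      also have "\<dots> \<le> (\<Sum>P\<in>{P \<in> paulis n. x \<in> pauli_dom P}. (\<alpha> P)\<^sup>2)"
        by (rule sum_mono2) (use \<phi>_dom w(2) in auto)
      finally show "(\<Sum>P\<in>{P \<in> \<P>. \<phi> j P = x}. \<bar>\<alpha> P\<bar>\<^sup>2) \<le> (\<Sum>P\<in>{P \<in> paulis n. x \<in> pauli_dom P}. (\<alpha> P)\<^sup>2)" .
    qed
    also have "\<dots> \<le> ?S"
      unfolding site_norm_sum_def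
    proof (rule sum_mono2)
      show "\<phi> j ` \<P> \<subseteq> {..<n}" using \<phi>_dom pauli_dom_subset w(2) by blast
    qed (simp_all add: sum_nonneg)
    finally show ?thesis .
  qed
  have main: "(\<Sum>P\<in>\<P>. \<bar>\<alpha> P\<bar> powr (2 * real d / (real d + 1)))
    \<le> c powr (1 / (real d + 1)) * ?S powr (2 * real d / (real d + 1))"
    by (rule mixed_norm_inequality[where \<phi> = \<phi>]) (use d fib slots in \<open>auto simp: \<P>_def\<close>)
  have S0: "0 \<le> ?S" unfolding site_norm_sum_def by (intro sum_nonneg) (simp add: sum_nonneg)
  have r: "rexpo d > 0" using d by (simp add: rexpo_def)
  have "(\<Sum>P\<in>paulis n - {pauli_id n}. \<bar>\<alpha> P\<bar> powr rexpo d) = (\<Sum>P\<in>\<P>. \<bar>\<alpha> P\<bar> powr rexpo d)"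
    by (rule sum.mono_neutral_right) (auto simp: \<P>_def)
  then have "coeff_norm n \<alpha> (rexpo d) \<le> (c powr (1 / (real d + 1)) * ?S powr rexpo d) powr (1 / rexpo d)"
    using main r unfolding coeff_norm_def by (simp add: powr_mono2 sum_nonneg rexpo_def)
  \<comment> \<open>The exponent of \<open>c\<close> is (1 / (d + 1)) * ((d + 1) / (2 * d)) = 1 / (2
    * d).\<close>
  also have "\<dots> = c powr (1 / (2 * real d)) * ?S"
    using c S0 r d by (simp add: powr_mult powr_powr rexpo_def)
  finally show ?thesis .
qed

subsection \<open>Central differences\<close>

text \<open>The \<open>N\<close>-th finite difference annihilates polynomials of degree below
  \<open>N\<close>. By Pascal's rule it is, up to sign, the difference of order \<open>N - 1\<close>
  applied to a first difference, which lowers the degree.\<close>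

lemma alternating_binomial_power_sum:
  "s < N \<Longrightarrow> (\<Sum>i\<le>N. (-1) ^ i * real (N choose i) * (a + real i) ^ s) = 0"
proof (induction N arbitrary: s a)
  case (Suc N)
  let ?G = "\<lambda>N s a. \<Sum>i\<le>N. (-1) ^ i * real (N choose i) * (a + real i) ^ s"
  have "?G (Suc N) s a = (\<Sum>i\<le>Suc N. (-1) ^ i * real (N choose i) * (a + real i) ^ s)
      + (\<Sum>i\<le>Suc N. (-1) ^ i * real (if i = 0 then 0 else N choose (i - 1)) * (a + real i) ^ s)"
    unfolding sum.distrib[symmetric]
  proof (rule sum.cong[OF refl])
    fix i show "(-1) ^ i * real (Suc N choose i) * (a + real i) ^ s = (-1) ^ i * real (N choose i) * (a + real i) ^ s
      + (-1) ^ i * real (if i = 0 then 0 else N choose (i - 1)) * (a + real i) ^ s"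
      by (cases i) (simp_all add: algebra_simps)
  qed
  also have "(\<Sum>i\<le>Suc N. (-1) ^ i * real (N choose i) * (a + real i) ^ s) = ?G N s a"
    by (simp add: binomial_eq_0)
  also have "(\<Sum>i\<le>Suc N. (-1) ^ i * real (if i = 0 then 0 else N choose (i - 1)) * (a + real i) ^ s)
      = - (\<Sum>i\<le>N. (-1) ^ i * real (N choose i) * (a + real i + 1) ^ s)"
    by (subst sum.atMost_Suc_shift) (simp add: sum_negf[symmetric] add.assoc add.commute[of 1])
  finally have "?G (Suc N) s a = - (\<Sum>i\<le>N. (-1) ^ i * real (N choose i) * ((a + real i + 1) ^ s - (a + real i) ^ s))"
    by (simp add: sum_subtractf right_diff_distrib)
  also have "(\<Sum>i\<le>N. (-1) ^ i * real (N choose i) * ((a + real i + 1) ^ s - (a + real i) ^ s))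
    = (\<Sum>i\<le>N. \<Sum>r<s. real (s choose r) * ((-1) ^ i * real (N choose i) * (a + real i) ^ r))"
  proof (rule sum.cong[OF refl])
    fix i
    have "(a + real i + 1) ^ s = (\<Sum>r\<le>s. real (s choose r) * (a + real i) ^ r)"
      by (subst binomial_ring) simp
    also have "\<dots> = (\<Sum>r<s. real (s choose r) * (a + real i) ^ r) + (a + real i) ^ s"
      by (simp add: lessThan_Suc_atMost[symmetric])
    finally show "(-1) ^ i * real (N choose i) * ((a + real i + 1) ^ s - (a + real i) ^ s)
      = (\<Sum>r<s. real (s choose r) * ((-1) ^ i * real (N choose i) * (a + real i) ^ r))"
      by (simp add: sum_distrib_left algebra_simps)
  qed
  also have "\<dots> = (\<Sum>r<s. real (s choose r) * ?G N r a)"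
    by (subst sum.swap) (simp add: sum_distrib_left)
  also have "\<dots> = 0"
    using Suc.prems by (intro sum.neutral) (simp add: Suc.IH)
  finally show ?case by simp
qed simp

text \<open>The weights of the central difference quotient with \<open>2 * m + 1\<close> nodes, which is exact on
  polynomials of degree at most \<open>2 * m\<close>; the node \<open>i\<close> stands for \<open>i - m\<close>.\<close>

definition diff_weight :: "nat \<Rightarrow> nat \<Rightarrow> real" where
  "diff_weight m i = (if i = m then 0 else
     - ((-1) ^ i * (-1) ^ m * real (2 * m choose i)) / ((real i - real m) * real (2 * m choose m)))"

text \<open>For s = 0 the weights are antisymmetric about \<open>m\<close>. For s = r + 1 the factor
  \<open>i - m\<close> cancels the denominator and leaves an alternating binomial sum, which
  vanishes; the node \<open>i = m\<close>, where the weight is 0 instead, accounts for the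
  correction \<open>0 ^ r\<close>, which is 1 exactly for s = 1.\<close>

lemma diff_weight_power:
  assumes "s \<le> 2 * m" "m \<ge> 1"
  shows "(\<Sum>i\<le>2 * m. diff_weight m i * (real i - real m) ^ s) = (if s = 1 then 1 else 0)"
proof (cases s)
  case 0
  have "(\<Sum>i\<le>2 * m. diff_weight m i) = (\<Sum>i\<le>2 * m. diff_weight m (2 * m - i))"
    by (rule sum.reindex_bij_witness[of _ "\<lambda>i. 2 * m - i" "\<lambda>i. 2 * m - i"]) auto
  also have "\<dots> = (\<Sum>i\<le>2 * m. - diff_weight m i)"
  proof (rule sum.cong[OF refl])
    fix i assume "i \<in> {..2 * m}"
    then have i: "i \<le> 2 * m" by simp
    have "(-1 :: real) ^ (2 * m - i) = (-1) ^ i"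
      using i by (simp add: minus_one_power_iff)
    moreover have "real (2 * m - i) - real m = - (real i - real m)" using i by (simp add: of_nat_diff)
    moreover have "(2 * m - i = m) = (i = m)" using i by auto
    ultimately show "diff_weight m (2 * m - i) = - diff_weight m i"
      unfolding diff_weight_def binomial_symmetric[OF i, symmetric]
      by (simp only: mult_minus_left divide_minus_right minus_minus split: if_split) simp
  qed
  finally show ?thesis using 0 by (simp add: sum_negf)
next
  case (Suc r)
  let ?c = "- ((-1) ^ m) / real (2 * m choose m)"
  have pos: "real (2 * m choose m) > 0" by simp
  have "(\<Sum>i\<le>2 * m. diff_weight m i * (real i - real m) ^ s)
    = (\<Sum>i\<le>2 * m. ?c * ((-1) ^ i * real (2 * m choose i) * (- real m + real i) ^ r) +
        (if i = m then 0 ^ r else 0))"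
  proof (rule sum.cong[OF refl])
    fix i
    show "diff_weight m i * (real i - real m) ^ s = ?c * ((-1) ^ i * real (2 * m choose i) * (- real m + real i) ^ r) +
        (if i = m then 0 ^ r else 0)"
    proof (cases "i = m")
      case True
      have "((-1) ^ m * (-1) ^ m :: real) = 1" by (simp add: power_add[symmetric] mult_2[symmetric])
      then show ?thesis using True pos Suc by (simp add: diff_weight_def)
    next
      case False
      have "- real m + real i = real i - real m" by simp
      then show ?thesis using False Suc pos by (simp add: diff_weight_def)
    qed
  qed
  also have "\<dots> = ?c * (\<Sum>i\<le>2 * m. (-1) ^ i * real (2 * m choose i) * (- real m + real i) ^ r) + 0 ^ r"
    unfolding sum.distrib sum_distrib_left[symmetric] by simp
  also have "(\<Sum>i\<le>2 * m. (-1) ^ i * real (2 * m choose i) * (- real m + real i) ^ r) = 0"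
    by (rule alternating_binomial_power_sum) (use assms Suc in simp)
  finally show ?thesis using Suc by (cases r) simp_all
qed

text \<open>Off the centre the binomial quotient is at most m / (m + 1). The two neighbours of
  \<open>m\<close> have distance 1 and the other 2m - 2 nodes at least 2, which adds up to m / (m +
  1) * (2 + (m - 1)) = m.\<close>

lemma diff_weight_abs_sum: "m \<ge> 1 \<Longrightarrow> (\<Sum>i\<le>2 * m. \<bar>diff_weight m i\<bar>) \<le> real m"
proof -
  assume m: "m \<ge> 1"
  let ?C = "real (2 * m choose m)"
  have C: "?C > 0" by simp
  \<comment> \<open>By symmetry and monotonicity the largest coefficient off the centre is the one
    at m - 1, which is m / (m + 1) times the central one.\<close>
  have le: "real (2 * m choose i) \<le> real m / real (Suc m) * ?C" if "i \<noteq> m" "i \<le> 2 * m" for i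
  proof -
    have key: "real (2 * m choose i) \<le> real m / real (Suc m) * ?C" if "i < m" for i
    proof -
      have "2 * m choose i \<le> 2 * m choose (m - 1)"
        using that by (intro binomial_mono) auto
      then have "real (Suc m) * real (2 * m choose i) \<le> real (Suc m) * real (2 * m choose (m - 1))"
        by (intro mult_left_mono) simp_all
      also have "real (Suc m) * real (2 * m choose (m - 1)) = real m * ?C"
      proof -
        have "m * (2 * m choose m) = (2 * m - (m - 1)) * (2 * m choose (m - 1))"
          using binomial_absorb_comp[of "2 * m" "m - 1"] times_binomial_minus1_eq[of m "2 * m"] m
          by (simp add: mult_ac)
        moreover have "2 * m - (m - 1) = Suc m" using m by simp
        ultimately show ?thesis by (metis of_nat_mult)
      qed
      finally show ?thesis by (simp add: pos_le_divide_eq mult.commute del: of_nat_Suc)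
    qed
    show ?thesis
    proof (cases "i < m")
      case False
      then have "2 * m - i < m" using that by simp
      from key[OF this] show ?thesis using binomial_symmetric[OF that(2)] by simp
    qed (rule key)
  qed
  have bound: "\<bar>diff_weight m i\<bar> \<le> real m / real (Suc m) * (1 / \<bar>real i - real m\<bar>)" if "i \<le> 2 * m" "i \<noteq> m" for i
  proof -
    have "\<bar>diff_weight m i\<bar> = real (2 * m choose i) / ?C * (1 / \<bar>real i - real m\<bar>)"
      using that by (simp add: diff_weight_def abs_mult power_abs)
    also have "\<dots> \<le> real m / real (Suc m) * (1 / \<bar>real i - real m\<bar>)"
      using le[OF that(2,1)] C by (intro mult_right_mono) (simp_all add: field_simps)
    finally show ?thesis .
  qed
  have b1: "\<bar>diff_weight m i\<bar> \<le> real m / real (Suc m) * (if i = m then 0 else if i = m - 1 \<or> i = m + 1 then 1 else 1 / 2)"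
    if "i \<le> 2 * m" for i
  proof (cases "i = m")
    case False
    have "1 / \<bar>real i - real m\<bar> \<le> (if i = m - 1 \<or> i = m + 1 then 1 else 1 / 2)"
    proof (cases "i = m - 1 \<or> i = m + 1")
      case True
      then have "\<bar>real i - real m\<bar> = 1" using m by (auto simp: of_nat_diff)
      then show ?thesis using True by simp
    next
      case far: False
      then have "i + 2 \<le> m \<or> m + 2 \<le> i" using False by auto
      then have "2 \<le> \<bar>real i - real m\<bar>" by auto
      then have "1 / \<bar>real i - real m\<bar> \<le> 1 / 2" by (intro divide_left_mono) auto
      then show ?thesis using far by simp
    qed
    then have "real m / real (Suc m) * (1 / \<bar>real i - real m\<bar>)
      \<le> real m / real (Suc m) * (if i = m - 1 \<or> i = m + 1 then 1 else 1 / 2)"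
      by (intro mult_left_mono) simp_all
    then show ?thesis using bound[OF that False] False by (simp only: if_False)
  qed (simp add: diff_weight_def)
  have "(\<Sum>i\<le>2 * m. \<bar>diff_weight m i\<bar>)
    \<le> (\<Sum>i\<le>2 * m. real m / real (Suc m) * (if i = m then 0 else if i = m - 1 \<or> i = m + 1 then 1 else 1 / 2))"
    by (rule sum_mono) (use b1 in auto)
  also have "\<dots> = real m / real (Suc m) * (\<Sum>i\<le>2 * m. 1 / 2 + (if i = m then - 1 / 2 else 0) +
      (if i = m - 1 then 1 / 2 else 0) + (if i = m + 1 then 1 / 2 else 0))"
    unfolding sum_distrib_left using m by (intro sum.cong) auto
  also have "\<dots> = real m / real (Suc m) * (real (2 * m + 1) / 2 - 1 / 2 + 1 / 2 + 1 / 2)"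
    using m by (simp add: sum.distrib)
  also have "\<dots> = real m" using m by (simp add: field_simps)
  finally show ?thesis .
qed

lemma poly_altdef_le:
  fixes p :: "real poly"
  assumes "degree p \<le> N"
  shows "poly p x = (\<Sum>s\<le>N. coeff p s * x ^ s)"
  unfolding poly_altdef by (rule sum.mono_neutral_left) (use assms in \<open>auto simp: coeff_eq_0\<close>)

text \<open>One factor \<open>m\<close> bounds the absolute sum of the difference weights, the other
  comes from the spacing 1 / m of the nodes.\<close>

lemma linear_coeff_bound:
  fixes p :: "real poly"
  assumes m: "m \<ge> 1" and deg: "degree p \<le> 2 * m"
    and M: "\<And>i. i \<le> 2 * m \<Longrightarrow> \<bar>poly p ((real i - real m) / real m)\<bar> \<le> M"
  shows "\<bar>coeff p 1\<bar> \<le> (real m)\<^sup>2 * M"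
proof -
  have "(\<Sum>i\<le>2 * m. diff_weight m i * poly p ((real i - real m) / real m))
    = (\<Sum>i\<le>2 * m. \<Sum>s\<le>2 * m. coeff p s / real m ^ s * (diff_weight m i * (real i - real m) ^ s))"
  proof (rule sum.cong[OF refl])
    fix i
    show "diff_weight m i * poly p ((real i - real m) / real m)
      = (\<Sum>s\<le>2 * m. coeff p s / real m ^ s * (diff_weight m i * (real i - real m) ^ s))"
      unfolding poly_altdef_le[OF deg] sum_distrib_left
      by (intro sum.cong) (simp_all add: power_divide)
  qed
  also have "\<dots> = (\<Sum>s\<le>2 * m. coeff p s / real m ^ s * (\<Sum>i\<le>2 * m. diff_weight m i * (real i - real m) ^ s))"
    by (subst sum.swap) (simp add: sum_distrib_left)
  also have "\<dots> = (\<Sum>s\<le>2 * m. if s = 1 then coeff p 1 / real m else 0)"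
    using m by (intro sum.cong) (auto simp: diff_weight_power)
  also have "\<dots> = coeff p 1 / real m" using m by simp
  finally have eq: "coeff p 1 = real m * (\<Sum>i\<le>2 * m. diff_weight m i * poly p ((real i - real m) / real m))"
    using m by simp
  have M0: "0 \<le> M" using M[of 0] by linarith
  have "\<bar>\<Sum>i\<le>2 * m. diff_weight m i * poly p ((real i - real m) / real m)\<bar> \<le> (\<Sum>i\<le>2 * m. \<bar>diff_weight m i\<bar> * M)"
    by (rule order_trans[OF sum_abs]) (auto intro!: sum_mono mult_left_mono M simp: abs_mult)
  also have "\<dots> \<le> real m * M"
    unfolding sum_distrib_right[symmetric] by (rule mult_right_mono[OF diff_weight_abs_sum[OF m] M0])
  finally show ?thesis unfolding eq using m by (simp add: abs_mult power2_eq_square mult.assoc mult_left_mono)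
qed

subsection \<open>Product states and Haar random states\<close>

lemma bit_set_top: "x < 2 ^ n \<Longrightarrow> \<not> bit (x :: nat) n"
  by (simp add: bit_iff_odd)

text \<open>The numbers below \<open>2 ^ n\<close> run through all bit patterns, so distributivity
  applies; the induction splits off the top bit.\<close>

lemma sum_bits_prod:
  fixes f :: "nat \<Rightarrow> bool \<Rightarrow> 'a :: comm_semiring_1"
  shows "(\<Sum>x<(2::nat) ^ n. \<Prod>i<n. f i (bit x i)) = (\<Prod>i<n. f i False + f i True)"
proof (induction n)
  case (Suc n)
  have "{..<2 ^ Suc n} = {..<2 ^ n} \<union> (\<lambda>x. x + 2 ^ n) ` {..<2 ^ n :: nat}"
  proof -
    have "x \<in> (\<lambda>x. x + 2 ^ n) ` {..<2 ^ n}" if "x < 2 ^ Suc n" "\<not> x < 2 ^ n" for x :: nat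
      using that by (intro image_eqI[of _ _ "x - 2 ^ n"]) auto
    then show ?thesis by auto
  qed
  then have "(\<Sum>x<(2::nat) ^ Suc n. \<Prod>i<Suc n. f i (bit x i)) =
    (\<Sum>x<(2::nat) ^ n. \<Prod>i<Suc n. f i (bit x i)) + (\<Sum>x\<in>(\<lambda>x. x + 2 ^ n) ` {..<(2::nat) ^ n}. \<Prod>i<Suc n. f i (bit x i))"
    by (simp only:) (rule sum.union_disjoint, auto)
  also have "(\<Sum>x\<in>(\<lambda>x. x + 2 ^ n) ` {..<(2::nat) ^ n}. \<Prod>i<Suc n. f i (bit x i))
    = (\<Sum>x<(2::nat) ^ n. \<Prod>i<Suc n. f i (bit (x + 2 ^ n) i))"
    by (subst sum.reindex) (auto intro: inj_onI)
  also have "\<dots> = (\<Sum>x<(2::nat) ^ n. (\<Prod>i<n. f i (bit x i)) * f n True)"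
  proof (rule sum.cong[OF refl])
    fix x :: nat assume "x \<in> {..<2 ^ n}"
    then have x: "x < 2 ^ n" by simp
    have "bit (x + 2 ^ n) i = bit x i" if "i < n" for i
    proof -
      have "x + 2 ^ n = x + 2 ^ (n - i) * 2 ^ i" using that by (simp add: power_add[symmetric])
      then have "(x + 2 ^ n) div 2 ^ i = 2 ^ (n - i) + x div 2 ^ i" by simp
      moreover have "even (2 ^ (n - i) :: nat)" using that by simp
      ultimately show ?thesis by (simp add: bit_iff_odd)
    qed
    moreover have "bit (x + 2 ^ n) n" using x by (simp add: bit_iff_odd)
    ultimately show "(\<Prod>i<Suc n. f i (bit (x + 2 ^ n) i)) = (\<Prod>i<n. f i (bit x i)) * f n True" by simp
  qed
  also have "(\<Sum>x<(2::nat) ^ n. \<Prod>i<Suc n. f i (bit x i)) = (\<Sum>x<(2::nat) ^ n. (\<Prod>i<n. f i (bit x i)) * f n False)"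
    by (rule sum.cong) (simp_all add: bit_set_top)
  finally have "(\<Sum>x<(2::nat) ^ Suc n. \<Prod>i<Suc n. f i (bit x i))
      = (\<Prod>i<n. f i False + f i True) * f n False + (\<Prod>i<n. f i False + f i True) * f n True"
    by (simp only: sum_distrib_right[symmetric] Suc.IH)
  then show ?case by (simp only: prod.lessThan_Suc distrib_left)
qed simp

definition amplitude :: "qubit \<Rightarrow> bool \<Rightarrow> complex" where
  "amplitude q b = (if b then snd q else fst q)"

definition pauli_mean :: "qubit \<Rightarrow> pauli \<Rightarrow> complex" where
  "pauli_mean q p = (\<Sum>a\<in>UNIV. \<Sum>b\<in>UNIV. cnj (amplitude q a) * pauli_entry p a b * amplitude q b)"

lemma pauli_product_mean:
  assumes "length P = n"
  shows "(\<Sum>x<(2::nat) ^ n. \<Sum>y<(2::nat) ^ n. cnj (product_state n q x) * pauli_op P x y * product_state n q y)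
    = (\<Prod>i<n. pauli_mean (q i) (P ! i))"
proof -
  have "(\<Sum>x<(2::nat) ^ n. \<Sum>y<(2::nat) ^ n. cnj (product_state n q x) * pauli_op P x y * product_state n q y)
    = (\<Sum>x<(2::nat) ^ n. \<Sum>y<(2::nat) ^ n. \<Prod>i<n. cnj (amplitude (q i) (bit x i)) * pauli_entry (P ! i) (bit x i) (bit y i) * amplitude (q i) (bit y i))"
    by (simp add: product_state_def pauli_op_def assms prod.distrib amplitude_def)
  also have "\<dots> = (\<Sum>x<(2::nat) ^ n. \<Prod>i<n. \<Sum>b\<in>UNIV. cnj (amplitude (q i) (bit x i)) * pauli_entry (P ! i) (bit x i) b * amplitude (q i) b)"
    by (rule sum.cong[OF refl], subst sum_bits_prod) (simp add: UNIV_bool add.commute)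
  also have "\<dots> = (\<Prod>i<n. pauli_mean (q i) (P ! i))"
    by (subst sum_bits_prod[where f = "\<lambda>i a. \<Sum>b\<in>UNIV. cnj (amplitude (q i) a) * pauli_entry (P ! i) a b * amplitude (q i) b"])
      (simp add: pauli_mean_def UNIV_bool add.commute)
  finally show ?thesis .
qed

lemma expval_hamiltonian:
  "expval n (hamiltonian n \<alpha>) \<phi> = (\<Sum>P\<in>paulis n. \<alpha> P * expval n (pauli_op P) \<phi>)"
proof -
  have "(\<Sum>x<2 ^ n. \<Sum>y<2 ^ n. cnj (\<phi> x) * hamiltonian n \<alpha> x y * \<phi> y)
    = (\<Sum>x<2 ^ n. \<Sum>y<2 ^ n. \<Sum>P\<in>paulis n. complex_of_real (\<alpha> P) * (cnj (\<phi> x) * pauli_op P x y * \<phi> y))"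
    by (simp add: hamiltonian_def sum_distrib_left sum_distrib_right mult_ac)
  also have "\<dots> = (\<Sum>P\<in>paulis n. complex_of_real (\<alpha> P) * (\<Sum>x<2 ^ n. \<Sum>y<2 ^ n. cnj (\<phi> x) * pauli_op P x y * \<phi> y))"
    by (simp add: sum.swap[of _ "paulis n"] sum_distrib_left)
  finally show ?thesis by (simp add: expval_def)
qed

lemma measurable_apply_op:
  assumes "sets \<mu> = sets (PiM {..<N} (\<lambda>_. borel :: complex measure))"
  shows "apply_op N U \<in> measurable \<mu> \<mu>"
proof -
  have "(\<lambda>\<phi>. \<lambda>x\<in>{..<N}. \<Sum>y<N. U x y * \<phi> y) \<in> measurable (PiM {..<N} (\<lambda>_. borel)) (PiM {..<N} (\<lambda>_. borel))"
    by (intro measurable_restrict borel_measurable_sum borel_measurable_times borel_measurable_const)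
      (auto intro: measurable_component_singleton)
  then show ?thesis unfolding apply_op_def[abs_def] using measurable_cong_sets[OF assms assms] by simp
qed

section \<open>Second moments of the Haar distribution\<close>

context
  fixes n :: nat and \<mu> :: "(nat \<Rightarrow> complex) measure"
  assumes haar: "haar_state_measure n \<mu>"
begin

lemma haar_sets: "sets \<mu> = sets (PiM {..<2 ^ n} (\<lambda>_. borel))"
  using haar by (simp add: haar_state_measure_def)

lemma haar_component: "x < 2 ^ n \<Longrightarrow> (\<lambda>\<phi>. \<phi> x) \<in> borel_measurable \<mu>"
proof -
  assume "x < 2 ^ n"
  then have "(\<lambda>\<phi>. \<phi> x) \<in> measurable (PiM {..<2 ^ n} (\<lambda>_. borel :: complex measure)) borel"
    by (intro measurable_component_singleton) simp
  then show ?thesis unfolding measurable_cong_sets[OF haar_sets refl] .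
qed

lemma haar_unit: "AE \<phi> in \<mu>. (\<Sum>x<2 ^ n. (cmod (\<phi> x))\<^sup>2) = 1"
  using haar by (simp add: haar_state_measure_def)

lemma haar_prob: "prob_space \<mu>"
  using haar by (simp add: haar_state_measure_def)

lemma haar_integrable:
  assumes "x < 2 ^ n" "y < 2 ^ n"
  shows "integrable \<mu> (\<lambda>\<phi>. cnj (\<phi> x) * \<phi> y)"
proof -
  interpret prob_space \<mu> by (rule haar_prob)
  show ?thesis
  proof (rule integrable_const_bound[of _ 1])
    show "AE \<phi> in \<mu>. norm (cnj (\<phi> x) * \<phi> y) \<le> 1"
      using haar_unit
    proof eventually_elim
      case (elim \<phi>)
      have le: "cmod (\<phi> z) \<le> 1" if "z < 2 ^ n" for z
      proof -
        have "(cmod (\<phi> z))\<^sup>2 \<le> (\<Sum>x<2 ^ n. (cmod (\<phi> x))\<^sup>2)"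
          by (rule member_le_sum) (use that in auto)
        then show ?thesis using elim by (simp add: power_le_one_iff abs_square_le_1)
      qed
      show ?case using mult_mono[OF le[OF assms(1)] le[OF assms(2)]] by (simp add: norm_mult)
    qed
    have [measurable]: "(\<lambda>\<phi>. \<phi> x) \<in> borel_measurable \<mu>" "(\<lambda>\<phi>. \<phi> y) \<in> borel_measurable \<mu>"
      using haar_component assms by auto
    have "continuous_on UNIV (cnj :: complex \<Rightarrow> complex)" by (intro continuous_intros)
    then have [measurable]: "(cnj :: complex \<Rightarrow> complex) \<in> borel_measurable borel"
      by (rule borel_measurable_continuous_onI)
    show "(\<lambda>\<phi>. cnj (\<phi> x) * \<phi> y) \<in> borel_measurable \<mu>" by measurable
  qed
qed

lemma haar_invariant:
  assumes "unitary (2 ^ n) U" "x < 2 ^ n" "y < 2 ^ n"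
  shows "(\<integral>\<phi>. cnj (\<phi> x) * \<phi> y \<partial>\<mu>)
    = (\<integral>\<phi>. cnj (apply_op (2 ^ n) U \<phi> x) * apply_op (2 ^ n) U \<phi> y \<partial>\<mu>)"
proof -
  have m: "apply_op (2 ^ n) U \<in> measurable \<mu> \<mu>" by (rule measurable_apply_op[OF haar_sets])
  have "(\<integral>\<phi>. cnj (\<phi> x) * \<phi> y \<partial>\<mu>) = (\<integral>\<phi>. cnj (\<phi> x) * \<phi> y \<partial>(distr \<mu> \<mu> (apply_op (2 ^ n) U)))"
    using haar assms(1) by (simp add: haar_state_measure_def)
  also have "\<dots> = (\<integral>\<phi>. cnj (apply_op (2 ^ n) U \<phi> x) * apply_op (2 ^ n) U \<phi> y \<partial>\<mu>)"
    by (rule integral_distr[OF m borel_measurable_integrable[OF haar_integrable[OF assms(2,3)]]])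
  finally show ?thesis .
qed

text \<open>The diagonal unitary that changes the sign of coordinate \<open>x\<close> turns the
  integral into its negative.\<close>

lemma haar_off_diagonal:
  assumes "x < 2 ^ n" "y < 2 ^ n" "x \<noteq> y"
  shows "(\<integral>\<phi>. cnj (\<phi> x) * \<phi> y \<partial>\<mu>) = 0"
proof -
  define U :: "nat \<Rightarrow> nat \<Rightarrow> complex" where "U = (\<lambda>a b. if a = b then (if a = x then -1 else 1) else 0)"
  have ap: "apply_op (2 ^ n) U \<phi> a = (if a = x then - \<phi> a else \<phi> a)" if "a < 2 ^ n" for \<phi> a
  proof -
    have "(\<Sum>b<2 ^ n. U a b * \<phi> b) = (\<Sum>b<2 ^ n. if b = a then (if a = x then - \<phi> a else \<phi> a) else 0)"
      by (rule sum.cong) (auto simp: U_def)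
    then show ?thesis using that by (simp add: apply_op_def)
  qed
  have "unitary (2 ^ n) U"
    unfolding unitary_def
  proof (intro allI impI)
    fix a b :: nat assume "a < 2 ^ n" "b < 2 ^ n"
    have "(\<Sum>z<2 ^ n. cnj (U z a) * U z b) = (\<Sum>z<2 ^ n. if z = a then (if a = b then 1 else 0) else 0)"
      by (rule sum.cong) (auto simp: U_def)
    then show "(\<Sum>z<2 ^ n. cnj (U z a) * U z b) = (if a = b then 1 else 0)" using \<open>a < 2 ^ n\<close> by simp
  qed
  from haar_invariant[OF this assms(1,2)]
  have "(\<integral>\<phi>. cnj (\<phi> x) * \<phi> y \<partial>\<mu>) = - (\<integral>\<phi>. cnj (\<phi> x) * \<phi> y \<partial>\<mu>)"
    using assms by (simp add: ap)
  then show ?thesis by (simp add: eq_neg_iff_add_eq_0)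
qed

text \<open>Invariance under the permutation that exchanges the basis states \<open>x\<close> and
  \<open>y\<close>.\<close>

lemma haar_diagonal_eq:
  assumes "x < 2 ^ n" "y < 2 ^ n"
  shows "(\<integral>\<phi>. cnj (\<phi> x) * \<phi> x \<partial>\<mu>) = (\<integral>\<phi>. cnj (\<phi> y) * \<phi> y \<partial>\<mu>)"
proof -
  define \<pi> where "\<pi> = (\<lambda>a. if a = x then y else if a = y then x else a)"
  define U :: "nat \<Rightarrow> nat \<Rightarrow> complex" where "U = (\<lambda>a b. if b = \<pi> a then 1 else 0)"
  have \<pi>: "\<pi> a < 2 ^ n" if "a < 2 ^ n" for a using that assms by (simp add: \<pi>_def)
  have inv: "\<pi> (\<pi> a) = a" for a by (auto simp: \<pi>_def)
  have ap: "apply_op (2 ^ n) U \<phi> a = \<phi> (\<pi> a)" if "a < 2 ^ n" for \<phi> a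
  proof -
    have "(\<Sum>b<2 ^ n. U a b * \<phi> b) = (\<Sum>b<2 ^ n. if b = \<pi> a then \<phi> b else 0)"
      by (rule sum.cong) (auto simp: U_def)
    then show ?thesis using that \<pi> by (simp add: apply_op_def)
  qed
  have "unitary (2 ^ n) U"
    unfolding unitary_def
  proof (intro allI impI)
    fix a b :: nat assume "a < 2 ^ n" "b < 2 ^ n"
    have "(\<Sum>z<2 ^ n. cnj (U z a) * U z b) = (\<Sum>z<2 ^ n. if z = \<pi> a then (if a = b then 1 else 0) else 0)"
      by (rule sum.cong) (auto simp: U_def inv)
    then show "(\<Sum>z<2 ^ n. cnj (U z a) * U z b) = (if a = b then 1 else 0)" using \<open>a < 2 ^ n\<close> \<pi> by simp
  qed
  from haar_invariant[OF this assms(1,1)] show ?thesis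
    using assms by (simp add: ap \<pi>_def)
qed

text \<open>The 2^n diagonal moments are equal and sum to the squared norm 1.\<close>

lemma haar_diagonal:
  assumes "x < 2 ^ n"
  shows "(\<integral>\<phi>. cnj (\<phi> x) * \<phi> x \<partial>\<mu>) = 1 / 2 ^ n"
proof -
  interpret prob_space \<mu> by (rule haar_prob)
  have "(\<Sum>y<2 ^ n. \<integral>\<phi>. cnj (\<phi> y) * \<phi> y \<partial>\<mu>) = (\<integral>\<phi>. (\<Sum>y<2 ^ n. cnj (\<phi> y) * \<phi> y) \<partial>\<mu>)"
    by (rule Bochner_Integration.integral_sum[symmetric]) (use haar_integrable in auto)
  also have "\<dots> = (\<integral>\<phi>. 1 \<partial>\<mu>)"
  proof (rule integral_cong_AE)
    show "(\<lambda>\<phi>. \<Sum>y<2 ^ n. cnj (\<phi> y) * \<phi> y) \<in> borel_measurable \<mu>"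
      using haar_integrable by (intro borel_measurable_sum borel_measurable_integrable) auto
    show "AE \<phi> in \<mu>. (\<Sum>y<2 ^ n. cnj (\<phi> y) * \<phi> y) = 1"
      using haar_unit
    proof eventually_elim
      case (elim \<phi>)
      have "(\<Sum>y<2 ^ n. cnj (\<phi> y) * \<phi> y) = (\<Sum>y<2 ^ n. complex_of_real ((cmod (\<phi> y))\<^sup>2))"
        by (rule sum.cong) (simp_all only: complex_norm_square mult.commute)
      then show ?case using elim by (metis of_real_1 of_real_sum)
    qed
  qed simp
  also have "\<dots> = 1" by (simp add: prob_space)
  also have "(\<Sum>y<2 ^ n. \<integral>\<phi>. cnj (\<phi> y) * \<phi> y \<partial>\<mu>) = (\<Sum>y<2 ^ n::nat. \<integral>\<phi>. cnj (\<phi> x) * \<phi> x \<partial>\<mu>)"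
    by (rule sum.cong[OF refl], rule haar_diagonal_eq) (use assms in simp_all)
  finally show ?thesis by (simp add: field_simps)
qed

lemma haar_expval:
  "(\<integral>\<phi>. expval n A \<phi> \<partial>\<mu>) = Re (\<Sum>x<2 ^ n. A x x) / 2 ^ n"
proof -
  have int: "integrable \<mu> (\<lambda>\<phi>. cnj (\<phi> x) * A x y * \<phi> y)" if "x < 2 ^ n" "y < 2 ^ n" for x y
    using integrable_mult_right[OF haar_integrable[OF that], of "A x y"] by (simp add: mult_ac)
  have "(\<integral>\<phi>. expval n A \<phi> \<partial>\<mu>) = Re (\<integral>\<phi>. (\<Sum>x<2 ^ n. \<Sum>y<2 ^ n. cnj (\<phi> x) * A x y * \<phi> y) \<partial>\<mu>)"
    unfolding expval_def by (rule integral_Re) (intro Bochner_Integration.integrable_sum, use int in auto)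
  also have "(\<integral>\<phi>. (\<Sum>x<2 ^ n. \<Sum>y<2 ^ n. cnj (\<phi> x) * A x y * \<phi> y) \<partial>\<mu>)
    = (\<Sum>x<2 ^ n. \<Sum>y<2 ^ n. \<integral>\<phi>. cnj (\<phi> x) * A x y * \<phi> y \<partial>\<mu>)"
    using int by (subst Bochner_Integration.integral_sum) (auto intro!: Bochner_Integration.integrable_sum sum.cong Bochner_Integration.integral_sum)
  also have "\<dots> = (\<Sum>x<2 ^ n. \<Sum>y<2 ^ n. if y = x then A x x / 2 ^ n else 0)"
  proof (intro sum.cong refl)
    fix x y :: nat assume "x \<in> {..<2 ^ n}" "y \<in> {..<2 ^ n}"
    then have xy: "x < 2 ^ n" "y < 2 ^ n" by auto
    have "(\<integral>\<phi>. cnj (\<phi> x) * A x y * \<phi> y \<partial>\<mu>) = (\<integral>\<phi>. A x y * (cnj (\<phi> x) * \<phi> y) \<partial>\<mu>)"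
      by (simp add: mult_ac)
    also have "\<dots> = A x y * (\<integral>\<phi>. cnj (\<phi> x) * \<phi> y \<partial>\<mu>)"
      by (rule integral_mult_right_zero)
    finally show "(\<integral>\<phi>. cnj (\<phi> x) * A x y * \<phi> y \<partial>\<mu>) = (if y = x then A x x / 2 ^ n else 0)"
      using haar_off_diagonal[OF xy] haar_diagonal[OF xy(1)] by auto
  qed
  also have "\<dots> = (\<Sum>x<2 ^ n. A x x) / 2 ^ n" by (simp add: sum_divide_distrib)
  also have "Re ((\<Sum>x<2 ^ n. A x x) / 2 ^ n) = Re (\<Sum>x<2 ^ n. A x x) / 2 ^ n"
    using Re_divide_of_real[of "\<Sum>x<2 ^ n. A x x" "2 ^ n"] by simp
  finally show ?thesis .
qed

end

lemma pauli_trace: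
  assumes "P \<in> paulis n"
  shows "(\<Sum>x<2 ^ n. pauli_op P x x) = (if P = pauli_id n then 2 ^ n else 0)"
proof -
  have len: "length P = n" using assms by (simp add: paulis_def)
  have "(\<Sum>x<2 ^ n. pauli_op P x x) = (\<Prod>i<n. pauli_entry (P ! i) False False + pauli_entry (P ! i) True True)"
    unfolding pauli_op_def len by (rule sum_bits_prod)
  also have "\<dots> = (\<Prod>i<n. if P ! i = PI then 2 else 0)"
    by (rule prod.cong[OF refl]) (metis (full_types) add.right_neutral add.right_inverse one_add_one pauli.exhaust pauli_entry.simps pauli.distinct)
  also have "\<dots> = (if P = pauli_id n then 2 ^ n else 0)"
  proof (cases "P = pauli_id n")
    case False
    then obtain i where "i < n" "P ! i \<noteq> PI" using len
      by (metis length_replicate nth_equalityI nth_replicate pauli_id_def)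
    then show ?thesis using False by (auto intro!: prod_zero)
  qed (simp add: pauli_id_def)
  finally show ?thesis .
qed

lemma pauli_id_in_paulis: "pauli_id n \<in> paulis n"
  by (simp add: paulis_def pauli_id_def)

text \<open>The Haar mean is the normalised trace, and among the Pauli observables only the identity
  has a nonzero one.\<close>

lemma haar_hamiltonian:
  assumes "haar_state_measure n \<mu>" "finite (paulis n)"
  shows "(\<integral>\<phi>. expval n (hamiltonian n \<alpha>) \<phi> \<partial>\<mu>) = \<alpha> (pauli_id n)"
proof -
  have "(\<Sum>x<2 ^ n. hamiltonian n \<alpha> x x) = (\<Sum>P\<in>paulis n. complex_of_real (\<alpha> P) * (\<Sum>x<2 ^ n. pauli_op P x x))"
    unfolding hamiltonian_def by (subst sum.swap) (simp add: sum_distrib_left)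
  also have "\<dots> = (\<Sum>P\<in>paulis n. if P = pauli_id n then complex_of_real (\<alpha> P) * 2 ^ n else 0)"
    by (rule sum.cong) (simp_all add: pauli_trace)
  also have "\<dots> = complex_of_real (\<alpha> (pauli_id n) * 2 ^ n)"
    using assms(2) pauli_id_in_paulis by simp
  finally show ?thesis unfolding haar_expval[OF assms(1)] by (simp only: Re_complex_of_real) simp
qed

subsection \<open>The preparation phase\<close>

definition prepare_prog :: com where
  "prepare_prog = table_prog ;; build_prog ;; merge_prog ;; sign_prog ;; scan_prog"

lemma phase_writes:
  "int_writes table_prog = {''B'', ''step'', ''idx'', ''j'', ''acc'', ''y'', ''tab''}" "real_writes table_prog = {}"
  "int_writes build_prog = {''o'', ''j'', ''e'', ''m'', ''y'', ''c'', ''x'', ''row'', ''l'', ''seen'', ''par'', ''root'', ''nxt'', ''head'', ''u''}"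
  "real_writes build_prog = {''al'', ''ca'', ''wt'', ''wgt'', ''beta'', ''V'', ''W''}"
  "int_writes merge_prog = {''c'', ''y''}" "real_writes merge_prog = {''K'', ''W'', ''T'', ''v'', ''beta''}"
  "int_writes sign_prog = {''y''}" "real_writes sign_prog = {''sg''}"
  "int_writes scan_prog = {''q'', ''o'', ''e'', ''j''}"
  "real_writes scan_prog = {''best'', ''tb'', ''pr'', ''val'', ''t''}"
  by (simp_all add: table_prog_def table_init_def table_row_def table_cell_def build_prog_def term_prog_def
      term_init_def path_prog_writes merge_prog_def layer_writes sign_prog_def scan_writes scan_prog_def insert_commute)

lemma prepare_writes:
  "int_writes prepare_prog \<inter> {''i'', ''n''} = {}"
  "real_writes prepare_prog \<inter> {''im0''} = {}"
  by (simp_all add: prepare_prog_def phase_writes)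

text \<open>The coefficient of degree 1 is the product rule at 0: each summand takes the slope of
  one factor and the constants of the others; distinctness lets \<open>filter\<close> remove exactly
  that factor.\<close>

lemma coeff_prod_linear:
  fixes v w :: "nat \<Rightarrow> real"
  assumes "distinct xs"
  shows "coeff (prod_list (map (\<lambda>z. [:v z, w z:]) xs)) 0 = prod_list (map v xs)"
    "coeff (prod_list (map (\<lambda>z. [:v z, w z:]) xs)) 1
      = (\<Sum>u\<in>set xs. w u * prod_list (map v (filter (\<lambda>z. z \<noteq> u) xs)))"
    "degree (prod_list (map (\<lambda>z. [:v z, w z:]) xs)) \<le> length xs"
  using assms
proof (induction xs)
  case (Cons x xs)
  let ?p = "prod_list (map (\<lambda>z. [:v z, w z:]) xs)"
  {
    case 1
    then show ?case using Cons.IH by (simp add: coeff_mult)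
  next
    case 2
    then have x: "x \<notin> set xs" "distinct xs" by auto
    then have f: "filter (\<lambda>z. z \<noteq> x) xs = xs" by (intro filter_True) auto
    have "coeff ([:v x, w x:] * ?p) 1 = v x * coeff ?p 1 + w x * coeff ?p 0"
      by (simp add: coeff_pCons split: nat.split)
    also have "\<dots> = v x * (\<Sum>u\<in>set xs. w u * prod_list (map v (filter (\<lambda>z. z \<noteq> u) xs))) + w x * prod_list (map v xs)"
      using Cons.IH x by simp
    also have "\<dots> = (\<Sum>u\<in>set (x # xs). w u * prod_list (map v (filter (\<lambda>z. z \<noteq> u) (x # xs))))"
    proof -
      have "(\<Sum>u\<in>set xs. w u * prod_list (map v (filter (\<lambda>z. z \<noteq> u) (x # xs))))
        = (\<Sum>u\<in>set xs. v x * (w u * prod_list (map v (filter (\<lambda>z. z \<noteq> u) xs))))"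
        using x(1) by (intro sum.cong) auto
      then show ?thesis using x f by (simp add: sum_distrib_left)
    qed
    finally show ?case by simp
  next
    case 3
    have "degree ([:v x, w x:] * ?p) \<le> degree [:v x, w x:] + degree ?p" by (rule degree_mult_le)
    also have "\<dots> \<le> 1 + length xs" using Cons.IH(3) 3 by (intro add_mono) (auto simp: degree_pCons_eq_if)
    finally show ?case by simp
  }
qed simp_all

text \<open>The trie and the scan cost k^2 per observable, while the time bound grants 2^k. The
  factor 2 is due to k = 3.\<close>

lemma square_le_two_power: "k ^ 2 \<le> 2 * 2 ^ (k :: nat)"
proof -
  consider "k \<le> 3" | "k \<ge> 4" by linarith
  then show ?thesis
  proof cases
    case 1
    then have "k = 0 \<or> k = 1 \<or> k = 2 \<or> k = 3" by auto
    then show ?thesis by auto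
  next
    case 2
    then have "k ^ 2 \<le> 2 ^ k"
    proof (induction k rule: nat_induct_at_least)
      case (Suc m)
      have "2 * m + 1 \<le> m * m" using mult_le_mono1[OF Suc(1), of m] Suc(1) by linarith
      then have "Suc m ^ 2 \<le> 2 * m ^ 2" by (simp add: power2_eq_square)
      then show ?case using Suc(2) by simp
    qed simp
    then show ?thesis by simp
  qed
qed

context hamiltonian_data
begin

definition prepare_time :: nat where
  "prepare_time = (k * (base * 8 + 20) + 20) + build_time + merge_time + (n * 30 + 10) + scan_time + 4"

definition prepared :: "store \<Rightarrow> bool" where
  "prepared t \<longleftrightarrow> (\<forall>z\<in>{1..3 * n}. reals t ''v'' z \<in> {1, -1} \<and> reals t ''sg'' z \<in> {1, -1}) \<and>
    \<bar>reals t ''tb'' 0\<bar> \<le> 1 \<and>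
    (\<Sum>u\<in>{1..3 * n}. sqrt (sq_norm u) / 3 ^ (k - 1)) \<le> (real k)\<^sup>2 * \<bar>ray_poly (reals t ''v'') (reals t ''sg'') (reals t ''tb'' 0)\<bar>"

text \<open>Along the ray the linear coefficient is the sum of \<open>w u * grad v u\<close>, and
  the signs \<open>w\<close> align all summands. The central difference then bounds it by the values
  at the scanned points.\<close>

lemma ray_poly_bound:
  assumes s: "\<And>u. u \<in> {1..3 * n} \<Longrightarrow> w u * grad v u = \<bar>grad v u\<bar>"
    and M: "\<And>q. q \<le> 2 * k \<Longrightarrow> \<bar>ray_poly v w ((real q - real k) / real k)\<bar> \<le> M"
  shows "(\<Sum>u\<in>{1..3 * n}. \<bar>grad v u\<bar>) \<le> (real k)\<^sup>2 * M"
proof -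
  define L where "L = (\<lambda>j. prod_list (map (\<lambda>z. [:v z, w z:]) (X j)))"
  define p where "p = (\<Sum>j<nz. smult (if X j = [] then 0 else amp j) (L j))"
  have poly: "poly p t = ray_poly v w t" for t
  proof -
    have "poly (prod_list (map (\<lambda>z. [:v z, w z:]) xs)) t = prod_list (map (\<lambda>z. v z + t * w z) xs)" for xs
      by (induction xs) (simp_all add: algebra_simps)
    then show ?thesis by (simp add: p_def L_def ray_poly_def poly_sum if_distrib[of "\<lambda>x. x * _"] cong: if_cong)
  qed
  have "degree (L j) \<le> 2 * k" if "j < nz" for j
    using coeff_prod_linear(3)[OF distinct_X[OF that], of v w] length_X[OF that] by (simp add: L_def)
  then have "degree p \<le> 2 * k"
    unfolding p_def by (intro degree_sum_le) (auto intro: order_trans[OF degree_smult_le])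
  then have "\<bar>coeff p 1\<bar> \<le> (real k)\<^sup>2 * M"
    using linear_coeff_bound[OF k_pos, of p M] M by (simp add: poly)
  have "coeff p 1 = (\<Sum>j<nz. amp j * coeff (L j) 1)"
    unfolding p_def coeff_sum by (intro sum.cong) (auto simp: L_def)
  also have "\<dots> = (\<Sum>j<nz. \<Sum>u\<in>set (X j). amp j * (w u * prod_list (map v (filter (\<lambda>z. z \<noteq> u) (X j)))))"
    by (rule sum.cong) (auto simp: L_def coeff_prod_linear(2)[OF distinct_X] sum_distrib_left simp del: One_nat_def)
  also have "\<dots> = (\<Sum>(j, u)\<in>entries nz. amp j * (w u * prod_list (map v (filter (\<lambda>z. z \<noteq> u) (X j)))))"
    unfolding entries_def by (rule sum.Sigma) auto
  also have "\<dots> = (\<Sum>(j, u')\<in>entries nz. \<Sum>u\<in>{1..3 * n}. if u' = u then w u * (amp j * prod_list (map v (tl (path j u)))) else 0)"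
  proof (rule sum.cong[OF refl], clarify)
    fix j u assume "(j, u) \<in> entries nz"
    then have "u \<in> {1..3 * n}" using set_X[of j] by (auto simp: entries_def)
    then show "amp j * (w u * prod_list (map v (filter (\<lambda>z. z \<noteq> u) (X j))))
      = (\<Sum>u'\<in>{1..3 * n}. if u = u' then w u' * (amp j * prod_list (map v (tl (path j u')))) else 0)"
      by (simp add: path_def)
  qed
  also have "\<dots> = (\<Sum>u\<in>{1..3 * n}. w u * grad v u)"
    unfolding grad_def sum_distrib_left case_prod_beta
    by (subst sum.swap) (intro sum.cong refl, simp)
  also have "\<dots> = (\<Sum>u\<in>{1..3 * n}. \<bar>grad v u\<bar>)"
    by (rule sum.cong) (use s in auto)
  finally have "coeff p 1 = (\<Sum>u\<in>{1..3 * n}. \<bar>grad v u\<bar>)" .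
  then show ?thesis using \<open>\<bar>coeff p 1\<bar> \<le> (real k)\<^sup>2 * M\<close> by linarith
qed

lemma wp_prepare:
  assumes s: "input s" and zero: "ints s ''seen'' = (\<lambda>_. 0)" "ints s ''head'' = (\<lambda>_. 0)"
    "reals s ''beta'' = (\<lambda>_. 0)" "reals s ''V'' = (\<lambda>_. 0)" "reals s ''W'' = (\<lambda>_. 0)"
  shows "wp prepare_prog s prepare_time prepared"
proof -
  \<comment> \<open>The phases are composed from the last one backwards, each assuming of its store
    only what the phases from there on need.\<close>
  have 5: "wp scan_prog t4 scan_time prepared"
    if t4: "input t4" "\<And>j. j < nz \<Longrightarrow> reals t4 ''ca'' j = amp j"
      "\<forall>z\<in>{1..3 * n}. reals t4 ''v'' z \<in> {1, -1} \<and> reals t4 ''sg'' z \<in> {1, -1}"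
      "\<And>u. u \<in> {1..3 * n} \<Longrightarrow> reals t4 ''sg'' u * grad (reals t4 ''v'') u = \<bar>grad (reals t4 ''v'') u\<bar>"
      "(\<Sum>u\<in>{1..3 * n}. sqrt (sq_norm u) / 3 ^ (k - 1)) \<le> (\<Sum>u\<in>{1..3 * n}. \<bar>grad (reals t4 ''v'') u\<bar>)" for t4
  proof (rule wp_conseq[OF wp_scan[OF t4(1,2) refl refl]], simp, elim conjE)
    fix t5 assume fr: "frame scan_prog t4 t5" and tb: "\<bar>reals t5 ''tb'' 0\<bar> \<le> 1"
      and best: "\<forall>q\<le>2 * k. \<bar>ray_poly (reals t4 ''v'') (reals t4 ''sg'') ((real q - real k) / real k)\<bar>
        \<le> \<bar>ray_poly (reals t4 ''v'') (reals t4 ''sg'') (reals t5 ''tb'' 0)\<bar>"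
    have fr': "reals t5 ''v'' = reals t4 ''v''" "reals t5 ''sg'' = reals t4 ''sg''"
      using fr by (simp_all add: frame_def phase_writes)
    have "(\<Sum>u\<in>{1..3 * n}. \<bar>grad (reals t4 ''v'') u\<bar>)
      \<le> (real k)\<^sup>2 * \<bar>ray_poly (reals t4 ''v'') (reals t4 ''sg'') (reals t5 ''tb'' 0)\<bar>"
      by (rule ray_poly_bound) (use t4(4) best in auto)
    then show "prepared t5" using t4(3,5) tb unfolding prepared_def fr' by (intro conjI) linarith+
  qed
  have 4: "wp (sign_prog ;; scan_prog) t3 ((n * 30 + 10) + scan_time + 1) prepared"
    if t3: "input t3" "\<And>j. j < nz \<Longrightarrow> reals t3 ''ca'' j = amp j" "ints t3 ''B'' 0 = base"
      "\<forall>z\<in>{1..3 * n}. reals t3 ''v'' z \<in> {1, - 1}" "\<forall>u\<in>{1..3 * n}. reals t3 ''beta'' u = grad (reals t3 ''v'') u"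
      "(\<Sum>u\<in>{1..3 * n}. sqrt (sq_norm u) / 3 ^ (k - 1)) \<le> (\<Sum>u\<in>{1..3 * n}. \<bar>grad (reals t3 ''v'') u\<bar>)" for t3
  proof (rule wp_Seq[where m = "n * 30 + 10" and n = scan_time], rule wp_conseq[OF wp_sign[OF t3(3)]])
    fix t4 assume fr: "frame sign_prog t3 t4"
      and sg: "\<forall>u\<in>{1..3 * n}. reals t4 ''sg'' u \<in> {1, -1} \<and> reals t4 ''sg'' u * reals t3 ''beta'' u = \<bar>reals t3 ''beta'' u\<bar>"
    have in4: "input t4" by (rule input_frame[OF t3(1) fr]) (simp_all add: phase_writes)
    have fr': "reals t4 ''v'' = reals t3 ''v''" "reals t4 ''ca'' = reals t3 ''ca''"
      using fr by (simp_all add: frame_def phase_writes)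
    show "wp scan_prog t4 scan_time prepared"
      by (rule 5[OF in4]) (use t3 sg in \<open>simp_all add: fr'\<close>)
  qed simp
  have 3: "wp (merge_prog ;; sign_prog ;; scan_prog) t2 (merge_time + ((n * 30 + 10) + scan_time + 1) + 1) prepared"
    if t2: "input t2" "\<And>j. j < nz \<Longrightarrow> reals t2 ''ca'' j = amp j" "ints t2 ''B'' 0 = base" "built (entries nz) t2" for t2
  proof (rule wp_Seq[where m = merge_time and n = "(n * 30 + 10) + scan_time + 1"],
      rule wp_conseq[OF wp_merge[OF t2(1,4)]], elim conjE)
    fix t3 assume fr: "frame merge_prog t2 t3" and t3: "\<forall>z\<in>{1..3 * n}. reals t3 ''v'' z \<in> {1, - 1}"
      "\<forall>u\<in>{1..3 * n}. reals t3 ''beta'' u = grad (reals t3 ''v'') u"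
      "(\<Sum>u\<in>{1..3 * n}. sqrt (sq_norm u) / 3 ^ (k - 1)) \<le> (\<Sum>u\<in>{1..3 * n}. \<bar>grad (reals t3 ''v'') u\<bar>)"
    have in3: "input t3" by (rule input_frame[OF t2(1) fr]) (simp_all add: phase_writes)
    have fr': "ints t3 ''B'' = ints t2 ''B''" "reals t3 ''ca'' = reals t2 ''ca''"
      using fr by (simp_all add: frame_def phase_writes)
    show "wp (sign_prog ;; scan_prog) t3 ((n * 30 + 10) + scan_time + 1) prepared"
      by (rule 4[OF in3 _ _ t3]) (use t2 in \<open>simp_all add: fr'\<close>)
  qed simp
  have 2: "wp (build_prog ;; merge_prog ;; sign_prog ;; scan_prog) t1
      (build_time + (merge_time + ((n * 30 + 10) + scan_time + 1) + 1) + 1) prepared"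
    if t1: "input t1" "table_ok t1" "frame table_prog s t1" for t1
  proof (rule wp_Seq[where m = build_time and n = "merge_time + ((n * 30 + 10) + scan_time + 1) + 1"],
      rule wp_conseq[OF wp_build[OF t1(1,2)]])
    show "ints t1 ''seen'' = (\<lambda>_. 0)" "ints t1 ''head'' = (\<lambda>_. 0)" "reals t1 ''beta'' = (\<lambda>_. 0)"
      "reals t1 ''V'' = (\<lambda>_. 0)" "reals t1 ''W'' = (\<lambda>_. 0)"
      using t1(3) zero by (simp_all add: frame_def phase_writes)
    fix t2 assume fr: "frame build_prog t1 t2"
      and t2: "built (entries nz) t2 \<and> (\<forall>j<nz. reals t2 ''ca'' j = amp j)"
    have in2: "input t2" by (rule input_frame[OF t1(1) fr]) (simp_all add: phase_writes)
    have "ints t2 ''B'' = ints t1 ''B''" using fr by (simp add: frame_def phase_writes)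
    then have "ints t2 ''B'' 0 = base" using t1(2) by (simp add: table_ok_def)
    with in2 t2 show "wp (merge_prog ;; sign_prog ;; scan_prog) t2 (merge_time + ((n * 30 + 10) + scan_time + 1) + 1) prepared"
      by (intro 3) auto
  qed simp
  show ?thesis
    unfolding prepare_prog_def
  proof (rule wp_Seq[where m = "k * (base * 8 + 20) + 20" and n = "build_time + (merge_time + ((n * 30 + 10) + scan_time + 1) + 1) + 1"],
      rule wp_conseq[OF wp_table_prog[OF s]])
    fix t1 assume fr: "frame table_prog s t1" and t1: "table_ok t1"
    have "input t1" by (rule input_frame[OF s fr]) (simp_all add: phase_writes)
    then show "wp (build_prog ;; merge_prog ;; sign_prog ;; scan_prog) t1
      (build_time + (merge_time + ((n * 30 + 10) + scan_time + 1) + 1) + 1) prepared"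
      by (rule 2[OF _ t1 fr])
  qed (simp add: prepare_time_def)
qed

section \<open>Counting nodes and steps\<close>

lemma card_node_set: "card node_set \<le> nz * k\<^sup>2"
proof -
  have "card node_set \<le> (\<Sum>e\<in>entries nz. card (prefixes2 (path (fst e) (snd e))))"
    unfolding nodes_def case_prod_beta by (rule card_UN_le) simp
  also have "\<dots> \<le> (\<Sum>e\<in>entries nz. k)"
  proof (rule sum_mono)
    fix e assume "e \<in> entries nz"
    then have "length (path (fst e) (snd e)) \<le> k"
      using length_path[of "fst e" "snd e"] length_X[of "fst e"] by (auto simp: entries_def)
    moreover have "card (prefixes2 xs) \<le> length xs" for xs
      unfolding prefixes2_def using card_image_le[of "{2..length xs}" "\<lambda>i. take i xs"] by simp
    ultimately show "card (prefixes2 (path (fst e) (snd e))) \<le> k" by (meson order_trans)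
  qed
  also have "\<dots> = card (entries nz) * k" by simp
  also have "card (entries nz) \<le> nz * k"
  proof -
    have "card (entries nz) = (\<Sum>j<nz. card (set (X j)))" unfolding entries_def by simp
    also have "\<dots> \<le> (\<Sum>j<nz. k)"
      by (intro sum_mono) (use card_length length_X in \<open>auto intro: order_trans\<close>)
    finally show ?thesis by simp
  qed
  finally show ?thesis by (simp add: power2_eq_square mult.assoc)
qed

lemma sum_card_layers: "(\<Sum>i<3 * n. card (layer (3 * n - i))) \<le> nz * k\<^sup>2"
proof -
  have "(\<Sum>i<3 * n. card (layer (3 * n - i))) = card (\<Union>i<3 * n. layer (3 * n - i))"
    by (rule card_UN_disjoint[symmetric]) (auto simp: layer_def)
  also have "\<dots> \<le> card node_set" by (rule card_mono) (auto simp: layer_def)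
  finally show ?thesis using card_node_set by linarith
qed

text \<open>Building and scanning cost O(k^2) per observable, merging O(1) per trie node and per
  variable, the table O(n * k); \<open>square_le_two_power\<close> converts the k^2.\<close>

lemma prepare_time_le: "prepare_time \<le> 600 * (n * k + nz * 2 ^ k)"
proof -
  let ?Q = "nz * 2 ^ k"
  have kk: "k\<^sup>2 \<le> 2 * 2 ^ k" by (rule square_le_two_power)
  have k2: "k \<le> 2 ^ k" "1 \<le> (2 :: nat) ^ k" by (simp_all add: less_imp_le)
  have nk: "1 \<le> n * k" "n \<le> n * k" "k \<le> n * k" using n_pos k_pos by auto
  have nzk: "nz * k\<^sup>2 \<le> 2 * ?Q" "nz * k \<le> ?Q" "nz \<le> ?Q"
    using mult_le_mono2[OF kk, of nz] mult_le_mono2[OF k2(1), of nz] mult_le_mono2[OF k2(2), of nz] by simp_all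
  have "k * (base * 8 + 20) + 20 = 24 * (n * k) + 28 * k + 20" by (simp add: base_def algebra_simps)
  then have table: "k * (base * 8 + 20) + 20 \<le> 72 * (n * k)" using nk by linarith
  have w: "length (X j) * length (X j) \<le> k\<^sup>2" "length (X j) \<le> k" if "j < nz" for j
    using length_X[OF that] by (simp_all add: power2_eq_square mult_le_mono)
  have "(\<Sum>j<nz. length (X j) * (length (X j) * 40 + 40) + 21) \<le> (\<Sum>j<nz. 40 * k\<^sup>2 + 40 * k + 21)"
  proof (rule sum_mono)
    fix j assume "j \<in> {..<nz}"
    then have "length (X j) * length (X j) \<le> k\<^sup>2" "length (X j) \<le> k" using w by auto
    then show "length (X j) * (length (X j) * 40 + 40) + 21 \<le> 40 * k\<^sup>2 + 40 * k + 21"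
      by (simp add: algebra_simps)
  qed
  also have "\<dots> = 40 * (nz * k\<^sup>2) + 40 * (nz * k) + 21 * nz" by (simp add: algebra_simps)
  finally have build: "build_time \<le> 141 * ?Q + 10 * (n * k)" unfolding build_time_def using nzk nk by linarith
  have "(\<Sum>i<3 * n. card (layer (3 * n - i)) * 30 + 31) = (\<Sum>i<3 * n. card (layer (3 * n - i))) * 30 + 93 * n"
    by (simp add: sum.distrib sum_distrib_right)
  then have merge: "merge_time \<le> 60 * ?Q + 113 * (n * k)"
    unfolding merge_time_def using sum_card_layers nzk nk by linarith
  have "(\<Sum>j<nz. length (X j) * 4 + 21) \<le> (\<Sum>j<nz. k * 4 + 21)"
    by (rule sum_mono) (use w in simp)
  then have ev: "eval_time \<le> 4 * (nz * k) + 21 * nz + 20" unfolding eval_time_def by (simp add: algebra_simps)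
  have "(2 * k + 1) * (eval_time + 1) \<le> (3 * k) * (4 * (nz * k) + 21 * nz + 21)"
    using ev k_pos by (intro mult_le_mono) auto
  also have "\<dots> = 12 * (nz * k\<^sup>2) + 63 * (nz * k) + 63 * k" by (simp add: algebra_simps power2_eq_square)
  finally have scan: "scan_time \<le> 87 * ?Q + 73 * (n * k)" unfolding scan_time_def using nzk nk by linarith
  have "n * 30 + 10 \<le> 40 * (n * k)" using nk by linarith
  then have "prepare_time \<le> 72 * (n * k) + (141 * ?Q + 10 * (n * k)) + (60 * ?Q + 113 * (n * k)) + 40 * (n * k)
      + (87 * ?Q + 73 * (n * k)) + 4"
    unfolding prepare_time_def using table build merge scan by (intro add_mono order_refl)
  \<comment> \<open>Stated for variables, so that the arithmetic is linear and does not meet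
    \<open>n * k\<close> and \<open>nz * 2 ^ k\<close>.\<close>
  moreover have "x \<le> 72 * a + (141 * b + 10 * a) + (60 * b + 113 * a) + 40 * a + (87 * b + 73 * a) + 4 \<Longrightarrow>
      1 \<le> a \<Longrightarrow> x \<le> 600 * (a + b)" for a b x :: nat
    by (simp add: distrib_left)
  ultimately show ?thesis using nk(1) by blast
qed

end

subsection \<open>Pauli observables as monomials\<close>

text \<open>The input arrays are concatenations of blocks, and \<open>offset\<close> is the total
  length of the earlier blocks.\<close>

lemma concat_nth_offset:
  "j < length xss \<Longrightarrow> l < length (xss ! j) \<Longrightarrow>
    (\<Sum>i<j. length (xss ! i)) + l < length (concat xss) \<and>
    concat xss ! ((\<Sum>i<j. length (xss ! i)) + l) = xss ! j ! l"
proof (induction xss arbitrary: j)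
  case (Cons xs xss)
  show ?case
  proof (cases j)
    case 0
    then show ?thesis using Cons.prems by (simp add: nth_append)
  next
    case (Suc i)
    have "(\<Sum>i<j. length ((xs # xss) ! i)) = length xs + (\<Sum>i<i. length (xss ! i))"
      unfolding Suc by (subst sum.lessThan_Suc_shift) simp
    then show ?thesis using Cons.IH[of i] Cons.prems Suc by (simp add: nth_append add.assoc)
  qed
qed simp

definition pauli_vars :: "pauli list \<Rightarrow> nat list" where
  "pauli_vars P = map (\<lambda>i. 3 * i + pauli_code (P ! i)) (sites P)"

lemma pauli_code_range: "p \<noteq> PI \<Longrightarrow> 1 \<le> pauli_code p \<and> pauli_code p \<le> 3"
  by (cases p) auto

lemma inj_pauli_code: "pauli_code p = pauli_code q \<Longrightarrow> p = q"
  by (cases p; cases q) auto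

lemma sites_props: "set (sites P) = pauli_dom P" "sorted_wrt (<) (sites P)" "distinct (sites P)"
  "length (sites P) = pauli_weight P"
  by (simp_all add: sites_def pauli_weight_def)

text \<open>Qubit \<open>i\<close> owns the three numbers 3 * i + 1 to 3 * i + 3, so the order of
  the sites decides.\<close>

lemma sorted_pauli_vars: "sorted_wrt (<) (pauli_vars P)"
  unfolding pauli_vars_def sorted_wrt_map
proof (rule sorted_wrt_mono_rel[OF _ sites_props(2)])
  fix x y assume "x \<in> set (sites P)" "y \<in> set (sites P)" "x < y"
  then have "pauli_code (P ! x) \<le> 3" "1 \<le> pauli_code (P ! y)"
    using pauli_code_range by (auto simp: sites_props pauli_dom_def)
  then show "3 * x + pauli_code (P ! x) < 3 * y + pauli_code (P ! y)" using \<open>x < y\<close> by linarith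
qed

lemma length_pauli_vars: "length (pauli_vars P) = pauli_weight P"
  by (simp add: pauli_vars_def sites_props)

lemma set_pauli_vars: "P \<in> paulis n \<Longrightarrow> set (pauli_vars P) \<subseteq> {1..3 * n}"
proof
  fix u assume P: "P \<in> paulis n" and "u \<in> set (pauli_vars P)"
  then obtain i where i: "i \<in> pauli_dom P" "u = 3 * i + pauli_code (P ! i)"
    by (auto simp: pauli_vars_def sites_props)
  then have "i < n" using pauli_dom_subset[OF P] by auto
  moreover have "1 \<le> pauli_code (P ! i) \<and> pauli_code (P ! i) \<le> 3"
    using i(1) by (intro pauli_code_range) (simp add: pauli_dom_def)
  ultimately show "u \<in> {1..3 * n}" using i(2) by auto
qed

lemma mem_pauli_vars:
  assumes "P \<in> paulis n" "i < n" "p \<noteq> PI"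
  shows "3 * i + pauli_code p \<in> set (pauli_vars P) \<longleftrightarrow> P ! i = p"
proof
  assume "3 * i + pauli_code p \<in> set (pauli_vars P)"
  then obtain j where j: "j \<in> pauli_dom P" "3 * i + pauli_code p = 3 * j + pauli_code (P ! j)"
    by (auto simp: pauli_vars_def sites_props)
  have "1 \<le> pauli_code p \<and> pauli_code p \<le> 3" "1 \<le> pauli_code (P ! j) \<and> pauli_code (P ! j) \<le> 3"
    using pauli_code_range assms(3) j(1) by (auto simp: pauli_dom_def)
  then have ij: "i = j" using j(2) by linarith
  then have "pauli_code p = pauli_code (P ! i)" using j(2) by simp
  then show "P ! i = p" using inj_pauli_code by metis
next
  assume "P ! i = p"
  then show "3 * i + pauli_code p \<in> set (pauli_vars P)"
    using assms by (force simp: pauli_vars_def sites_props pauli_dom_def paulis_def)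
qed

lemma inj_pauli_vars: "inj_on pauli_vars (paulis n)"
proof (rule inj_onI)
  fix P Q assume PQ: "P \<in> paulis n" "Q \<in> paulis n" "pauli_vars P = pauli_vars Q"
  show "P = Q"
  proof (rule nth_equalityI)
    fix i assume "i < length P"
    then have i: "i < n" using PQ by (simp add: paulis_def)
    show "P ! i = Q ! i"
      using mem_pauli_vars[OF PQ(1) i] mem_pauli_vars[OF PQ(2) i] PQ(3) by metis
  qed (use PQ in \<open>simp add: paulis_def\<close>)
qed

lemma pauli_vars_empty: "P \<in> paulis n \<Longrightarrow> pauli_vars P = [] \<longleftrightarrow> P = pauli_id n"
proof -
  assume P: "P \<in> paulis n"
  have "pauli_vars P = [] \<longleftrightarrow> pauli_dom P = {}"
    by (simp add: pauli_vars_def sites_def)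
  also have "\<dots> \<longleftrightarrow> P = pauli_id n"
    using pauli_dom_empty[OF P] by (auto simp: pauli_dom_def pauli_id_def)
  finally show ?thesis .
qed

lemma sum_triples: "(\<Sum>u\<in>{1..3 * n}. f u) = (\<Sum>i<n. f (3 * i + 1) + f (3 * i + 2) + f (3 * i + 3 :: nat) :: real)"
proof (induction n)
  case (Suc n)
  have "{1..3 * Suc n} = insert (3 * n + 1) (insert (3 * n + 2) (insert (3 * n + 3) {1..3 * n}))" by auto
  then show ?case using Suc by (simp add: add.assoc)
qed simp

definition bloch :: "qubit \<Rightarrow> pauli \<Rightarrow> real" where
  "bloch q p = Re (pauli_mean q p)"

lemma pauli_mean_real: "pauli_mean q p = complex_of_real (bloch q p)"
  by (cases p) (simp_all add: bloch_def pauli_mean_def amplitude_def UNIV_bool complex_eq_iff)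

text \<open>The third identity normalises the state: the second amplitude has squared modulus (1/3 +
  1/3) / (4 r^2) = 1 / (6 r^2), and (1 + s) * (1 - s) = 2/3 for s = +-1 / sqrt 3.\<close>

lemma corner_amplitudes:
  fixes z :: bool
  defines "r \<equiv> sqrt ((1 + sgn_bool z / sqrt 3) / 2)"
  shows "r > 0" "r\<^sup>2 = (1 + sgn_bool z / sqrt 3) / 2" "1 / (6 * r\<^sup>2) = (1 - sgn_bool z / sqrt 3) / 2"
proof -
  have s3: "sqrt 3 > 1" by simp
  then have pos: "1 + sgn_bool z / sqrt 3 > 0" by (cases z) (simp_all add: sgn_bool_def add_pos_pos)
  then show "r > 0" by (simp add: r_def)
  show r2: "r\<^sup>2 = (1 + sgn_bool z / sqrt 3) / 2" using pos by (simp add: r_def)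
  have "(sgn_bool z / sqrt 3)\<^sup>2 = 1 / 3" by (simp add: power_divide sgn_bool_def)
  then have "(1 + sgn_bool z / sqrt 3) * (1 - sgn_bool z / sqrt 3) = 2 / 3"
    by (simp add: power2_eq_square algebra_simps)
  moreover have "1 / (6 * (a / 2)) = b / 2" if "a * b = 2 / 3" "a > 0" for a b :: real
    using that by (simp add: field_simps)
  ultimately show "1 / (6 * r\<^sup>2) = (1 - sgn_bool z / sqrt 3) / 2"
    unfolding r2 using pos by blast
qed

lemma corner_norms:
  "(cmod (fst (corner x y z)))\<^sup>2 = (1 + sgn_bool z / sqrt 3) / 2"
  "(cmod (snd (corner x y z)))\<^sup>2 = (1 - sgn_bool z / sqrt 3) / 2"
proof -
  define r where "r = sqrt ((1 + sgn_bool z / sqrt 3) / 2)"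
  note r = corner_amplitudes[of z, folded r_def]
  show "(cmod (fst (corner x y z)))\<^sup>2 = (1 + sgn_bool z / sqrt 3) / 2"
    using r by (simp add: corner_def Let_def r_def[symmetric] cmod_power2)
  have "(sgn_bool x / sqrt 3 / (2 * r))\<^sup>2 + (sgn_bool y / sqrt 3 / (2 * r))\<^sup>2 = 1 / (6 * r\<^sup>2)"
    by (simp add: power_divide power_mult_distrib sgn_bool_def)
  then show "(cmod (snd (corner x y z)))\<^sup>2 = (1 - sgn_bool z / sqrt 3) / 2"
    using r(3) by (simp add: corner_def Let_def r_def[symmetric] cmod_power2)
qed

lemma unit_corner: "unit_qubit (corner x y z)"
  unfolding unit_qubit_def corner_norms by (simp add: field_simps)

lemma bloch_corner:
  "bloch (corner x y z) PI = 1" "bloch (corner x y z) PX = sgn_bool x / sqrt 3"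
  "bloch (corner x y z) PY = sgn_bool y / sqrt 3" "bloch (corner x y z) PZ = sgn_bool z / sqrt 3"
proof -
  define r where "r = sqrt ((1 + sgn_bool z / sqrt 3) / 2)"
  note r = corner_amplitudes[of z, folded r_def]
  have b: "bloch q PI = (cmod (fst q))\<^sup>2 + (cmod (snd q))\<^sup>2" "bloch q PZ = (cmod (fst q))\<^sup>2 - (cmod (snd q))\<^sup>2" for q
    unfolding cmod_power2
    by (simp_all add: bloch_def pauli_mean_def amplitude_def UNIV_bool power2_eq_square)
  show "bloch (corner x y z) PI = 1" "bloch (corner x y z) PZ = sgn_bool z / sqrt 3"
    unfolding b corner_norms by (simp_all add: field_simps)
  show "bloch (corner x y z) PX = sgn_bool x / sqrt 3" "bloch (corner x y z) PY = sgn_bool y / sqrt 3"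
    using r(1) by (simp_all add: bloch_def pauli_mean_def amplitude_def UNIV_bool corner_def Let_def r_def[symmetric])
qed

text \<open>The bound on the means keeps the coin probabilities in the unit interval, where
  \<open>bernoulli_pmf\<close> does not clip them. A Pauli matrix reads a single component of the
  Bloch vector, hence a single coin.\<close>

lemma expectation_bloch:
  assumes m: "\<And>u. u \<in> {3 * i + 1..3 * i + 3} \<Longrightarrow> \<bar>m u\<bar> \<le> 1"
  shows "measure_pmf.expectation (qubit_pmf m i) (\<lambda>q. bloch q p)
    = (if p = PI then 1 else m (3 * i + pauli_code p) / sqrt 3)"
proof -
  have p: "0 \<le> (1 + m (3 * i + a)) / 2" "(1 + m (3 * i + a)) / 2 \<le> 1" if "a = 1 \<or> a = 2 \<or> a = 3" for a
    using m[of "3 * i + a"] that by (auto simp: abs_le_iff)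
  have E: "measure_pmf.expectation (qubit_pmf m i) g =
    measure_pmf.expectation (bernoulli_pmf ((1 + m (3 * i + 1)) / 2)) (\<lambda>x.
    measure_pmf.expectation (bernoulli_pmf ((1 + m (3 * i + 2)) / 2)) (\<lambda>y.
    measure_pmf.expectation (bernoulli_pmf ((1 + m (3 * i + 3)) / 2)) (\<lambda>z. g (corner x y z))))" for g :: "qubit \<Rightarrow> real"
    unfolding qubit_pmf_def by (subst expectation_bind_finite, simp, simp)+ simp
  have bool: "measure_pmf.expectation (bernoulli_pmf ((1 + m (3 * i + a)) / 2)) g
    = g True * ((1 + m (3 * i + a)) / 2) + g False * (1 - (1 + m (3 * i + a)) / 2)"
    if "a = 1 \<or> a = 2 \<or> a = 3" for a and g :: "bool \<Rightarrow> real"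
    using p[OF that] by simp
  show ?thesis
    by (cases p) (simp_all only: E bool[of 1] bool[of 2] bool[of 3] simp_thms bloch_corner sgn_bool_def, simp_all add: field_simps)
qed

lemma expval_product:
  assumes "P \<in> paulis n"
  shows "expval n (pauli_op P) (product_state n q) = (\<Prod>i<n. bloch (q i) (P ! i))"
proof -
  have "length P = n" using assms by (simp add: paulis_def)
  from pauli_product_mean[OF this, of q] show ?thesis
    unfolding expval_def by (simp add: pauli_mean_real of_real_prod[symmetric] del: of_real_prod)
qed

lemma prod_dom_vars:
  fixes g :: "nat \<Rightarrow> real"
  assumes "P \<in> paulis n"
  shows "(\<Prod>i<n. if P ! i = PI then 1 else g (3 * i + pauli_code (P ! i))) = prod_list (map g (pauli_vars P))"
    (is "?l = _")
proof -
  have "?l = (\<Prod>i\<in>pauli_dom P. g (3 * i + pauli_code (P ! i)))"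
    using assms by (intro prod.mono_neutral_cong_right) (auto simp: pauli_dom_def paulis_def)
  also have "\<dots> = prod_list (map (\<lambda>i. g (3 * i + pauli_code (P ! i))) (sites P))"
    using prod.distinct_set_conv_list[OF sites_props(3)] by (metis sites_props(1))
  finally show ?thesis by (simp add: pauli_vars_def o_def)
qed

text \<open>The right side is the guaranteed gain. As \<open>rexpo d\<close> is at most 2, the
  exponent of k is at least k + 2, which absorbs k^2 and leaves k^k; this power outweighs sqrt(k!)
  together with the ratio of (6 sqrt 3)^k, the product of the losses 12^(k/2) and 3^k, to
  \<rho>^k.\<close>

lemma constant_bound:
  assumes k: "k \<ge> 1" and c: "c \<ge> 1" and d: "d \<ge> 1" and S: "0 \<le> S"
  shows "gain_const c d k * (c powr (1 / (2 * real d)) * S) \<le> S / (12 powr (real k / 2) * 3 ^ (k - 1) * (real k)\<^sup>2)"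
proof -
  define \<rho> where "\<rho> = sqrt 6 + 2 * sqrt (3 :: real)"
  let ?e = "real k + 1.5 + 1 / rexpo d"
  have kp: "real k \<ge> 1" using k by simp
  have \<rho>: "\<rho> > 0" by (simp add: \<rho>_def add_pos_pos)
  have cp: "c powr (1 / (2 * real d)) > 0" using c by simp
  have "rexpo d \<le> 2" "rexpo d > 0" using d by (simp_all add: rexpo_def divide_simps)
  then have "1 / 2 \<le> 1 / rexpo d" by (intro divide_left_mono) auto
  then have "real k powr (real (k + 2)) \<le> real k powr ?e"
    using kp by (intro powr_mono) simp_all
  moreover have "real k powr real (k + 2) = real k ^ (k + 2)" by (rule powr_realpow) (use kp in linarith)
  ultimately have e: "real k ^ (k + 2) \<le> real k powr ?e" by simp
  have "gain_const c d k * (c powr (1 / (2 * real d)) * S) = sqrt (2 * fact k) * S / (real k powr ?e * \<rho> ^ k)"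
    using cp by (simp add: gain_const_def \<rho>_def)
  also have "\<dots> \<le> sqrt (2 * fact k) * S / (real k ^ (k + 2) * \<rho> ^ k)"
    using e \<rho> S kp by (intro divide_left_mono mult_right_mono mult_pos_pos) auto
  also have "\<dots> \<le> S / (12 powr (real k / 2) * 3 ^ (k - 1) * (real k)\<^sup>2)"
  proof -
    have "k = 1 \<or> k = 2 \<or> k = 3 \<or> 4 \<le> k" using k by linarith
    \<comment> \<open>After squaring, 31/10 is a rational bound for 108 / \<rho>^2, and 9 is the
      square of the factor 3 gained by the exponent \<open>k - 1\<close> in place of
      \<open>k\<close>. From k = 4 on the base \<open>k\<close> alone exceeds 31/10.\<close>
    then have num: "2 * (31 / 10 :: real) ^ k \<le> 9 * real k ^ k"
    proof (elim disjE)
      assume "4 \<le> k"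
      then have "(31 / 10 :: real) ^ k \<le> real k ^ k" by (intro power_mono) auto
      moreover have "0 \<le> real k ^ k" by simp
      ultimately show ?thesis by linarith
    qed (simp_all add: eval_nat_numeral)
    have r12: "12 powr (real k / 2) = (2 * sqrt 3) ^ k"
    proof -
      have "12 powr (real k / 2) = (12 powr (1 / 2)) powr real k" by (simp add: powr_powr)
      also have "12 powr (1 / 2) = 2 * sqrt (3 :: real)"
        using real_sqrt_mult[of 4 3] by (simp add: powr_half_sqrt)
      finally show ?thesis by (simp add: powr_realpow)
    qed
    \<comment> \<open>Here \<rho>^2 = 18 + 12 sqrt 2, and sqrt 2 >= 1.41 suffices since 3.1 * 34.92
      > 108.\<close>
    have \<rho>2: "(6 * sqrt 3)\<^sup>2 \<le> 31 / 10 * \<rho>\<^sup>2"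
    proof -
      have "\<rho>\<^sup>2 = 18 + 4 * (sqrt 6 * sqrt 3)" by (simp add: \<rho>_def power2_eq_square algebra_simps)
      also have "sqrt 6 * sqrt 3 = 3 * sqrt (2 :: real)"
        using real_sqrt_mult[of 9 2] by (simp add: real_sqrt_mult[symmetric])
      finally have eq: "\<rho>\<^sup>2 = 18 + 12 * sqrt 2" by simp
      have "sqrt 2 \<ge> (141 / 100 :: real)" by (rule real_le_rsqrt) (simp add: power2_eq_square)
      then show ?thesis unfolding eq by (simp add: power_mult_distrib)
    qed
    have "(sqrt x * a ^ k)\<^sup>2 = x * (a\<^sup>2) ^ k" if "x \<ge> 0" for a x :: real
      using that by (simp add: power_mult_distrib power_mult[symmetric] mult.commute)
    then have "(sqrt (2 * fact k) * (6 * sqrt 3) ^ k)\<^sup>2 = 2 * fact k * ((6 * sqrt 3)\<^sup>2) ^ k"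
      by (meson fact_ge_zero mult_nonneg_nonneg zero_le_numeral)
    also have "\<dots> \<le> 2 * real k ^ k * (31 / 10 * \<rho>\<^sup>2) ^ k"
      using \<rho>2 fact_le_power[of k, where 'a = real] by (intro mult_mono power_mono) auto
    also have "\<dots> = real k ^ k * (2 * (31 / 10) ^ k) * (\<rho> ^ k)\<^sup>2"
    proof -
      have "(\<rho>\<^sup>2) ^ k = (\<rho> ^ k)\<^sup>2" by (simp add: power_mult[symmetric] mult.commute)
      then show ?thesis by (simp only: power_mult_distrib mult_ac)
    qed
    also have "\<dots> \<le> real k ^ k * (9 * real k ^ k) * (\<rho> ^ k)\<^sup>2"
      using num by (intro mult_right_mono mult_left_mono) auto
    also have "\<dots> = (3 * real k ^ k * \<rho> ^ k)\<^sup>2" by (simp add: power2_eq_square)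
    finally have "sqrt (2 * fact k) * (6 * sqrt 3) ^ k \<le> 3 * real k ^ k * \<rho> ^ k"
      by (rule power2_le_imp_le) (use \<rho> in simp)
    also have "(6 * sqrt 3) ^ k = (2 * sqrt 3 * 3 :: real) ^ k" by simp
    also have "\<dots> = (2 * sqrt 3) ^ k * (3 * 3 ^ (k - 1))"
      using power_minus_mult[of k "3 :: real"] k by (simp only: power_mult_distrib) simp
    finally have "3 * (sqrt (2 * fact k) * ((2 * sqrt 3) ^ k * 3 ^ (k - 1))) \<le> 3 * (real k ^ k * \<rho> ^ k)"
      by (simp only: mult_ac)
    then have key: "sqrt (2 * fact k) * ((2 * sqrt 3) ^ k * 3 ^ (k - 1)) \<le> real k ^ k * \<rho> ^ k"
      by (simp only: mult_le_cancel_left_pos zero_less_numeral)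
    have "sqrt (2 * fact k) / (real k ^ (k + 2) * \<rho> ^ k) \<le> 1 / ((2 * sqrt 3) ^ k * 3 ^ (k - 1) * (real k)\<^sup>2)"
    proof -
      have "sqrt (2 * fact k) * ((2 * sqrt 3) ^ k * 3 ^ (k - 1) * (real k)\<^sup>2) \<le> real k ^ (k + 2) * \<rho> ^ k"
        using mult_right_mono[OF key, of "(real k)\<^sup>2"] by (simp only: power_add mult_ac zero_le_power2 simp_thms)
      then show ?thesis using kp \<rho> by (simp add: divide_simps mult_ac)
    qed
    then show ?thesis using mult_right_mono[OF _ S] unfolding r12 by fastforce
  qed
  finally show ?thesis .
qed

section \<open>The algorithm on a Hamiltonian in sparse format\<close>

locale pauli_instance =
  fixes n k :: nat and \<alpha> :: "pauli list \<Rightarrow> real" and c\<^sub>e :: real and d\<^sub>e :: nat and Ps :: "pauli list list"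
  assumes n: "n \<ge> 1" and k: "k \<ge> 1" and loc: "k_local n k \<alpha>" and expand: "expansion n \<alpha> c\<^sub>e d\<^sub>e"
    and dist: "distinct Ps" and set_Ps: "set Ps = {P\<in>paulis n. \<alpha> P \<noteq> 0}"
begin

lemma nth_Ps: "j < length Ps \<Longrightarrow> Ps ! j \<in> paulis n \<and> \<alpha> (Ps ! j) \<noteq> 0"
  using set_Ps nth_mem by blast

sublocale hamiltonian_data n k "length Ps" "\<lambda>j. pauli_vars (Ps ! j)" "\<lambda>j. \<alpha> (Ps ! j)"
proof
  fix j assume j: "j < length Ps"
  show "sorted_wrt (<) (pauli_vars (Ps ! j))" by (rule sorted_pauli_vars)
  show "set (pauli_vars (Ps ! j)) \<subseteq> {1..3 * n}" using nth_Ps[OF j] by (intro set_pauli_vars) simp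
  show "length (pauli_vars (Ps ! j)) \<le> k" using nth_Ps[OF j] loc by (simp add: length_pauli_vars k_local_def)
next
  show "inj_on (\<lambda>j. pauli_vars (Ps ! j)) {..<length Ps}"
  proof (rule inj_onI)
    fix i j assume *: "i \<in> {..<length Ps}" "j \<in> {..<length Ps}" "pauli_vars (Ps ! i) = pauli_vars (Ps ! j)"
    then have "Ps ! i = Ps ! j" using inj_onD[OF inj_pauli_vars, of "Ps ! i" "Ps ! j" n] nth_Ps by auto
    then show "i = j" using * dist by (simp add: nth_eq_iff_index_eq)
  qed
qed (use n k in auto)

abbreviation start :: store where "start \<equiv> input_store n k d\<^sub>e \<alpha> Ps"

lemma input_start: "input start"
proof -
  have "3 * ints start ''site'' (offset j + l) + ints start ''pauli'' (offset j + l) = pauli_vars (Ps ! j) ! l"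
    if j: "j < length Ps" and l: "l < length (pauli_vars (Ps ! j))" for j l
  proof -
    have l': "l < length (sites (Ps ! j))" using l by (simp add: length_pauli_vars sites_props)
    have off: "offset j = (\<Sum>i<j. length (map sites Ps ! i))"
      "offset j = (\<Sum>i<j. length (map (\<lambda>P. map (\<lambda>i. pauli_code (P ! i)) (sites P)) Ps ! i))"
      unfolding offset_def using j by (auto intro!: sum.cong simp: length_pauli_vars sites_props)
    have "ints start ''site'' (offset j + l) = sites (Ps ! j) ! l"
      using concat_nth_offset[of j "map sites Ps" l] j l' unfolding off(1) by (simp add: input_store_def cells_def)
    moreover have "ints start ''pauli'' (offset j + l) = pauli_code (Ps ! j ! (sites (Ps ! j) ! l))"
      using concat_nth_offset[of j "map (\<lambda>P. map (\<lambda>i. pauli_code (P ! i)) (sites P)) Ps" l] j l'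
      unfolding off(2) by (simp add: input_store_def cells_def)
    ultimately show ?thesis using l' by (simp add: pauli_vars_def)
  qed
  moreover have "ints start ''n'' 0 = n" "ints start ''k'' 0 = k" "ints start ''nnz'' 0 = length Ps"
    "\<And>j. j < length Ps \<Longrightarrow> ints start ''weight'' j = length (pauli_vars (Ps ! j))"
    "\<And>j. j < length Ps \<Longrightarrow> reals start ''coeff'' j = \<alpha> (Ps ! j)"
    by (simp_all add: input_store_def cells_def length_pauli_vars)
  ultimately show ?thesis unfolding input_def by blast
qed

lemma amp_eq: "amp j = \<alpha> (Ps ! j) / (2 * sqrt 3) ^ pauli_weight (Ps ! j)"
proof -
  let ?w = "pauli_weight (Ps ! j)"
  have "12 powr (real ?w / 2) = (12 powr (1 / 2)) powr real ?w" by (simp add: powr_powr)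
  also have "12 powr (1 / 2) = 2 * sqrt (3 :: real)" using real_sqrt_mult[of 4 3] by (simp add: powr_half_sqrt)
  finally show ?thesis by (simp add: amp_def length_pauli_vars powr_realpow)
qed

lemma sum_Ps: "(\<Sum>P\<in>paulis n. \<alpha> P * f P) = (\<Sum>j<length Ps. \<alpha> (Ps ! j) * f (Ps ! j))"
proof -
  have "(\<Sum>P\<in>paulis n. \<alpha> P * f P) = (\<Sum>P\<in>set Ps. \<alpha> P * f P)"
    by (rule sum.mono_neutral_right) (auto simp: set_Ps)
  also have "\<dots> = (\<Sum>j<length Ps. \<alpha> (Ps ! j) * f (Ps ! j))"
    by (rule sum.reindex_bij_betw[symmetric, OF bij_betw_nth[OF dist refl refl]])
  finally show ?thesis .
qed

text \<open>Qubits are independent and a site contributes its mean divided by sqrt 3, so an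
  observable has as expectation its monomial at (v + t * w) / (2 sqrt 3); the powers of 2 sqrt 3
  form the divisor in \<open>amp\<close>.\<close>

lemma expected_value:
  assumes t: "prepared t" "ints t ''i'' 0 = 0" "reals t ''im0'' = (\<lambda>_. 0)"
  shows "measure_pmf.expectation (iterate_pmf qubit_step n t) (\<lambda>s. expval n (hamiltonian n \<alpha>) (product_state n (output_qubits s)))
    = \<alpha> (pauli_id n) + ray_poly (reals t ''v'') (reals t ''sg'') (reals t ''tb'' 0)"
proof -
  let ?D = "iterate_pmf qubit_step n t" and ?m = "mean_of t"
  let ?E = "measure_pmf.expectation"
  \<comment> \<open>This is why the means are halved: |v + t * w| can reach 2.\<close>
  have m: "\<bar>?m u\<bar> \<le> 1" if "u \<in> {1..3 * n}" for u
  proof -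
    have "reals t ''v'' u \<in> {1, -1}" "reals t ''sg'' u \<in> {1, -1}" and tb: "\<bar>reals t ''tb'' 0\<bar> \<le> 1"
      using t(1) that unfolding prepared_def by blast+
    then have "\<bar>reals t ''v'' u\<bar> \<le> 1" "\<bar>reals t ''sg'' u\<bar> \<le> 1" "\<bar>reals t ''tb'' 0\<bar> \<le> 1"
      by auto
    then have "\<bar>reals t ''v'' u\<bar> \<le> 1" "\<bar>reals t ''tb'' 0 * reals t ''sg'' u\<bar> \<le> 1"
      using mult_mono[of "\<bar>reals t ''tb'' 0\<bar>" 1 "\<bar>reals t ''sg'' u\<bar>" 1] by (simp_all add: abs_mult)
    then show ?thesis unfolding mean_of_def by (simp add: abs_le_iff)
  qed
  define f where "f = (\<lambda>P. prod_list (map (\<lambda>u. ?m u / sqrt 3) (pauli_vars P)))"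
  have one: "?E ?D (\<lambda>s. expval n (pauli_op P) (product_state n (output_qubits s))) = f P" if P: "P \<in> paulis n" for P
  proof -
    have "?E ?D (\<lambda>s. expval n (pauli_op P) (product_state n (output_qubits s)))
      = ?E ?D (\<lambda>s. \<Prod>i\<in>{0..<0 + n}. bloch (output_qubits s i) (P ! i))"
      by (simp add: expval_product[OF P] atLeast0LessThan)
    also have "\<dots> = (\<Prod>i\<in>{0..<0 + n}. ?E (qubit_pmf ?m i) (\<lambda>q. bloch q (P ! i)))"
      by (rule expectation_iterate[OF t(3,2) refl])
    also have "\<dots> = (\<Prod>i<n. if P ! i = PI then 1 else ?m (3 * i + pauli_code (P ! i)) / sqrt 3)"
    proof (rule prod.cong)
      fix i assume "i \<in> {..<n}"
      then have "\<bar>?m u\<bar> \<le> 1" if "u \<in> {3 * i + 1..3 * i + 3}" for u using that by (intro m) auto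
      then show "?E (qubit_pmf ?m i) (\<lambda>q. bloch q (P ! i)) = (if P ! i = PI then 1 else ?m (3 * i + pauli_code (P ! i)) / sqrt 3)"
        by (rule expectation_bloch)
    qed auto
    also have "\<dots> = f P" unfolding f_def by (rule prod_dom_vars[OF P])
    finally show ?thesis .
  qed
  have int: "integrable (measure_pmf ?D) g" for g :: "store \<Rightarrow> real"
    by (rule integrable_measure_pmf_finite) simp
  have "?E ?D (\<lambda>s. expval n (hamiltonian n \<alpha>) (product_state n (output_qubits s)))
    = (\<Sum>P\<in>paulis n. \<alpha> P * ?E ?D (\<lambda>s. expval n (pauli_op P) (product_state n (output_qubits s))))"
    unfolding expval_hamiltonian by (subst Bochner_Integration.integral_sum) (auto intro: int)
  also have "\<dots> = (\<Sum>P\<in>paulis n. \<alpha> P * f P)" by (rule sum.cong) (simp_all add: one)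
  also have "\<dots> = (\<Sum>P\<in>paulis n. \<alpha> P * (if P = pauli_id n then 1 else 0))
      + (\<Sum>P\<in>paulis n. \<alpha> P * (if P = pauli_id n then 0 else f P))"
  proof -
    have "f (pauli_id n) = 1" using pauli_vars_empty[OF pauli_id_in_paulis] by (simp add: f_def)
    then have "\<alpha> P * f P = \<alpha> P * (if P = pauli_id n then 1 else 0) + \<alpha> P * (if P = pauli_id n then 0 else f P)" for P
      by simp
    then show ?thesis unfolding sum.distrib[symmetric] by (rule sum.cong[OF refl])
  qed
  also have "(\<Sum>P\<in>paulis n. \<alpha> P * (if P = pauli_id n then 1 else 0)) = \<alpha> (pauli_id n)"
  proof -
    have "(\<Sum>P\<in>paulis n. \<alpha> P * (if P = pauli_id n then 1 else 0)) = (\<Sum>P\<in>paulis n. if P = pauli_id n then \<alpha> P else 0)"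
      by (rule sum.cong) auto
    then show ?thesis using pauli_id_in_paulis by simp
  qed
  also have "(\<Sum>P\<in>paulis n. \<alpha> P * (if P = pauli_id n then 0 else f P))
    = (\<Sum>j<length Ps. \<alpha> (Ps ! j) * (if Ps ! j = pauli_id n then 0 else f (Ps ! j)))" by (rule sum_Ps)
  also have "\<dots> = ray_poly (reals t ''v'') (reals t ''sg'') (reals t ''tb'' 0)"
    unfolding ray_poly_def
  proof (rule sum.cong[OF refl])
    fix j assume "j \<in> {..<length Ps}"
    then have P: "Ps ! j \<in> paulis n" using nth_Ps by simp
    have "prod_list (map (\<lambda>u. ?m u / sqrt 3) xs) = prod_list (map (\<lambda>z. reals t ''v'' z + reals t ''tb'' 0 * reals t ''sg'' z) xs)
        / (2 * sqrt 3) ^ length xs" for xs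
      by (induction xs) (simp_all add: mean_of_def)
    then have "\<alpha> (Ps ! j) * f (Ps ! j) = amp j * prod_list (map (\<lambda>z. reals t ''v'' z + reals t ''tb'' 0 * reals t ''sg'' z) (pauli_vars (Ps ! j)))"
      by (simp add: f_def amp_eq length_pauli_vars)
    then show "\<alpha> (Ps ! j) * (if Ps ! j = pauli_id n then 0 else f (Ps ! j)) = (if pauli_vars (Ps ! j) = [] then 0
      else amp j * prod_list (map (\<lambda>z. reals t ''v'' z + reals t ''tb'' 0 * reals t ''sg'' z) (pauli_vars (Ps ! j))))"
      using pauli_vars_empty[OF P] by simp
  qed
  finally show ?thesis .
qed

lemma sq_norm_eq: "sq_norm u = (\<Sum>j<length Ps. if u \<in> set (pauli_vars (Ps ! j)) then (amp j)\<^sup>2 else 0)"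
proof -
  have "sq_norm u = (\<Sum>j<length Ps. \<Sum>u'\<in>set (pauli_vars (Ps ! j)). if u' = u then (amp j)\<^sup>2 else 0)"
    unfolding sq_norm_def entries_def by (rule sum.Sigma[symmetric]) auto
  then show ?thesis by simp
qed

text \<open>An observable acting on a site contains exactly one of the three variables of that site,
  and the square root is subadditive. Passing from \<open>amp\<close> back to
  \<open>\<alpha>\<close> costs at most 12^(k/2), as weights are at most k.\<close>

lemma site_norm_bound: "site_norm_sum n \<alpha> / 12 powr (real k / 2) \<le> (\<Sum>u\<in>{1..3 * n}. sqrt (sq_norm u))"
proof -
  have "sqrt (\<Sum>P\<in>{P \<in> paulis n. i \<in> pauli_dom P}. (\<alpha> P)\<^sup>2) / 12 powr (real k / 2)
    \<le> sqrt (sq_norm (3 * i + 1)) + sqrt (sq_norm (3 * i + 2)) + sqrt (sq_norm (3 * i + 3))" if i: "i < n" for i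
  proof -
    have "(\<Sum>P\<in>{P \<in> paulis n. i \<in> pauli_dom P}. (\<alpha> P)\<^sup>2) = (\<Sum>P\<in>paulis n. if i \<in> pauli_dom P then (\<alpha> P)\<^sup>2 else 0)"
      by (rule sum.inter_filter) simp
    also have "\<dots> = (\<Sum>P\<in>paulis n. \<alpha> P * (if i \<in> pauli_dom P then \<alpha> P else 0))"
      by (rule sum.cong) (auto simp: power2_eq_square)
    also have "\<dots> = (\<Sum>j<length Ps. \<alpha> (Ps ! j) * (if i \<in> pauli_dom (Ps ! j) then \<alpha> (Ps ! j) else 0))"
      by (rule sum_Ps)
    also have "\<dots> \<le> (\<Sum>j<length Ps. 12 ^ k * ((if 3 * i + 1 \<in> set (pauli_vars (Ps ! j)) then (amp j)\<^sup>2 else 0)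
      + (if 3 * i + 2 \<in> set (pauli_vars (Ps ! j)) then (amp j)\<^sup>2 else 0)
      + (if 3 * i + 3 \<in> set (pauli_vars (Ps ! j)) then (amp j)\<^sup>2 else 0)))"
    proof (rule sum_mono)
      fix j assume "j \<in> {..<length Ps}"
      then have P: "Ps ! j \<in> paulis n" and w: "pauli_weight (Ps ! j) \<le> k" using nth_Ps loc by (auto simp: k_local_def)
      let ?P = "Ps ! j"
      have mem: "3 * i + 1 \<in> set (pauli_vars ?P) \<longleftrightarrow> ?P ! i = PX" "3 * i + 2 \<in> set (pauli_vars ?P) \<longleftrightarrow> ?P ! i = PY"
        "3 * i + 3 \<in> set (pauli_vars ?P) \<longleftrightarrow> ?P ! i = PZ"
        using mem_pauli_vars[OF P i, of PX] mem_pauli_vars[OF P i, of PY] mem_pauli_vars[OF P i, of PZ] by simp_all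
      have dom: "i \<in> pauli_dom ?P \<longleftrightarrow> ?P ! i \<noteq> PI" using P i by (simp add: pauli_dom_def paulis_def)
      have "((2 * sqrt 3) ^ pauli_weight ?P)\<^sup>2 = (12 :: real) ^ pauli_weight ?P"
        by (simp add: power_mult[symmetric] mult.commute power_mult_distrib) (simp add: power_mult power_mult_distrib[symmetric])
      then have "(\<alpha> ?P)\<^sup>2 = 12 ^ pauli_weight ?P * (amp j)\<^sup>2" by (simp add: amp_eq power_divide)
      also have "\<dots> \<le> 12 ^ k * (amp j)\<^sup>2" using w by (intro mult_right_mono power_increasing) auto
      finally have "(\<alpha> ?P)\<^sup>2 \<le> 12 ^ k * (amp j)\<^sup>2" .
      then show "\<alpha> ?P * (if i \<in> pauli_dom ?P then \<alpha> ?P else 0)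
        \<le> 12 ^ k * ((if 3 * i + 1 \<in> set (pauli_vars ?P) then (amp j)\<^sup>2 else 0)
        + (if 3 * i + 2 \<in> set (pauli_vars ?P) then (amp j)\<^sup>2 else 0)
        + (if 3 * i + 3 \<in> set (pauli_vars ?P) then (amp j)\<^sup>2 else 0))"
        unfolding mem dom by (cases "?P ! i") (simp_all add: power2_eq_square)
    qed
    also have "\<dots> = 12 ^ k * (sq_norm (3 * i + 1) + sq_norm (3 * i + 2) + sq_norm (3 * i + 3))"
      unfolding sq_norm_eq sum_distrib_left[symmetric] sum.distrib ..
    finally have "sqrt (\<Sum>P\<in>{P \<in> paulis n. i \<in> pauli_dom P}. (\<alpha> P)\<^sup>2)
      \<le> sqrt (12 ^ k) * sqrt (sq_norm (3 * i + 1) + sq_norm (3 * i + 2) + sq_norm (3 * i + 3))"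
      by (simp add: real_sqrt_mult[symmetric])
    also have "sqrt (12 ^ k) = 12 powr (real k / 2)"
      by (simp add: powr_half_sqrt[symmetric] powr_realpow[symmetric] powr_powr)
    also have "sqrt (sq_norm (3 * i + 1) + sq_norm (3 * i + 2) + sq_norm (3 * i + 3))
      \<le> sqrt (sq_norm (3 * i + 1)) + sqrt (sq_norm (3 * i + 2)) + sqrt (sq_norm (3 * i + 3))"
      using sqrt_add_le_add_sqrt[of "sq_norm (3 * i + 1) + sq_norm (3 * i + 2)" "sq_norm (3 * i + 3)"]
        sqrt_add_le_add_sqrt[of "sq_norm (3 * i + 1)" "sq_norm (3 * i + 2)"] sq_norm_nonneg by fastforce
    finally show ?thesis by (simp add: pos_divide_le_eq mult.commute)
  qed
  then show ?thesis
    unfolding sum_triples site_norm_sum_def sum_divide_distrib by (intro sum_mono) simp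
qed

lemma gain_le:
  assumes "prepared t"
  shows "gain_const c\<^sub>e d\<^sub>e k * coeff_norm n \<alpha> (rexpo d\<^sub>e)
    \<le> \<bar>ray_poly (reals t ''v'') (reals t ''sg'') (reals t ''tb'' 0)\<bar>" (is "_ \<le> ?R")
proof -
  let ?S = "site_norm_sum n \<alpha>"
  have cd: "c\<^sub>e \<ge> 1" "d\<^sub>e \<ge> 1" using expand by (simp_all add: expansion_def)
  have S: "0 \<le> ?S" unfolding site_norm_sum_def by (intro sum_nonneg) (simp add: sum_nonneg)
  have g: "0 \<le> gain_const c\<^sub>e d\<^sub>e k" by (simp add: gain_const_def)
  have "gain_const c\<^sub>e d\<^sub>e k * coeff_norm n \<alpha> (rexpo d\<^sub>e) \<le> gain_const c\<^sub>e d\<^sub>e k * (c\<^sub>e powr (1 / (2 * real d\<^sub>e)) * ?S)"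
    by (rule mult_left_mono[OF coeff_norm_le_site_norm_sum[OF expand] g])
  also have "\<dots> \<le> ?S / (12 powr (real k / 2) * 3 ^ (k - 1) * (real k)\<^sup>2)"
    by (rule constant_bound[OF k cd S])
  also have "\<dots> = ?S / 12 powr (real k / 2) / 3 ^ (k - 1) / (real k)\<^sup>2" by simp
  also have "\<dots> \<le> (\<Sum>u\<in>{1..3 * n}. sqrt (sq_norm u)) / 3 ^ (k - 1) / (real k)\<^sup>2"
    by (intro divide_right_mono site_norm_bound) auto
  also have "\<dots> \<le> (real k)\<^sup>2 * ?R / (real k)\<^sup>2"
    using assms by (intro divide_right_mono) (simp_all add: prepared_def sum_divide_distrib)
  also have "\<dots> = ?R" using k by simp
  finally show ?thesis .
qed

text \<open>The number of steps depends on the instance; as a halted machine stays put, the run can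
  be padded to the claimed bound. Coins are tossed only after the store \<open>t\<close> is
  reached.\<close>

lemma run_to_end:
  obtains t where "prepared t" "ints t ''i'' 0 = 0" "reals t ''im0'' = (\<lambda>_. 0)"
    "run (1000 * (n * k + length Ps * 2 ^ k)) ([prepare_prog ;; sample_loop], start)
      = map_pmf (Pair []) (iterate_pmf qubit_step n t)"
proof -
  let ?T = "1000 * (n * k + length Ps * 2 ^ k)"
  have "wp prepare_prog start prepare_time prepared"
    by (rule wp_prepare[OF input_start]) (simp_all add: input_store_def)
  then obtain m t where m: "m \<le> prepare_time" "prepared t" "frame prepare_prog start t" "reaches prepare_prog start m t"
    unfolding wp_def by blast
  have t: "ints t ''i'' 0 = 0" "ints t ''n'' 0 = n" "reals t ''im0'' = (\<lambda>_. 0)"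
    using m(3) prepare_writes by (simp_all add: frame_def input_store_def cells_def)
  have y: "yields (prepare_prog ;; sample_loop) start (Suc (m + (n * 14 + 1))) (iterate_pmf qubit_step n t)"
    using yields_Seq[OF yields_reaches[OF m(4)], of sample_loop "n * 14 + 1" "iterate_pmf qubit_step n"]
      yields_sample[OF t(2,1,3)] by (simp add: bind_return_pmf)
  have "n \<le> n * k" "1 \<le> n * k" using n k by auto
  then have "Suc (m + (n * 14 + 1)) \<le> ?T"
  proof -
    have "x \<le> y \<Longrightarrow> y \<le> 600 * (b + a) \<Longrightarrow> n \<le> b \<Longrightarrow> 1 \<le> b \<Longrightarrow> Suc (x + (n * 14 + 1)) \<le> 1000 * (b + a)"
      for x y a b :: nat by (simp add: distrib_left)
    from this[OF m(1) prepare_time_le] show ?thesis using \<open>n \<le> n * k\<close> \<open>1 \<le> n * k\<close> .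
  qed
  then obtain r where r: "?T = Suc (m + (n * 14 + 1)) + r" using le_Suc_ex by blast
  have stay: "run r ([], s) = return_pmf ([], s)" for s by (induction r) (simp_all add: bind_return_pmf)
  have "run ?T ([prepare_prog ;; sample_loop], start) = map_pmf (Pair []) (iterate_pmf qubit_step n t)"
    unfolding r run_add using y unfolding yields_def
    by (simp add: bind_map_pmf stay map_pmf_def[symmetric] del: run.simps)
  then show ?thesis using that[of t] m(2) t by blast
qed

end

theorem theorem5:
  shows "\<exists>(prog :: com) (B :: nat).
    \<forall>(n :: nat) (k :: nat) (\<alpha> :: pauli list \<Rightarrow> real) (c\<^sub>e :: real) (d\<^sub>e :: nat) (Ps :: pauli list list).
      n \<ge> 1 \<longrightarrow> k \<ge> 1 \<longrightarrow> k_local n k \<alpha> \<longrightarrow> expansion n \<alpha> c\<^sub>e d\<^sub>e \<longrightarrow>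
      distinct Ps \<longrightarrow> set Ps = {P\<in>paulis n. \<alpha> P \<noteq> 0} \<longrightarrow>
      (let s = input_store n k d\<^sub>e \<alpha> Ps;
           T = B * (n * k + nnz n \<alpha> * 2 ^ k);
           H = hamiltonian n \<alpha>;
           \<Psi> = output_pmf prog s T;
           E = measure_pmf.expectation \<Psi> (\<lambda>q. expval n H (product_state n q));
           gain = gain_const c\<^sub>e d\<^sub>e k * coeff_norm n \<alpha> (rexpo d\<^sub>e)
       in halts_within prog s T \<and>
          (\<forall>q\<in>set_pmf \<Psi>. \<forall>i<n. unit_qubit (q i)) \<and>
          (\<forall>\<mu>. haar_state_measure n \<mu> \<longrightarrow>
             E \<ge> (\<integral>\<phi>. expval n H \<phi> \<partial>\<mu>) + gain \<or>
             E \<le> (\<integral>\<phi>. expval n H \<phi> \<partial>\<mu>) - gain))"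
proof (intro exI[of _ "prepare_prog ;; sample_loop"] exI[of _ 1000] allI impI)
  fix n k :: nat and \<alpha> :: "pauli list \<Rightarrow> real" and c\<^sub>e :: real and d\<^sub>e :: nat and Ps :: "pauli list list"
  assume "n \<ge> 1" "k \<ge> 1" "k_local n k \<alpha>" "expansion n \<alpha> c\<^sub>e d\<^sub>e" "distinct Ps"
    "set Ps = {P\<in>paulis n. \<alpha> P \<noteq> 0}"
  then interpret pauli_instance n k \<alpha> c\<^sub>e d\<^sub>e Ps by unfold_locales
  have nnz: "nnz n \<alpha> = length Ps" using distinct_card[OF dist] set_Ps by (simp add: nnz_def)
  obtain t where t: "prepared t" "ints t ''i'' 0 = 0" "reals t ''im0'' = (\<lambda>_. 0)"
    and run: "run (1000 * (n * k + length Ps * 2 ^ k)) ([prepare_prog ;; sample_loop], start)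
      = map_pmf (Pair []) (iterate_pmf qubit_step n t)"
    by (rule run_to_end)
  let ?T = "1000 * (n * k + nnz n \<alpha> * 2 ^ k)"
  let ?\<Psi> = "output_pmf (prepare_prog ;; sample_loop) start ?T"
  let ?E = "measure_pmf.expectation ?\<Psi> (\<lambda>q. expval n (hamiltonian n \<alpha>) (product_state n q))"
  let ?gain = "gain_const c\<^sub>e d\<^sub>e k * coeff_norm n \<alpha> (rexpo d\<^sub>e)"
  let ?R = "ray_poly (reals t ''v'') (reals t ''sg'') (reals t ''tb'' 0)"
  have \<Psi>: "?\<Psi> = map_pmf output_qubits (iterate_pmf qubit_step n t)"
    unfolding output_pmf_def nnz run by (simp add: pmf.map_comp o_def)
  have "halts_within (prepare_prog ;; sample_loop) start ?T"
    unfolding halts_within_def nnz run by auto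
  moreover have "\<forall>q\<in>set_pmf ?\<Psi>. \<forall>i<n. unit_qubit (q i)"
  proof (intro ballI allI impI)
    fix q i assume "q \<in> set_pmf ?\<Psi>" and i: "i < n"
    then obtain s' where s': "s' \<in> set_pmf (iterate_pmf qubit_step n t)" "q = output_qubits s'"
      unfolding \<Psi> by auto
    have "\<exists>x y z. output_qubits s' i = corner x y z"
      using iterate_support[OF s'(1) t(3), of i] t(2) i by simp
    then show "unit_qubit (q i)" using s'(2) unit_corner by auto
  qed
  moreover have "?E \<ge> (\<integral>\<phi>. expval n (hamiltonian n \<alpha>) \<phi> \<partial>\<mu>) + ?gain \<or>
      ?E \<le> (\<integral>\<phi>. expval n (hamiltonian n \<alpha>) \<phi> \<partial>\<mu>) - ?gain" if "haar_state_measure n \<mu>" for \<mu>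
  proof -
    have "?E = \<alpha> (pauli_id n) + ?R" unfolding \<Psi> using expected_value[OF t] by simp
    moreover have "(\<integral>\<phi>. expval n (hamiltonian n \<alpha>) \<phi> \<partial>\<mu>) = \<alpha> (pauli_id n)"
      by (rule haar_hamiltonian[OF that finite_paulis])
    moreover have "?gain \<le> \<bar>?R\<bar>" by (rule gain_le[OF t(1)])
    \<comment> \<open>The sign of \<open>?R\<close> decides which alternative holds.\<close>
    ultimately show ?thesis by linarith
  qed
  ultimately show "let s = start; T = ?T; H = hamiltonian n \<alpha>; \<Psi> = output_pmf (prepare_prog ;; sample_loop) s T;
      E = measure_pmf.expectation \<Psi> (\<lambda>q. expval n H (product_state n q)); gain = ?gain
    in halts_within (prepare_prog ;; sample_loop) s T \<and> (\<forall>q\<in>set_pmf \<Psi>. \<forall>i<n. unit_qubit (q i)) \<and>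
      (\<forall>\<mu>. haar_state_measure n \<mu> \<longrightarrow> E \<ge> (\<integral>\<phi>. expval n H \<phi> \<partial>\<mu>) + gain \<or> E \<le> (\<integral>\<phi>. expval n H \<phi> \<partial>\<mu>) - gain)"
    unfolding Let_def by blast
qed

end
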